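(* Let $s\in\mathbb{R}\setminus\{0\}$ and $0<\varepsilon<R$. For every $0<h<\varepsilon$ let $W_{h,\varepsilon}$ be the (unique) minimizer in $\mathscr{B}_{\varepsilon,R}$ of the functional $$\mathcal{I}_{h,\varepsilon}(w)=\mathcal{G}(w;B_R(0))+\frac{s}{2\pi(\varepsilon-h)}\int_{\partial B_{\varepsilon-h}(0)}\frac{w(x+\frac h2e_1)-w(x-\frac h2e_1)}{h}\,d\mathcal{H}^1(x),$$ and let $W_{0,\varepsilon}$ be the (unique) minimizer in $\mathscr{B}_{\varepsilon,R}$ of the functional $$\mathcal{I}_{0,\varepsilon}(w)=\mathcal{G}(w;B_R(0))+\frac{s}{2\pi\varepsilon}\int_{\partial B_\varepsilon(0)}\partial_{x_1}w\,d\mathcal{H}^1.$$ Then, as $h\to0$, $W_{h,\varepsilon}\to W_{0,\varepsilon}$ strongly in $H^2(B_R(0))$. Moreover, $\mathcal{I}_{h,\varepsilon}(W_{h,\varepsilon})\to\mathcal{I}_{0,\varepsilon}(W_{0,\varepsilon})$ as $h\to0$.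
   Context: $E>0$ and $-1<\nu<\frac12$ are constants; $e_1=(1;0)$; $B_r(0)$ is the open disc of radius $r$ centered at the origin of $\mathbb{R}^2$. For an open set $A\subset\mathbb{R}^2$, $\mathcal{G}(w;A)=\frac12\frac{1+\nu}{E}\int_A\big(|\nabla^2w|^2-\nu|\Delta w|^2\big)\,dx$. The class of admissible functions is $\mathscr{B}_{\varepsilon,R}=\{w\in H^2_0(B_R(0)):\ w=a\text{ in }B_\varepsilon(0)\text{ for some affine function }a\}$. (In the paper $\mathcal{I}_{h,\varepsilon}$ is associated with the rescaled disclination dipole $\theta_h/h$, $\theta_h=s\delta_{(h/2;0)}-s\delta_{(-h/2;0)}$, and $\mathcal{I}_{0,\varepsilon}$ with the edge dislocation $s e_2\delta_0$.) *)

theory Defs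
  imports "HOL-Analysis.Analysis"
begin

section \<open>Smooth functions\<close>

definition partial_deriv :: "'n \<Rightarrow> (real^'n \<Rightarrow> real) \<Rightarrow> real^'n \<Rightarrow> real" where
  "partial_deriv i f x = frechet_derivative f (at x) (axis i 1)"

primrec C_k :: "nat \<Rightarrow> (real^'n \<Rightarrow> real) \<Rightarrow> bool" where
  "C_k 0 f \<longleftrightarrow> continuous_on UNIV f"
| "C_k (Suc k) f \<longleftrightarrow> (\<forall>x. f differentiable (at x)) \<and> (\<forall>i. C_k k (partial_deriv i f))"

definition smooth :: "(real^'n \<Rightarrow> real) \<Rightarrow> bool" where
  "smooth f \<longleftrightarrow> (\<forall>k. C_k k f)"

definition test_functions :: "(real^'n) set \<Rightarrow> (real^'n \<Rightarrow> real) set" where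
  "test_functions \<Omega> =
     {\<phi>. smooth \<phi> \<and> compact (closure {x. \<phi> x \<noteq> 0}) \<and> closure {x. \<phi> x \<noteq> 0} \<subseteq> \<Omega>}"

section \<open>Sobolev spaces on an open set\<close>

text \<open>
  Elements of Lebesgue and Sobolev spaces are represented by functions on the whole space; only
  their values almost everywhere on \<open>\<Omega>\<close> matter.
\<close>

definition locally_integrable :: "(real^'n) set \<Rightarrow> (real^'n \<Rightarrow> real) \<Rightarrow> bool" where
  "locally_integrable \<Omega> f \<longleftrightarrow> (\<forall>K. compact K \<and> K \<subseteq> \<Omega> \<longrightarrow> integrable (lebesgue_on K) f)"

definition L2 :: "(real^'n) set \<Rightarrow> (real^'n \<Rightarrow> real) set" where
  "L2 \<Omega> = {f. f \<in> borel_measurable (lebesgue_on \<Omega>) \<and> integrable (lebesgue_on \<Omega>) (\<lambda>x. (f x)\<^sup>2)}"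

definition has_weak_deriv ::
    "(real^'n) set \<Rightarrow> 'n \<Rightarrow> (real^'n \<Rightarrow> real) \<Rightarrow> (real^'n \<Rightarrow> real) \<Rightarrow> bool" where
  "has_weak_deriv \<Omega> i f g \<longleftrightarrow>
     locally_integrable \<Omega> f \<and> locally_integrable \<Omega> g \<and>
     (\<forall>\<phi>\<in>test_functions \<Omega>.
        (LINT x|lebesgue_on \<Omega>. f x * partial_deriv i \<phi> x) = - (LINT x|lebesgue_on \<Omega>. g x * \<phi> x))"

text \<open>A representative of the weak derivative, which is determined up to a null set.\<close>

definition weak_deriv :: "(real^'n) set \<Rightarrow> 'n \<Rightarrow> (real^'n \<Rightarrow> real) \<Rightarrow> real^'n \<Rightarrow> real" where
  "weak_deriv \<Omega> i f = (SOME g. has_weak_deriv \<Omega> i f g)"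

definition H1 :: "(real^'n) set \<Rightarrow> (real^'n \<Rightarrow> real) set" where
  "H1 \<Omega> = {f \<in> L2 \<Omega>. \<forall>i. \<exists>g\<in>L2 \<Omega>. has_weak_deriv \<Omega> i f g}"

definition H2 :: "(real^'n) set \<Rightarrow> (real^'n \<Rightarrow> real) set" where
  "H2 \<Omega> = {f \<in> H1 \<Omega>. \<forall>i. weak_deriv \<Omega> i f \<in> H1 \<Omega>}"

definition H1_norm :: "(real^'n) set \<Rightarrow> (real^'n \<Rightarrow> real) \<Rightarrow> real" where
  "H1_norm \<Omega> f =
     sqrt ((LINT x|lebesgue_on \<Omega>. (f x)\<^sup>2)
         + (\<Sum>i\<in>UNIV. LINT x|lebesgue_on \<Omega>. (weak_deriv \<Omega> i f x)\<^sup>2))"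

definition H2_norm :: "(real^'n) set \<Rightarrow> (real^'n \<Rightarrow> real) \<Rightarrow> real" where
  "H2_norm \<Omega> f =
     sqrt ((LINT x|lebesgue_on \<Omega>. (f x)\<^sup>2)
         + (\<Sum>i\<in>UNIV. LINT x|lebesgue_on \<Omega>. (weak_deriv \<Omega> i f x)\<^sup>2)
         + (\<Sum>i\<in>UNIV. \<Sum>j\<in>UNIV. LINT x|lebesgue_on \<Omega>. (weak_deriv \<Omega> j (weak_deriv \<Omega> i f) x)\<^sup>2))"

text \<open>The closure of the test functions in \<open>H2 \<Omega>\<close>.\<close>

definition H2_0 :: "(real^'n) set \<Rightarrow> (real^'n \<Rightarrow> real) set" where
  "H2_0 \<Omega> = {w \<in> H2 \<Omega>. \<exists>\<phi>. (\<forall>n. \<phi> n \<in> test_functions \<Omega>) \<and>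
                 (\<lambda>n. H2_norm \<Omega> (\<lambda>x. w x - \<phi> n x)) \<longlonglongrightarrow> 0}"

section \<open>One-dimensional Hausdorff measure, pointwise values and traces\<close>

text \<open>Normalised so that a segment has its length as measure.\<close>

definition hausdorff_outer1 :: "'a::metric_space set \<Rightarrow> ennreal" where
  "hausdorff_outer1 A =
     (SUP \<delta>\<in>{0::real<..}.
        INF C\<in>{C::nat \<Rightarrow> 'a set. A \<subseteq> (\<Union>i. C i) \<and> (\<forall>i. bounded (C i) \<and> diameter (C i) \<le> \<delta>)}.
          \<Sum>i. ennreal (diameter (C i)))"

text \<open>The restriction of the one-dimensional Hausdorff measure to the Borel subsets of \<open>S\<close>.\<close>

definition hausdorff1_on :: "'a::metric_space set \<Rightarrow> 'a measure" where
  "hausdorff1_on S = measure_of S (sets (restrict_space borel S)) hausdorff_outer1"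

text \<open>
  Evaluating a Sobolev function at points means evaluating its continuous representative, which
  on an open set is unique if it exists.
\<close>

definition continuous_rep :: "(real^'n) set \<Rightarrow> (real^'n \<Rightarrow> real) \<Rightarrow> real^'n \<Rightarrow> real" where
  "continuous_rep \<Omega> w =
     (SOME v. continuous_on \<Omega> v \<and> (AE x in lebesgue_on \<Omega>. v x = w x))"

text \<open>
  The trace of \<open>g \<in> H1 \<Omega>\<close> on a curve \<open>S\<close> contained in the closure of \<open>\<Omega>\<close>, as the limit in
  \<open>L\<^sup>2(S)\<close> of the restrictions of smooth functions converging to \<open>g\<close> in \<open>H1 \<Omega>\<close>.
\<close>

definition is_trace ::
    "(real^'n) set \<Rightarrow> (real^'n) set \<Rightarrow> (real^'n \<Rightarrow> real) \<Rightarrow> (real^'n \<Rightarrow> real) \<Rightarrow> bool" where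
  "is_trace \<Omega> S g t \<longleftrightarrow>
     g \<in> H1 \<Omega> \<and> t \<in> borel_measurable (hausdorff1_on S) \<and>
     integrable (hausdorff1_on S) (\<lambda>x. (t x)\<^sup>2) \<and>
     (\<exists>\<phi>. (\<forall>n. smooth (\<phi> n) \<and> \<phi> n \<in> H1 \<Omega>) \<and>
          (\<lambda>n. H1_norm \<Omega> (\<lambda>x. g x - \<phi> n x)) \<longlonglongrightarrow> 0 \<and>
          (\<lambda>n. LINT x|hausdorff1_on S. (t x - \<phi> n x)\<^sup>2) \<longlonglongrightarrow> 0)"

definition trace_on :: "(real^'n) set \<Rightarrow> (real^'n) set \<Rightarrow> (real^'n \<Rightarrow> real) \<Rightarrow> real^'n \<Rightarrow> real" where
  "trace_on \<Omega> S g = (SOME t. is_trace \<Omega> S g t)"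

section \<open>The energies\<close>

abbreviation e1 :: "real^2" where
  "e1 \<equiv> axis 1 1"

definition elastic_energy :: "real \<Rightarrow> real \<Rightarrow> (real^2 \<Rightarrow> real) \<Rightarrow> (real^2) set \<Rightarrow> real" where
  "elastic_energy E \<nu> w A =
     1/2 * ((1 + \<nu>) / E) *
     (LINT x|lebesgue_on A.
        (\<Sum>i\<in>UNIV. \<Sum>j\<in>UNIV. (weak_deriv A j (weak_deriv A i w) x)\<^sup>2)
        - \<nu> * (\<Sum>i\<in>UNIV. weak_deriv A i (weak_deriv A i w) x)\<^sup>2)"

definition admissible :: "real \<Rightarrow> real \<Rightarrow> (real^2 \<Rightarrow> real) set" where
  "admissible \<epsilon> R =
     {w \<in> H2_0 (ball 0 R). \<exists>b c. AE x in lebesgue_on (ball 0 \<epsilon>). w x = b \<bullet> x + c}"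

definition dipole_energy ::
    "real \<Rightarrow> real \<Rightarrow> real \<Rightarrow> real \<Rightarrow> real \<Rightarrow> real \<Rightarrow> (real^2 \<Rightarrow> real) \<Rightarrow> real" where
  "dipole_energy E \<nu> s R \<epsilon> h w =
     elastic_energy E \<nu> w (ball 0 R)
     + s / (2 * pi * (\<epsilon> - h)) *
       (LINT x|hausdorff1_on (sphere 0 (\<epsilon> - h)).
          (continuous_rep (ball 0 R) w (x + (h/2) *\<^sub>R e1)
           - continuous_rep (ball 0 R) w (x - (h/2) *\<^sub>R e1)) / h)"

text \<open>
  The weak derivative of \<open>w\<close> is only in \<open>H1\<close> of the disc, so its values on the circle are
  understood in the sense of traces.
\<close>

definition dislocation_energy ::
    "real \<Rightarrow> real \<Rightarrow> real \<Rightarrow> real \<Rightarrow> real \<Rightarrow> (real^2 \<Rightarrow> real) \<Rightarrow> real" where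
  "dislocation_energy E \<nu> s R \<epsilon> w =
     elastic_energy E \<nu> w (ball 0 R)
     + s / (2 * pi * \<epsilon>) *
       (LINT x|hausdorff1_on (sphere 0 \<epsilon>).
          trace_on (ball 0 R) (sphere 0 \<epsilon>) (weak_deriv (ball 0 R) 1 w) x)"

end

theory Submission
  imports Defs
begin

text \<open>
  The two functionals coincide on the admissible class, so there is nothing to pass to the limit
  in. If \<open>w\<close> is admissible, then \<open>w x = b \<bullet> x + c\<close> for almost every \<open>x\<close> in the disc
  \<open>B\<^sub>\<epsilon>\<close>. For \<open>0 < h < \<epsilon>\<close> the points \<open>x \<plusminus> (h/2) e\<^sub>1\<close> with \<open>|x| = \<epsilon> - h\<close> stay inside \<open>B\<^sub>\<epsilon>\<close>, where
  the difference quotient is exactly \<open>b\<^sub>1\<close>; and the trace of \<open>\<partial>\<^sub>1 w\<close> on \<open>\<partial>B\<^sub>\<epsilon>\<close> can be found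
  from the inside and is \<open>b\<^sub>1\<close> as well. Since the length of a circle is proportional to its radius, both linear terms
  equal \<open>s \<kappa> b\<^sub>1\<close> with the same constant \<open>\<kappa>\<close> (which is \<open>1\<close>, but only its independence of the radius
  matters). Hence \<open>W h\<close> and \<open>W0\<close> minimise one functional, the elastic energy plus a linear term.
  By the parallelogram identity the elastic energy of \<open>(W h - W0) / 2\<close> is at most \<open>0\<close>; as
  \<open>-1 < \<nu> < 1/2\<close>, it dominates a positive multiple of the squared \<open>L\<^sup>2\<close> norm of the Hessian, and
  Poincare's inequality on \<open>H\<^sup>2\<^sub>0\<close> shows that the \<open>H\<^sup>2\<close> norm of \<open>W h - W0\<close> vanishes for every
  \<open>h < \<epsilon>\<close>.

  Most of the work lies in the facts that give the two linear terms their meaning. Weak derivatives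
  are unique almost everywhere (\<open>fundamental_lemma\<close>, with explicit smooth bump functions), so that
  they are linear and local. Functions in \<open>H\<^sup>2\<^sub>0\<close> of a disc have a continuous representative
  (\<open>H2_0_continuous_representative\<close>), because a planar test function is bounded by the \<open>L\<^sup>1\<close> norm of
  its mixed second derivative. The trace of \<open>\<partial>\<^sub>1 w\<close> on \<open>\<partial>B\<^sub>\<epsilon>\<close> exists and is the constant \<open>b\<^sub>1\<close>
  (\<open>is_trace_const\<close>, \<open>integral_is_trace\<close>), by a trace inequality on \<open>\<partial>B\<^sub>\<epsilon>\<close>
  (\<open>trace_inequality\<close>) obtained in polar coordinates. For the Hausdorff measure of circles two
  properties suffice: it scales with the radius (\<open>measure_hausdorff1_sphere\<close>), and it is bounded by
  arc length (\<open>nn_integral_hausdorff1_sphere_le\<close>).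
\<close>

section \<open>Partial derivatives and smooth functions\<close>

lemma partial_deriv_eqI:
  "(f has_derivative f') (at x) \<Longrightarrow> partial_deriv i f x = f' (axis i 1)"
  unfolding partial_deriv_def by (metis frechet_derivative_at)

lemma partial_deriv_const: "partial_deriv i (\<lambda>x. c) = (\<lambda>x. 0)"
  by (rule ext, rule partial_deriv_eqI[OF has_derivative_const])

lemma partial_deriv_add:
  assumes "\<And>x. f differentiable (at x)" "\<And>x. g differentiable (at x)"
  shows "partial_deriv i (\<lambda>x. f x + g x) = (\<lambda>x. partial_deriv i f x + partial_deriv i g x)"
  using assms
  by (intro ext, subst partial_deriv_eqI[OF has_derivative_add])
     (auto simp: frechet_derivative_works partial_deriv_def)

lemma partial_deriv_mult:
  assumes "\<And>x. f differentiable (at x)" "\<And>x. g differentiable (at x)"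
  shows "partial_deriv i (\<lambda>x. f x * g x) = (\<lambda>x. f x * partial_deriv i g x + partial_deriv i f x * g x)"
  using assms
  by (intro ext, subst partial_deriv_eqI[OF has_derivative_mult])
     (auto simp: frechet_derivative_works partial_deriv_def)

lemma C_k_continuous_on: "C_k k f \<Longrightarrow> continuous_on S f"
  by (cases k) (auto intro: continuous_on_subset differentiable_imp_continuous_on
      simp: differentiable_on_def differentiable_at_withinI)

lemma C_k_SucD: "C_k (Suc k) f \<Longrightarrow> C_k k f"
proof (induction k arbitrary: f)
  case 0
  show ?case using C_k_continuous_on[OF 0] by simp
next
  case (Suc k)
  then have "C_k k (partial_deriv i f)" for i by simp
  with Suc.prems show ?case by simp
qed

lemma C_k_const: "C_k k (\<lambda>x. c)"
  by (induction k arbitrary: c) (auto simp: partial_deriv_const)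

lemma C_k_add: "C_k k f \<Longrightarrow> C_k k g \<Longrightarrow> C_k k (\<lambda>x. f x + g x)"
proof (induction k arbitrary: f g)
  case 0
  then show ?case by (simp add: continuous_on_add)
next
  case (Suc k)
  then show ?case by (simp add: partial_deriv_add)
qed

lemma C_k_mult: "C_k k f \<Longrightarrow> C_k k g \<Longrightarrow> C_k k (\<lambda>x. f x * g x)"
proof (induction k arbitrary: f g)
  case 0
  then show ?case by (simp add: continuous_on_mult)
next
  case (Suc k)
  have "C_k k f" "C_k k g" using Suc.prems C_k_SucD by blast+
  then show ?case using Suc by (simp add: partial_deriv_mult C_k_add)
qed

lemma smooth_const: "smooth (\<lambda>x. c)"
  by (simp add: smooth_def C_k_const)

lemma smooth_add: "smooth f \<Longrightarrow> smooth g \<Longrightarrow> smooth (\<lambda>x. f x + g x)"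
  by (simp add: smooth_def C_k_add)

lemma smooth_mult: "smooth f \<Longrightarrow> smooth g \<Longrightarrow> smooth (\<lambda>x. f x * g x)"
  by (simp add: smooth_def C_k_mult)

lemma smooth_prod: "(\<And>i. i \<in> I \<Longrightarrow> smooth (f i)) \<Longrightarrow> smooth (\<lambda>x. \<Prod>i\<in>I. f i x)"
  by (induction I rule: infinite_finite_induct) (auto simp: smooth_const smooth_mult)

lemma smooth_partial_deriv: "smooth f \<Longrightarrow> smooth (partial_deriv i f)"
  unfolding smooth_def using C_k.simps(2) by blast

lemma smooth_differentiable: "smooth f \<Longrightarrow> f differentiable (at x)"
  unfolding smooth_def using C_k.simps(2) by blast

lemma smooth_continuous_on: "smooth f \<Longrightarrow> continuous_on S f"
  unfolding smooth_def using C_k_continuous_on by blast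

lemma smooth_has_derivative:
  "smooth f \<Longrightarrow> (f has_derivative (\<lambda>h. \<Sum>i\<in>UNIV. h $ i * partial_deriv i f x)) (at x)"
proof -
  assume "smooth f"
  then have D: "(f has_derivative frechet_derivative f (at x)) (at x)"
    using smooth_differentiable frechet_derivative_works by blast
  then interpret linear "frechet_derivative f (at x)"
    by (rule has_derivative_linear)
  have "frechet_derivative f (at x) h = (\<Sum>i\<in>UNIV. h $ i * partial_deriv i f x)" for h
  proof -
    have "frechet_derivative f (at x) h = frechet_derivative f (at x) (\<Sum>i\<in>UNIV. h $ i *\<^sub>R axis i 1)"
      using basis_expansion[of h] by (simp add: scalar_mult_eq_scaleR)
    then show ?thesis by (simp add: sum scale partial_deriv_def)
  qed
  then have "frechet_derivative f (at x) = (\<lambda>h. \<Sum>i\<in>UNIV. h $ i * partial_deriv i f x)" by (rule ext)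
  with D show ?thesis by simp
qed

subsection \<open>Test functions\<close>

lemma test_functionD:
  assumes "\<phi> \<in> test_functions \<Omega>"
  shows "smooth \<phi>" "compact (closure {x. \<phi> x \<noteq> 0})" "closure {x. \<phi> x \<noteq> 0} \<subseteq> \<Omega>"
  using assms by (auto simp: test_functions_def)

lemma test_functionI:
  assumes "smooth \<phi>" "compact K" "K \<subseteq> \<Omega>" "\<And>x. x \<notin> K \<Longrightarrow> \<phi> x = 0"
  shows "\<phi> \<in> test_functions \<Omega>"
proof -
  have "closure {x. \<phi> x \<noteq> 0} \<subseteq> K"
    using assms by (intro closure_minimal compact_imp_closed) auto
  moreover from this have "compact (closure {x. \<phi> x \<noteq> 0})"
    using compact_Int_closed[OF assms(2) closed_closure[of "{x. \<phi> x \<noteq> 0}"]]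
    by (simp add: inf.absorb2)
  ultimately show ?thesis
    using assms by (simp add: test_functions_def)
qed

lemma test_function_zero: "\<phi> \<in> test_functions \<Omega> \<Longrightarrow> x \<notin> closure {x. \<phi> x \<noteq> 0} \<Longrightarrow> \<phi> x = 0"
  using closure_subset[of "{x. \<phi> x \<noteq> 0}"] by auto

lemma test_function_eq_0: "\<phi> \<in> test_functions \<Omega> \<Longrightarrow> x \<notin> \<Omega> \<Longrightarrow> \<phi> x = 0"
  using test_function_zero[of \<phi> \<Omega> x] test_functionD(3)[of \<phi> \<Omega>] by auto

lemma test_function_mono: "\<phi> \<in> test_functions A \<Longrightarrow> A \<subseteq> B \<Longrightarrow> \<phi> \<in> test_functions B"
  by (auto simp: test_functions_def)

lemma partial_deriv_outside_support:
  assumes "x \<notin> closure {x. \<phi> x \<noteq> 0}"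
  shows "partial_deriv i \<phi> x = 0"
proof -
  let ?U = "- closure {x. \<phi> x \<noteq> 0}"
  have U: "open ?U" "x \<in> ?U" using assms by auto
  have "(\<phi> has_derivative (\<lambda>h. 0)) (at x)"
  proof (rule has_derivative_transform_within_open[OF _ U])
    show "((\<lambda>x. 0::real) has_derivative (\<lambda>h. 0)) (at x)" by simp
    show "0 = \<phi> y" if "y \<in> ?U" for y using that closure_subset[of "{x. \<phi> x \<noteq> 0}"] by auto
  qed
  then show ?thesis by (rule partial_deriv_eqI)
qed

lemma test_function_partial_deriv:
  assumes "\<phi> \<in> test_functions \<Omega>"
  shows "partial_deriv i \<phi> \<in> test_functions \<Omega>"
  using test_functionD[OF assms]
  by (intro test_functionI[of _ "closure {x. \<phi> x \<noteq> 0}"])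
     (simp_all add: smooth_partial_deriv partial_deriv_outside_support)

lemma test_function_lincomb:
  assumes "\<phi> \<in> test_functions \<Omega>" "\<psi> \<in> test_functions \<Omega>"
  shows "(\<lambda>x. a * \<phi> x + b * \<psi> x) \<in> test_functions \<Omega>"
proof (rule test_functionI)
  show "smooth (\<lambda>x. a * \<phi> x + b * \<psi> x)"
    by (rule smooth_add[OF smooth_mult[OF smooth_const test_functionD(1)[OF assms(1)]]
                           smooth_mult[OF smooth_const test_functionD(1)[OF assms(2)]]])
  show "compact (closure {x. \<phi> x \<noteq> 0} \<union> closure {x. \<psi> x \<noteq> 0})"
    by (rule compact_Un[OF test_functionD(2)[OF assms(1)] test_functionD(2)[OF assms(2)]])
  show "closure {x. \<phi> x \<noteq> 0} \<union> closure {x. \<psi> x \<noteq> 0} \<subseteq> \<Omega>"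
    by (rule Un_least[OF test_functionD(3)[OF assms(1)] test_functionD(3)[OF assms(2)]])
  show "a * \<phi> x + b * \<psi> x = 0" if "x \<notin> closure {x. \<phi> x \<noteq> 0} \<union> closure {x. \<psi> x \<noteq> 0}" for x
  proof -
    have "\<phi> x = 0" "\<psi> x = 0"
      using that test_function_zero[OF assms(1), of x] test_function_zero[OF assms(2), of x] by auto
    then show ?thesis by simp
  qed
qed

subsection \<open>Smooth approximations of the indicator of a box\<close>

text \<open>
  The functions \<open>t \<mapsto> exp (-1/t) / t\<^sup>m\<close>, extended by \<open>0\<close> to the nonpositive half line. This
  family is closed under differentiation up to linear combinations, which makes every member
  smooth.
\<close>

definition flat :: "nat \<Rightarrow> real \<Rightarrow> real" where
  "flat m t = (if t > 0 then exp (- 1 / t) / t ^ m else 0)"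

lemma flat_tendsto_0: "(flat m \<longlongrightarrow> 0) (at 0)"
proof (rule filterlim_split_at)
  show "(flat m \<longlongrightarrow> 0) (at_left 0)"
    by (rule tendsto_eventually) (auto simp: flat_def eventually_at_filter)
  have "((\<lambda>t. (inverse t) ^ m / exp (inverse t)) \<longlongrightarrow> 0) (at_right (0::real))"
    by (rule filterlim_compose[OF tendsto_power_div_exp_0 filterlim_inverse_at_top_right])
  moreover have "\<forall>\<^sub>F t in at_right 0. (inverse t) ^ m / exp (inverse t) = flat m t"
    by (auto simp: eventually_at_filter flat_def exp_minus inverse_eq_divide power_one_over)
  ultimately show "(flat m \<longlongrightarrow> 0) (at_right 0)"
    by (rule Lim_transform_eventually)
qed

lemma flat_DERIV: "(flat m has_real_derivative flat (m + 2) t - real m * flat (m + 1) t) (at t)"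
proof -
  consider "t > 0" | "t = 0" | "t < 0" by linarith
  then show ?thesis
  proof cases
    case 1
    have "((\<lambda>t. exp (- 1 / t) / t ^ m) has_real_derivative
            exp (- 1 / t) / t ^ (m + 2) - real m * (exp (- 1 / t) / t ^ (m + 1))) (at t)"
    proof (cases m)
      case 0
      then show ?thesis using 1
        by (auto intro!: derivative_eq_intros simp: field_simps power2_eq_square)
    next
      case (Suc k)
      have "((\<lambda>t. exp (- 1 / t)) has_real_derivative exp (- 1 / t) * (1 / t\<^sup>2)) (at t)"
        using 1 by (auto intro!: derivative_eq_intros simp: field_simps power2_eq_square)
      moreover have "((\<lambda>t. t ^ m) has_real_derivative real m * t ^ k) (at t)"
        unfolding Suc by (rule DERIV_pow[THEN DERIV_cong]) simp
      ultimately have "((\<lambda>t. exp (- 1 / t) / t ^ m) has_real_derivative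
          (exp (- 1 / t) * (1 / t\<^sup>2) * t ^ m - exp (- 1 / t) * (real m * t ^ k)) / (t ^ m * t ^ m)) (at t)"
        using 1 by (intro DERIV_divide) auto
      then show ?thesis
        by (rule DERIV_cong) (use 1 Suc in \<open>simp add: field_simps power2_eq_square\<close>)
    qed
    then have "((\<lambda>t. exp (- 1 / t) / t ^ m) has_real_derivative
            flat (m + 2) t - real m * flat (m + 1) t) (at t)"
      using 1 by (simp add: flat_def)
    then show ?thesis
      by (rule has_field_derivative_transform_within_open[where S = "{0<..}"])
         (use 1 in \<open>auto simp: flat_def\<close>)
  next
    case 2
    have "\<forall>\<^sub>F h in at 0. flat (m + 1) h = (flat m (0 + h) - flat m 0) / h"
      by (auto simp: eventually_at_filter flat_def)
    then have "((\<lambda>h. (flat m (0 + h) - flat m 0) / h) \<longlongrightarrow> 0) (at 0)"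
      by (rule Lim_transform_eventually[OF flat_tendsto_0])
    then show ?thesis unfolding 2 DERIV_def by (simp add: flat_def)
  next
    case 3
    have "((\<lambda>t. 0) has_real_derivative flat (m + 2) t - real m * flat (m + 1) t) (at t)"
      using 3 by (simp add: flat_def)
    then show ?thesis
      by (rule has_field_derivative_transform_within_open[where S = "{..<0}"])
         (use 3 in \<open>auto simp: flat_def\<close>)
  qed
qed

lemma C_k_flat_affine: "C_k k (\<lambda>x::real^'n. flat m (c * x $ i + d))"
proof (induction k arbitrary: m)
  case 0
  have "continuous_on UNIV (flat m)"
    using flat_DERIV by (meson DERIV_isCont continuous_at_imp_continuous_on)
  then show ?case
    by (simp only: C_k.simps) (rule continuous_on_compose2[of UNIV],
        auto intro!: continuous_on_add continuous_on_mult continuous_on_const continuous_on_component continuous_on_id)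
next
  case (Suc k)
  let ?F' = "\<lambda>(x::real^'n) y. (c * y $ i) * (flat (m + 2) (c * x $ i + d) - real m * flat (m + 1) (c * x $ i + d))"
  have der: "((\<lambda>x. flat m (c * x $ i + d)) has_derivative ?F' x) (at x)" for x :: "real^'n"
    by (rule DERIV_compose_FDERIV[OF flat_DERIV])
       (intro has_derivative_add_const has_derivative_mult_right bounded_linear_imp_has_derivative
          bounded_linear_vec_nth)
  have pd: "partial_deriv j (\<lambda>x. flat m (c * x $ i + d)) =
      (\<lambda>x::real^'n. (c * axis j 1 $ i) * flat (m + 2) (c * x $ i + d)
            + (- (c * axis j 1 $ i) * real m) * flat (m + 1) (c * x $ i + d))" for j
    by (rule ext, subst partial_deriv_eqI[OF der]) (simp add: algebra_simps)
  have "C_k k (partial_deriv j (\<lambda>x::real^'n. flat m (c * x $ i + d)))" for j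
    unfolding pd by (rule C_k_add[OF C_k_mult[OF C_k_const Suc] C_k_mult[OF C_k_const Suc]])
  moreover have "(\<lambda>x. flat m (c * x $ i + d)) differentiable (at x)" for x :: "real^'n"
    using der differentiableI by blast
  ultimately show ?case by simp
qed

text \<open>Smooth functions with values in \<open>[0, 1]\<close> that vanish outside \<open>box a b\<close>; for \<open>n > 0\<close> they are positive
  on \<open>box a b\<close>.\<close>

definition bump :: "nat \<Rightarrow> real^'n \<Rightarrow> real^'n \<Rightarrow> real^'n \<Rightarrow> real" where
  "bump n a b x = (\<Prod>i\<in>UNIV. flat 0 (real n * (x $ i - a $ i)) * flat 0 (real n * (b $ i - x $ i)))"

lemma flat_0_bounds: "0 \<le> flat 0 t" "flat 0 t \<le> 1"
  by (auto simp: flat_def)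

lemma bump_bounds: "0 \<le> bump n a b x" "bump n a b x \<le> 1"
  unfolding bump_def
  by (simp_all add: prod_nonneg prod_le_1 mult_le_one flat_0_bounds)

lemma bump_test_function:
  fixes a b :: "real^'n"
  assumes "cbox a b \<subseteq> \<Omega>"
  shows "bump n a b \<in> test_functions \<Omega>"
proof (rule test_functionI[OF _ compact_cbox assms])
  have "smooth (\<lambda>x::real^'n. flat 0 (real n * x $ i + - real n * a $ i) * flat 0 (- real n * x $ i + real n * b $ i))" for i
    by (rule smooth_mult) (simp_all only: smooth_def C_k_flat_affine simp_thms)
  then have "smooth (\<lambda>x::real^'n. \<Prod>i\<in>UNIV. flat 0 (real n * x $ i + - real n * a $ i) * flat 0 (- real n * x $ i + real n * b $ i))"
    by (rule smooth_prod)
  then show "smooth (bump n a b)"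
    by (simp add: bump_def[abs_def] algebra_simps)
  show "bump n a b x = 0" if x: "x \<notin> cbox a b" for x
  proof -
    obtain i where "x $ i < a $ i \<or> b $ i < x $ i"
      using x by (auto simp: mem_box_cart not_le)
    then have "flat 0 (real n * (x $ i - a $ i)) * flat 0 (real n * (b $ i - x $ i)) = 0"
      by (auto simp: flat_def zero_less_mult_iff)
    then show ?thesis unfolding bump_def by (meson UNIV_I finite prod_zero)
  qed
qed

text \<open>
  Inside the box the factors are \<open>exp (-1/(n t))\<close> with \<open>t > 0\<close> fixed and tend to \<open>1\<close>; outside, one of
  them is \<open>0\<close>.
\<close>

lemma bump_tendsto: "(\<lambda>n. bump n a b x) \<longlonglongrightarrow> indicator (box a b) x"
proof -
  have flat1: "(\<lambda>n. flat 0 (real n * t)) \<longlonglongrightarrow> (if t > 0 then 1 else 0)" for t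
  proof (cases "t > 0")
    case True
    have "(\<lambda>n. - (inverse t) * inverse (real n)) \<longlonglongrightarrow> - (inverse t) * 0"
      by (intro tendsto_mult tendsto_const lim_inverse_n)
    then have "(\<lambda>n. exp (- (inverse t) * inverse (real n))) \<longlonglongrightarrow> 1"
      using tendsto_exp by fastforce
    moreover have "\<forall>\<^sub>F n in sequentially. exp (- (inverse t) * inverse (real n)) = flat 0 (real n * t)"
      using eventually_gt_at_top[of 0]
      by eventually_elim (use True in \<open>auto simp: flat_def field_simps\<close>)
    ultimately show ?thesis using True by (auto dest: Lim_transform_eventually)
  qed (auto simp: flat_def zero_less_mult_iff)
  have "(\<lambda>n. bump n a b x) \<longlonglongrightarrow>
     (\<Prod>i\<in>UNIV. (if x $ i - a $ i > 0 then 1 else 0) * (if b $ i - x $ i > 0 then 1 else 0))"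
    unfolding bump_def by (intro tendsto_prod tendsto_mult flat1)
  also have "(\<Prod>i\<in>UNIV. (if x $ i - a $ i > 0 then 1 else 0) * (if b $ i - x $ i > 0 then 1 else 0))
       = (indicator (box a b) x :: real)"
  proof (cases "x \<in> box a b")
    case True
    then show ?thesis by (simp add: mem_box_cart)
  next
    case False
    then obtain i where "\<not> (a $ i < x $ i \<and> x $ i < b $ i)" by (auto simp: mem_box_cart)
    then show ?thesis using False by (subst prod_zero) auto
  qed
  finally show ?thesis .
qed

section \<open>Integration by parts and weak derivatives\<close>

subsection \<open>Integrals over the whole space and over a subset\<close>

lemma integral_lebesgue_on:
  fixes f :: "'a::euclidean_space \<Rightarrow> real"
  assumes "S \<in> sets lebesgue"
  shows "(LINT x|lebesgue_on S. f x) = (LINT x|lebesgue. indicator S x * f x)"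
  using assms by (subst integral_restrict_space) auto

lemma integrable_lebesgue_on:
  fixes f :: "'a::euclidean_space \<Rightarrow> real"
  assumes "S \<in> sets lebesgue"
  shows "integrable (lebesgue_on S) f \<longleftrightarrow> integrable lebesgue (\<lambda>x. indicator S x * f x)"
  using assms by (subst integrable_restrict_space) auto

lemma AE_lebesgue_on:
  assumes "S \<in> sets lebesgue"
  shows "(AE x in lebesgue_on S. P x) \<longleftrightarrow> (AE x in lborel. x \<in> S \<longrightarrow> P x)"
  using assms by (subst AE_restrict_space_iff) (auto simp: AE_completion_iff)

lemma integral_lebesgue_on_support:
  fixes f :: "'a::euclidean_space \<Rightarrow> real"
  assumes "S \<in> sets lebesgue" "f \<in> borel_measurable borel" "\<And>x. x \<notin> S \<Longrightarrow> f x = 0"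
  shows "(LINT x|lebesgue_on S. f x) = (LINT x|lborel. f x)"
proof -
  have "(\<lambda>x. indicator S x * f x) = f"
    using assms(3) by (auto simp: indicator_def fun_eq_iff)
  then show ?thesis using assms(2) by (simp add: integral_lebesgue_on[OF assms(1)] integral_completion)
qed

lemma integrable_lebesgue_onI:
  fixes f :: "'a::euclidean_space \<Rightarrow> real"
  assumes "S \<in> sets lebesgue" "integrable lborel f"
  shows "integrable (lebesgue_on S) f"
proof -
  have "integrable lebesgue f"
    using assms(2) by (metis borel_measurable_integrable integrable_completion)
  then show ?thesis
    unfolding integrable_lebesgue_on[OF assms(1)]
    using integrable_mult_indicator[OF assms(1), of f] by simp
qed

lemma integrable_compact_support:
  fixes f :: "'a::euclidean_space \<Rightarrow> real"
  assumes "continuous_on UNIV f" "compact K" "\<And>x. x \<notin> K \<Longrightarrow> f x = 0"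
  shows "integrable lborel f"
proof -
  have "(\<lambda>x. indicator K x *\<^sub>R f x) = f"
    using assms(3) by (auto simp: indicator_def fun_eq_iff)
  moreover have "integrable lborel (\<lambda>x. indicator K x *\<^sub>R f x)"
    using assms by (intro borel_integrable_compact) (auto intro: continuous_on_subset)
  ultimately show ?thesis by simp
qed

lemma test_function_measurable: "\<phi> \<in> test_functions \<Omega> \<Longrightarrow> \<phi> \<in> borel_measurable borel"
  by (intro borel_measurable_continuous_onI smooth_continuous_on test_functionD(1))

lemma test_function_integrable:
  assumes "\<phi> \<in> test_functions \<Omega>"
  shows "integrable lborel \<phi>"
  by (rule integrable_compact_support[OF smooth_continuous_on[OF test_functionD(1)[OF assms]]
      test_functionD(2)[OF assms]]) (rule test_function_zero[OF assms])

lemma test_function_sq_integrable: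
  assumes "\<phi> \<in> test_functions \<Omega>"
  shows "integrable lborel (\<lambda>x. (\<phi> x)\<^sup>2)"
proof (rule integrable_compact_support[OF _ test_functionD(2)[OF assms]])
  show "continuous_on UNIV (\<lambda>x. (\<phi> x)\<^sup>2)"
    by (intro continuous_on_power smooth_continuous_on test_functionD(1)[OF assms])
  show "(\<phi> x)\<^sup>2 = 0" if "x \<notin> closure {x. \<phi> x \<noteq> 0}" for x
    using test_function_zero[OF assms that] by simp
qed

lemma test_function_bounded:
  assumes "\<phi> \<in> test_functions \<Omega>"
  obtains M where "0 \<le> M" "\<And>x. \<bar>\<phi> x\<bar> \<le> M"
proof -
  let ?K = "closure {x. \<phi> x \<noteq> 0}"
  have "bounded (\<phi> ` ?K)"
    by (intro compact_imp_bounded compact_continuous_image smooth_continuous_on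
        test_functionD(1,2)[OF assms])
  then obtain M where M: "\<And>x. x \<in> ?K \<Longrightarrow> \<bar>\<phi> x\<bar> \<le> M"
    unfolding bounded_iff by auto
  have "\<bar>\<phi> x\<bar> \<le> max M 0" for x
  proof (cases "x \<in> ?K")
    case True
    then show ?thesis using M[OF True] by simp
  next
    case False
    then show ?thesis using test_function_zero[OF assms False] by simp
  qed
  then show ?thesis using that[of "max M 0"] by simp
qed

subsection \<open>Integration by parts\<close>

lemma smooth_DERIV_line:
  assumes "smooth f"
  shows "((\<lambda>t. f (x + t *\<^sub>R axis i 1)) has_real_derivative partial_deriv i f (x + t *\<^sub>R axis i 1)) (at t)"
proof -
  have "((\<lambda>t. x + t *\<^sub>R axis i (1::real)) has_derivative (\<lambda>h. h *\<^sub>R axis i 1)) (at t)"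
    by (auto intro!: derivative_eq_intros)
  from has_derivative_compose[OF this smooth_has_derivative[OF assms]]
  have "((\<lambda>t. f (x + t *\<^sub>R axis i 1)) has_derivative
         (\<lambda>h. \<Sum>j\<in>UNIV. (h *\<^sub>R axis i 1) $ j * partial_deriv j f (x + t *\<^sub>R axis i 1))) (at t)" .
  moreover have "(\<Sum>j\<in>UNIV. (h *\<^sub>R axis i 1) $ j * partial_deriv j f y) = partial_deriv i f y * h" for h y
    by (simp add: axis_def if_distrib if_distribR sum.delta cong: if_cong)
  ultimately show ?thesis by (simp add: has_field_derivative_def)
qed

text \<open>
  The integral of a difference quotient vanishes by translation invariance, and the difference
  quotients converge boundedly on a common compact set.
\<close>

lemma integral_partial_deriv_eq_0:
  fixes \<phi> :: "real^'n \<Rightarrow> real"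
  assumes "\<phi> \<in> test_functions \<Omega>"
  shows "(LINT x|lborel. partial_deriv i \<phi> x) = 0"
proof -
  let ?e = "axis i (1::real)"
  let ?t = "\<lambda>n. inverse (real (Suc n))"
  let ?F = "\<lambda>n x. (\<phi> (x + ?t n *\<^sub>R ?e) - \<phi> x) / ?t n"
  note sm = test_functionD(1)[OF assms]
  obtain M where M: "0 \<le> M" "\<And>x. \<bar>partial_deriv i \<phi> x\<bar> \<le> M"
    using test_function_bounded[OF test_function_partial_deriv[OF assms]] by metis
  obtain r where r: "\<And>x. x \<in> closure {x. \<phi> x \<noteq> 0} \<Longrightarrow> norm x \<le> r"
    using compact_imp_bounded[OF test_functionD(2)[OF assms]] unfolding bounded_iff by auto
  let ?K = "cball (0::real^'n) (r + 1)"
  have int_shift: "integrable lborel (\<lambda>x. \<phi> (x + c))" "(LINT x|lborel. \<phi> (x + c)) = (LINT x|lborel. \<phi> x)" for c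
  proof -
    note [measurable] = test_function_measurable[OF assms]
    have 1: "integrable (distr lborel borel ((+) c)) \<phi>"
      unfolding lborel_distr_plus by (rule test_function_integrable[OF assms])
    then show "integrable lborel (\<lambda>x. \<phi> (x + c))"
      by (subst (asm) integrable_distr_eq) (auto simp: add.commute)
    have "(LINT x|lborel. \<phi> x) = (LINT x|distr lborel borel ((+) c). \<phi> x)"
      unfolding lborel_distr_plus ..
    also have "\<dots> = (LINT x|lborel. \<phi> (x + c))"
      by (subst integral_distr) (auto simp: add.commute)
    finally show "(LINT x|lborel. \<phi> (x + c)) = (LINT x|lborel. \<phi> x)" ..
  qed
  have "(LINT x|lborel. ?F n x) = 0" for n
    using int_shift test_function_integrable[OF assms] by simp
  moreover have "(\<lambda>n. LINT x|lborel. ?F n x) \<longlonglongrightarrow> (LINT x|lborel. partial_deriv i \<phi> x)"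
  proof (rule integral_dominated_convergence[where w = "\<lambda>x. indicator ?K x *\<^sub>R M"])
    show "partial_deriv i \<phi> \<in> borel_measurable lborel"
      using test_function_measurable[OF test_function_partial_deriv[OF assms]] by simp
    show "?F n \<in> borel_measurable lborel" for n
      by (intro borel_measurable_divide borel_measurable_diff borel_measurable_const
          borel_measurable_integrable int_shift test_function_integrable[OF assms])
    show "integrable lborel (\<lambda>x. indicator ?K x *\<^sub>R M)"
      by (intro borel_integrable_compact) auto
    show "AE x in lborel. (\<lambda>n. ?F n x) \<longlonglongrightarrow> partial_deriv i \<phi> x"
    proof (rule AE_I2)
      fix x
      have "((\<lambda>h. (\<phi> (x + h *\<^sub>R ?e) - \<phi> x) / h) \<longlongrightarrow> partial_deriv i \<phi> x) (at 0)"
        using smooth_DERIV_line[OF sm, of x i 0] unfolding DERIV_def by simp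
      moreover have "filterlim ?t (at 0) sequentially"
        using LIMSEQ_inverse_real_of_nat by (auto simp: filterlim_at)
      ultimately show "(\<lambda>n. ?F n x) \<longlonglongrightarrow> partial_deriv i \<phi> x"
        by (rule filterlim_compose)
    qed
    show "AE x in lborel. norm (?F n x) \<le> indicator ?K x *\<^sub>R M" for n
    proof (rule AE_I2)
      fix x :: "real^'n"
      have t: "0 < ?t n" "?t n \<le> 1" by (auto simp: inverse_le_1_iff)
      show "norm (?F n x) \<le> indicator ?K x *\<^sub>R M"
      proof (cases "x \<in> ?K")
        case True
        obtain z where "\<phi> (x + ?t n *\<^sub>R ?e) - \<phi> (x + 0 *\<^sub>R ?e) = (?t n - 0) * partial_deriv i \<phi> (x + z *\<^sub>R ?e)"
          using MVT2[of 0 "?t n" "\<lambda>t. \<phi> (x + t *\<^sub>R ?e)" "\<lambda>t. partial_deriv i \<phi> (x + t *\<^sub>R ?e)"]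
            t smooth_DERIV_line[OF sm] by blast
        then have "?F n x = partial_deriv i \<phi> (x + z *\<^sub>R ?e)" using t by simp
        then show ?thesis using M True by simp
      next
        case False
        have "norm x > r + 1" using False by simp
        moreover have "norm (x + ?t n *\<^sub>R ?e) \<ge> norm x - 1"
          using norm_diff_ineq[of x "?t n *\<^sub>R ?e"] t by (simp add: norm_axis_1)
        ultimately have "x \<notin> closure {x. \<phi> x \<noteq> 0}" "x + ?t n *\<^sub>R ?e \<notin> closure {x. \<phi> x \<noteq> 0}"
          using r[of x] r[of "x + ?t n *\<^sub>R ?e"] by auto
        then have "\<phi> x = 0" "\<phi> (x + ?t n *\<^sub>R ?e) = 0"
          using test_function_zero[OF assms] by blast+
        then show ?thesis using False by simp
      qed
    qed
  qed
  ultimately show ?thesis by (simp add: LIMSEQ_const_iff)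
qed

lemma test_function_mult:
  assumes "smooth f" "\<phi> \<in> test_functions \<Omega>"
  shows "(\<lambda>x. f x * \<phi> x) \<in> test_functions \<Omega>"
proof (rule test_functionI[OF smooth_mult[OF assms(1) test_functionD(1)[OF assms(2)]]
      test_functionD(2,3)[OF assms(2)]])
  show "f x * \<phi> x = 0" if "x \<notin> closure {x. \<phi> x \<noteq> 0}" for x
    using test_function_zero[OF assms(2) that] by simp
qed

lemma integration_by_parts:
  assumes "smooth f" "\<phi> \<in> test_functions \<Omega>"
  shows "(LINT x|lborel. f x * partial_deriv i \<phi> x) = - (LINT x|lborel. partial_deriv i f x * \<phi> x)"
proof -
  have "(LINT x|lborel. f x * partial_deriv i \<phi> x + partial_deriv i f x * \<phi> x) = 0"
    using integral_partial_deriv_eq_0[OF test_function_mult[OF assms], of i]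
    by (simp add: partial_deriv_mult[OF smooth_differentiable[OF assms(1)]
          smooth_differentiable[OF test_functionD(1)[OF assms(2)]]])
  then show ?thesis
    using test_function_integrable[OF test_function_mult[OF assms(1) test_function_partial_deriv[OF assms(2)]]]
      test_function_integrable[OF test_function_mult[OF smooth_partial_deriv[OF assms(1)] assms(2)]]
    by (simp add: eq_neg_iff_add_eq_0)
qed

subsection \<open>The fundamental lemma of the calculus of variations\<close>

lemma locally_integrable_continuous:
  fixes f :: "real^'n \<Rightarrow> real"
  assumes "continuous_on UNIV f"
  shows "locally_integrable \<Omega> f"
  unfolding locally_integrable_def
proof (intro allI impI)
  fix K :: "(real^'n) set"
  assume "compact K \<and> K \<subseteq> \<Omega>"
  then have "integrable lborel (\<lambda>x. indicator K x * f x)" "K \<in> sets borel"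
    using borel_integrable_compact[OF _ continuous_on_subset[OF assms subset_UNIV], of K]
    by (simp_all add: borel_compact)
  moreover from this(1) have "integrable lebesgue (\<lambda>x. indicator K x * f x)"
    by (metis borel_measurable_integrable integrable_completion)
  ultimately show "integrable (lebesgue_on K) f"
    by (subst integrable_lebesgue_on) auto
qed

text \<open>
  A locally integrable function that annihilates all test functions is zero almost everywhere. The
  bump functions show that its integral over every box vanishes, and a Dynkin system argument passes
  from boxes to Borel sets.
\<close>

lemma integral_box_eq_0:
  fixes g :: "real^'n \<Rightarrow> real"
  assumes \<Omega>: "\<Omega> \<in> sets lebesgue" and g: "locally_integrable \<Omega> g"
    and test: "\<And>\<phi>. \<phi> \<in> test_functions \<Omega> \<Longrightarrow> (LINT x|lebesgue_on \<Omega>. g x * \<phi> x) = 0"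
    and sub: "cbox a b \<subseteq> \<Omega>"
  shows "(LINT x|lebesgue. indicator (box a b) x * g x) = 0"
proof -
  have "integrable (lebesgue_on (cbox a b)) g"
    using g sub by (auto simp: locally_integrable_def)
  then have int: "integrable lebesgue (\<lambda>x. indicator (cbox a b) x * g x)"
    by (simp add: integrable_lebesgue_on)
  have eq: "indicator (cbox a b) x * g x * bump n a b x = indicator \<Omega> x * (g x * bump n a b x)" for n x
    using sub test_function_eq_0[OF bump_test_function[OF order_refl, of n a b], of x]
    by (cases "x \<in> cbox a b") auto
  have "(LINT x|lebesgue. indicator (cbox a b) x * g x * bump n a b x) = 0" for n
    using test[OF bump_test_function[OF sub]] by (simp add: eq integral_lebesgue_on[OF \<Omega>])
  moreover have "(\<lambda>n. LINT x|lebesgue. indicator (cbox a b) x * g x * bump n a b x)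
      \<longlonglongrightarrow> (LINT x|lebesgue. indicator (box a b) x * g x)"
  proof (rule integral_dominated_convergence[where w = "\<lambda>x. \<bar>indicator (cbox a b) x * g x\<bar>"])
    have bump_meas: "bump n a b \<in> borel_measurable lebesgue" for n
      using test_function_measurable[OF bump_test_function[OF order_refl, of n a b]]
      by (simp add: borel_measurable_if_I measurable_completion)
    show m: "(\<lambda>x. indicator (cbox a b) x * g x * bump n a b x) \<in> borel_measurable lebesgue" for n
      using borel_measurable_integrable[OF int] bump_meas by (rule borel_measurable_times)
    have lim: "(\<lambda>n. indicator (cbox a b) x * g x * bump n a b x) \<longlonglongrightarrow> indicator (box a b) x * g x" for x
    proof -
      have "(\<lambda>n. indicator (cbox a b) x * g x * bump n a b x) \<longlonglongrightarrow> indicator (cbox a b) x * g x * indicator (box a b) x"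
        by (intro tendsto_mult tendsto_const bump_tendsto)
      moreover have "indicator (cbox a b) x * g x * indicator (box a b) x = indicator (box a b) x * g x"
        using box_subset_cbox[of a b] by (auto simp: indicator_def)
      ultimately show ?thesis by simp
    qed
    then show "AE x in lebesgue. (\<lambda>n. indicator (cbox a b) x * g x * bump n a b x) \<longlonglongrightarrow> indicator (box a b) x * g x"
      by simp
    show "(\<lambda>x. indicator (box a b) x * g x) \<in> borel_measurable lebesgue"
      by (rule borel_measurable_LIMSEQ_real[OF _ m]) (rule lim)
    show "integrable lebesgue (\<lambda>x. \<bar>indicator (cbox a b) x * g x\<bar>)"
      using int by (rule integrable_abs)
    show "AE x in lebesgue. norm (indicator (cbox a b) x * g x * bump n a b x) \<le> \<bar>indicator (cbox a b) x * g x\<bar>" for n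
      using bump_bounds[of n a b] by (auto simp: abs_mult intro!: mult_left_le)
  qed
  ultimately show ?thesis by (simp add: LIMSEQ_const_iff)
qed

lemma AE_zero_on_box:
  fixes g :: "real^'n \<Rightarrow> real"
  assumes \<Omega>: "\<Omega> \<in> sets lebesgue" and g: "locally_integrable \<Omega> g"
    and test: "\<And>\<phi>. \<phi> \<in> test_functions \<Omega> \<Longrightarrow> (LINT x|lebesgue_on \<Omega>. g x * \<phi> x) = 0"
    and sub: "cbox a b \<subseteq> \<Omega>"
  shows "AE x in lborel. x \<in> box a b \<longrightarrow> g x = 0"
proof -
  let ?g = "\<lambda>x. indicator (box a b) x * g x"
  have "integrable (lebesgue_on (cbox a b)) g"
    using g sub by (auto simp: locally_integrable_def)
  then have "integrable lebesgue (\<lambda>x. indicator (cbox a b) x * g x)"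
    by (simp add: integrable_lebesgue_on)
  then have "integrable lebesgue (\<lambda>x. indicator (box a b) x *\<^sub>R (indicator (cbox a b) x * g x))"
    by (rule integrable_mult_indicator[rotated]) auto
  also have "(\<lambda>x. indicator (box a b) x *\<^sub>R (indicator (cbox a b) x * g x)) = ?g"
    using box_subset_cbox[of a b] by (auto simp: indicator_def fun_eq_iff)
  finally have int: "integrable lebesgue ?g" .
  \<comment> \<open>boxes generate only the Borel sets, so \<open>g\<close> is replaced by a Borel measurable representative\<close>
  then obtain g' where g': "g' \<in> borel_measurable lborel" "AE x in lborel. ?g x = g' x"
    using completion_ex_borel_measurable_real borel_measurable_integrable by blast
  have AE': "AE x in lebesgue. ?g x = g' x" using g'(2) by (rule AE_completion)
  have g'_meas: "g' \<in> borel_measurable lebesgue" using g'(1) by (rule measurable_completion)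
  have "integrable lebesgue g'"
    using int AE' by (rule integrable_cong_AE_imp[OF _ g'_meas]) 
  then have int': "integrable lborel g'" by (rule integrable_completion[OF g'(1), THEN iffD1])
  have zero: "(LINT x|lborel. indicator A x * g' x) = 0" if "A \<in> sets borel" for A
  proof -
    have box: "(LINT x|lborel. indicator (box u v) x * g' x) = 0" for u v
    proof -
      obtain c d where cd: "box u v \<inter> box a b = box c d"
        using that[OF box_Int_box] .
      have "(LINT x|lebesgue. indicator (box c d) x * g x) = 0"
      proof (cases "box c d = {}")
        case False
        have "cbox c d \<subseteq> cbox a b"
          using closure_mono[of "box c d" "cbox a b"] False cd box_subset_cbox[of a b]
          by (auto simp: closure_box)
        then show ?thesis by (intro integral_box_eq_0[OF \<Omega> g test]) (use sub in auto)
      qed simp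
      also have "(\<lambda>x. indicator (box c d) x * g x) = (\<lambda>x. indicator (box u v) x * ?g x)"
        unfolding cd[symmetric] by (auto simp: indicator_def fun_eq_iff)
      also have "(LINT x|lebesgue. indicator (box u v) x * ?g x) = (LINT x|lebesgue. indicator (box u v) x * g' x)"
      proof (rule integral_cong_AE)
        have ind: "(indicator (box u v) :: _ \<Rightarrow> real) \<in> borel_measurable lebesgue"
          by (rule borel_measurable_indicator) simp
        show "(\<lambda>x. indicator (box u v) x * ?g x) \<in> borel_measurable lebesgue"
          by (rule borel_measurable_times[OF ind borel_measurable_integrable[OF int]])
        show "(\<lambda>x. indicator (box u v) x * g' x) \<in> borel_measurable lebesgue"
          by (rule borel_measurable_times[OF ind g'_meas])
        show "AE x in lebesgue. indicator (box u v) x * ?g x = indicator (box u v) x * g' x"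
          using AE' by eventually_elim simp
      qed
      also have "\<dots> = (LINT x|lborel. indicator (box u v) x * g' x)"
        using g'(1) by (intro integral_completion borel_measurable_times) auto
      finally show ?thesis by simp
    qed
    have int_ind: "integrable lborel (\<lambda>x. indicator A x * g' x)" if "A \<in> sets borel" for A
      using integrable_mult_indicator[OF _ int', of A] that by simp
    have univ: "(LINT x|lborel. g' x) = 0"
    proof -
      have "(LINT x|lborel. g' x) = (LINT x|lebesgue. g' x)" by (rule integral_completion[OF g'(1), symmetric])
      also have "\<dots> = (LINT x|lebesgue. ?g x)"
        using AE' borel_measurable_integrable[OF int] g'_meas by (intro integral_cong_AE) auto
      also have "\<dots> = 0" by (rule integral_box_eq_0[OF \<Omega> g test sub])
      finally show ?thesis .
    qed
    \<comment> \<open>the sets over which \<open>g'\<close> integrates to \<open>0\<close> form a Dynkin system containing the boxes\<close>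
    have st: "Int_stable (range (\<lambda>(a, b). box a b :: (real^'n) set))"
      by (auto simp: Int_stable_def box_Int_box)
    have cl: "range (\<lambda>(a, b). box a b :: (real^'n) set) \<subseteq> Pow UNIV" by simp
    have A: "A \<in> sigma_sets UNIV (range (\<lambda>(a, b). box a b :: (real^'n) set))"
      using that by (subst (asm) borel_eq_box) (simp add: sets_measure_of)
    from st cl A have "A \<in> sets borel \<and> (LINT x|lborel. indicator A x * g' x) = 0"
    proof (induction rule: sigma_sets_induct_disjoint)
      case (basic A)
      then show ?case using box by auto
    next
      case empty
      then show ?case by simp
    next
      case (compl A)
      have "(LINT x|lborel. indicator (UNIV - A) x * g' x) = (LINT x|lborel. g' x - indicator A x * g' x)"
        by (intro Bochner_Integration.integral_cong) (auto simp: indicator_def)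
      also have "\<dots> = 0" using compl int' int_ind univ by simp
      finally show ?case using compl by auto
    next
      case (union A)
      have U: "(\<Union>i. A i) \<in> sets borel" using union by (intro sets.countable_UN) auto
      have "(LINT x|lborel. indicator (\<Union>i. A i) x * g' x) = (LINT x:(\<Union>i. A i)|lborel. g' x)"
        by (simp add: set_lebesgue_integral_def)
      also have "\<dots> = (\<Sum>i. LINT x:A i|lborel. g' x)"
        using union int_ind[OF U]
        by (intro lebesgue_integral_countable_add)
           (auto simp: set_integrable_def disjoint_family_on_def)
      also have "\<dots> = 0" using union by (simp add: set_lebesgue_integral_def)
      finally show ?case using union by auto
    qed
    then show ?thesis ..
  qed
  have "AE x in lborel. g' x = 0"
    using int' zero
    by (intro density_unique_real) (auto simp: set_lebesgue_integral_def)
  with g'(2) show ?thesis by eventually_elim auto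
qed

theorem fundamental_lemma:
  fixes g :: "real^'n \<Rightarrow> real"
  assumes "open \<Omega>" and g: "locally_integrable \<Omega> g"
    and test: "\<And>\<phi>. \<phi> \<in> test_functions \<Omega> \<Longrightarrow> (LINT x|lebesgue_on \<Omega>. g x * \<phi> x) = 0"
  shows "AE x in lebesgue_on \<Omega>. g x = 0"
proof -
  have \<Omega>: "\<Omega> \<in> sets lebesgue" using assms(1) by auto
  obtain D where D: "countable D" "D \<subseteq> Pow \<Omega>" "\<And>X. X \<in> D \<Longrightarrow> \<exists>a b. X = cbox a b" "\<Union>D = \<Omega>"
    using open_countable_Union_open_cbox[OF assms(1)] by metis
  have "AE x in lborel. x \<in> X \<longrightarrow> g x = 0" if X: "X \<in> D" for X
  proof -
    obtain a b where ab: "X = cbox a b" using D(3) X by blast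
    have "AE x in lborel. x \<in> box a b \<longrightarrow> g x = 0"
      using D(2) X ab by (intro AE_zero_on_box[OF \<Omega> g test]) auto
    moreover have "AE x in lborel. x \<notin> cbox a b - box a b"
      by (rule AE_completion_iff[THEN iffD1, OF AE_not_in[OF negligible_iff_null_sets[THEN iffD1,
            OF negligible_frontier_interval[of a b]]]])
    ultimately show ?thesis unfolding ab by eventually_elim auto
  qed
  then have "AE x in lborel. \<forall>X\<in>D. x \<in> X \<longrightarrow> g x = 0"
    by (intro AE_ball_countable[OF D(1), THEN iffD2] ballI)
  then have "AE x in lborel. x \<in> \<Omega> \<longrightarrow> g x = 0"
    by eventually_elim (use D(4) in auto)
  then show ?thesis by (simp add: AE_lebesgue_on[OF \<Omega>])
qed

subsection \<open>Uniqueness and linearity of weak derivatives\<close>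

lemma AE_sym: "AE x in M. u x = v x \<Longrightarrow> AE x in M. v x = u x"
  by (erule eventually_mono) simp

lemma AE_lebesgue_on_subset:
  assumes "A \<in> sets lebesgue" "B \<in> sets lebesgue" "A \<subseteq> B" "AE x in lebesgue_on B. P x"
  shows "AE x in lebesgue_on A. P x"
  using assms(4) unfolding AE_lebesgue_on[OF assms(1)] AE_lebesgue_on[OF assms(2)]
  by eventually_elim (use assms(3) in auto)

lemma measurable_lebesgue_on_AE:
  fixes f g :: "'a::euclidean_space \<Rightarrow> real"
  assumes S: "S \<in> sets lebesgue" and f: "f \<in> borel_measurable (lebesgue_on S)"
    and eq: "AE x in lebesgue_on S. f x = g x"
  shows "g \<in> borel_measurable (lebesgue_on S)"
proof -
  have S': "S \<inter> space lebesgue \<in> sets lebesgue" using S by simp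
  have "AE x in lebesgue. indicator S x *\<^sub>R f x = indicator S x *\<^sub>R g x"
    using AE_completion[OF eq[unfolded AE_lebesgue_on[OF S]]]
    by eventually_elim (auto simp: indicator_def)
  with f[unfolded borel_measurable_restrict_space_iff[OF S']] show ?thesis
    unfolding borel_measurable_restrict_space_iff[OF S'] by (rule borel_measurable_AE)
qed

lemma integrable_lebesgue_on_AE:
  fixes f g :: "'a::euclidean_space \<Rightarrow> real"
  assumes "S \<in> sets lebesgue" "integrable (lebesgue_on S) f" "AE x in lebesgue_on S. f x = g x"
  shows "integrable (lebesgue_on S) g"
  using assms measurable_lebesgue_on_AE[OF assms(1) borel_measurable_integrable[OF assms(2)] assms(3)]
  by (intro integrable_cong_AE_imp[of _ f g]) auto

lemma locally_integrable_AE: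
  assumes "\<Omega> \<in> sets lebesgue" "locally_integrable \<Omega> f" "AE x in lebesgue_on \<Omega>. f x = g x"
  shows "locally_integrable \<Omega> g"
  unfolding locally_integrable_def
proof (intro allI impI)
  fix K :: "(real^'a) set"
  assume K: "compact K \<and> K \<subseteq> \<Omega>"
  then have "K \<in> sets lebesgue" by (simp add: borel_compact)
  then show "integrable (lebesgue_on K) g"
    using K assms AE_lebesgue_on_subset[OF _ assms(1) _ assms(3), of K]
    by (intro integrable_lebesgue_on_AE[of K f g]) (auto simp: locally_integrable_def)
qed

lemma locally_integrable_lincomb:
  assumes "locally_integrable \<Omega> f" "locally_integrable \<Omega> g"
  shows "locally_integrable \<Omega> (\<lambda>x. a * f x + b * g x)"
  using assms unfolding locally_integrable_def by auto

lemma locally_integrable_mult_test_function: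
  assumes \<Omega>: "\<Omega> \<in> sets lebesgue" and f: "locally_integrable \<Omega> f" and \<phi>: "\<phi> \<in> test_functions \<Omega>"
  shows "integrable (lebesgue_on \<Omega>) (\<lambda>x. f x * \<phi> x)"
proof -
  let ?K = "closure {x. \<phi> x \<noteq> 0}"
  obtain M where M: "0 \<le> M" "\<And>x. \<bar>\<phi> x\<bar> \<le> M" using test_function_bounded[OF \<phi>] by metis
  have "integrable (lebesgue_on ?K) f"
    using f test_functionD[OF \<phi>] by (auto simp: locally_integrable_def)
  then have int: "integrable lebesgue (\<lambda>x. indicator ?K x * f x)"
    by (subst (asm) integrable_lebesgue_on) auto
  have meas: "\<phi> \<in> borel_measurable lebesgue"
    using test_function_measurable[OF \<phi>] by (intro measurable_completion) simp
  have "integrable lebesgue (\<lambda>x. indicator ?K x * f x * \<phi> x)"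
  proof (rule Bochner_Integration.integrable_bound)
    show "integrable lebesgue (\<lambda>x. M * (indicator ?K x * f x))" using int by simp
    show "(\<lambda>x. indicator ?K x * f x * \<phi> x) \<in> borel_measurable lebesgue"
      by (rule borel_measurable_times[OF borel_measurable_integrable[OF int] meas])
    show "AE x in lebesgue. norm (indicator ?K x * f x * \<phi> x) \<le> norm (M * (indicator ?K x * f x))"
      using M by (auto simp: abs_mult mult.commute[of M] intro!: mult_left_mono)
  qed
  moreover have "(\<lambda>x. indicator ?K x * f x * \<phi> x) = (\<lambda>x. indicator \<Omega> x * (f x * \<phi> x))"
  proof
    fix x
    show "indicator ?K x * f x * \<phi> x = indicator \<Omega> x * (f x * \<phi> x)"
      using test_functionD(3)[OF \<phi>] test_function_zero[OF \<phi>, of x]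
      by (cases "x \<in> ?K") auto
  qed
  ultimately show ?thesis by (simp add: integrable_lebesgue_on[OF \<Omega>])
qed

lemma has_weak_derivD:
  assumes "has_weak_deriv \<Omega> i f g"
  shows "locally_integrable \<Omega> f" "locally_integrable \<Omega> g"
    "\<phi> \<in> test_functions \<Omega> \<Longrightarrow>
      (LINT x|lebesgue_on \<Omega>. f x * partial_deriv i \<phi> x) = - (LINT x|lebesgue_on \<Omega>. g x * \<phi> x)"
  using assms by (auto simp: has_weak_deriv_def)

lemma has_weak_deriv_lincomb:
  assumes \<Omega>: "\<Omega> \<in> sets lebesgue" and f: "has_weak_deriv \<Omega> i f f'" and g: "has_weak_deriv \<Omega> i g g'"
  shows "has_weak_deriv \<Omega> i (\<lambda>x. a * f x + b * g x) (\<lambda>x. a * f' x + b * g' x)"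
  unfolding has_weak_deriv_def
proof (intro conjI ballI)
  show "locally_integrable \<Omega> (\<lambda>x. a * f x + b * g x)" "locally_integrable \<Omega> (\<lambda>x. a * f' x + b * g' x)"
    using locally_integrable_lincomb has_weak_derivD(1,2)[OF f] has_weak_derivD(1,2)[OF g] by blast+
  fix \<phi> assume \<phi>: "\<phi> \<in> test_functions \<Omega>"
  have lin: "(LINT x|lebesgue_on \<Omega>. (a * u x + b * v x) * \<psi> x) =
      a * (LINT x|lebesgue_on \<Omega>. u x * \<psi> x) + b * (LINT x|lebesgue_on \<Omega>. v x * \<psi> x)"
    if "locally_integrable \<Omega> u" "locally_integrable \<Omega> v" "\<psi> \<in> test_functions \<Omega>" for u v \<psi>
  proof -
    have "(LINT x|lebesgue_on \<Omega>. (a * u x + b * v x) * \<psi> x) =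
        (LINT x|lebesgue_on \<Omega>. a * (u x * \<psi> x) + b * (v x * \<psi> x))"
      by (simp add: algebra_simps)
    then show ?thesis
      using locally_integrable_mult_test_function[OF \<Omega> that(1,3)]
        locally_integrable_mult_test_function[OF \<Omega> that(2,3)] by simp
  qed
  show "(LINT x|lebesgue_on \<Omega>. (a * f x + b * g x) * partial_deriv i \<phi> x)
      = - (LINT x|lebesgue_on \<Omega>. (a * f' x + b * g' x) * \<phi> x)"
    using lin[OF has_weak_derivD(1)[OF f] has_weak_derivD(1)[OF g] test_function_partial_deriv[OF \<phi>]]
      lin[OF has_weak_derivD(2)[OF f] has_weak_derivD(2)[OF g] \<phi>]
      has_weak_derivD(3)[OF f \<phi>] has_weak_derivD(3)[OF g \<phi>] by simp
qed

lemma has_weak_deriv_AE: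
  assumes \<Omega>: "\<Omega> \<in> sets lebesgue" and f: "has_weak_deriv \<Omega> i f g"
    and "AE x in lebesgue_on \<Omega>. f x = f' x" "AE x in lebesgue_on \<Omega>. g x = g' x"
  shows "has_weak_deriv \<Omega> i f' g'"
  unfolding has_weak_deriv_def
proof (intro conjI ballI)
  show loc: "locally_integrable \<Omega> f'" "locally_integrable \<Omega> g'"
    using locally_integrable_AE[OF \<Omega>] has_weak_derivD[OF f] assms by blast+
  fix \<phi> assume \<phi>: "\<phi> \<in> test_functions \<Omega>"
  note int = borel_measurable_integrable[OF locally_integrable_mult_test_function[OF \<Omega>]]
  note \<phi>' = test_function_partial_deriv[OF \<phi>]
  have "(LINT x|lebesgue_on \<Omega>. f' x * partial_deriv i \<phi> x) = (LINT x|lebesgue_on \<Omega>. f x * partial_deriv i \<phi> x)"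
    using assms(3) by (intro integral_cong_AE int[OF loc(1) \<phi>'] int[OF has_weak_derivD(1)[OF f] \<phi>']) auto
  moreover have "(LINT x|lebesgue_on \<Omega>. g' x * \<phi> x) = (LINT x|lebesgue_on \<Omega>. g x * \<phi> x)"
    using assms(4) by (intro integral_cong_AE int[OF loc(2) \<phi>] int[OF has_weak_derivD(2)[OF f] \<phi>]) auto
  ultimately show "(LINT x|lebesgue_on \<Omega>. f' x * partial_deriv i \<phi> x) = - (LINT x|lebesgue_on \<Omega>. g' x * \<phi> x)"
    using has_weak_derivD(3)[OF f \<phi>] by simp
qed

lemma has_weak_deriv_unique:
  fixes \<Omega> :: "(real^'n) set"
  assumes "open \<Omega>" and g: "has_weak_deriv \<Omega> i f g" and h: "has_weak_deriv \<Omega> i f h"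
  shows "AE x in lebesgue_on \<Omega>. g x = h x"
proof -
  have \<Omega>: "\<Omega> \<in> sets lebesgue" using assms(1) by auto
  have lc: "has_weak_deriv \<Omega> i (\<lambda>x. 1 * f x + -1 * f x) (\<lambda>x. 1 * g x + -1 * h x)"
    by (rule has_weak_deriv_lincomb[OF \<Omega> g h])
  then have "AE x in lebesgue_on \<Omega>. 1 * g x + -1 * h x = 0"
    by (intro fundamental_lemma[OF assms(1)]) (auto simp: has_weak_deriv_def)
  then show ?thesis by eventually_elim simp
qed

lemma has_weak_deriv_mono:
  assumes "A \<in> sets lebesgue" "B \<in> sets lebesgue" "A \<subseteq> B" and f: "has_weak_deriv B i f g"
  shows "has_weak_deriv A i f g"
  unfolding has_weak_deriv_def
proof (intro conjI ballI)
  show "locally_integrable A f" "locally_integrable A g"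
    using has_weak_derivD(1,2)[OF f] assms(3) by (auto simp: locally_integrable_def)
  fix \<phi> assume \<phi>: "\<phi> \<in> test_functions A"
  have eq: "(LINT x|lebesgue_on A. u x * \<psi> x) = (LINT x|lebesgue_on B. u x * \<psi> x)"
    if "\<psi> \<in> test_functions A" for u \<psi>
  proof -
    have "(\<lambda>x. indicator A x * (u x * \<psi> x)) = (\<lambda>x. indicator B x * (u x * \<psi> x))"
    proof
      show "indicator A x * (u x * \<psi> x) = indicator B x * (u x * \<psi> x)" for x
        using test_function_eq_0[OF that, of x] assms(3) by (cases "x \<in> A") auto
    qed
    then show ?thesis using assms(1,2) by (simp add: integral_lebesgue_on)
  qed
  show "(LINT x|lebesgue_on A. f x * partial_deriv i \<phi> x) = - (LINT x|lebesgue_on A. g x * \<phi> x)"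
    unfolding eq[OF \<phi>] eq[OF test_function_partial_deriv[OF \<phi>]]
    by (rule has_weak_derivD(3)[OF f test_function_mono[OF \<phi> assms(3)]])
qed

lemma smooth_has_weak_deriv:
  fixes \<Omega> :: "(real^'n) set"
  assumes \<Omega>: "\<Omega> \<in> sets lebesgue" and f: "smooth f"
  shows "has_weak_deriv \<Omega> i f (partial_deriv i f)"
  unfolding has_weak_deriv_def
proof (intro conjI ballI)
  show "locally_integrable \<Omega> f" "locally_integrable \<Omega> (partial_deriv i f)"
    using f by (auto intro!: locally_integrable_continuous smooth_continuous_on smooth_partial_deriv)
  fix \<phi> assume \<phi>: "\<phi> \<in> test_functions \<Omega>"
  have eq: "(LINT x|lebesgue_on \<Omega>. u x * \<psi> x) = (LINT x|lborel. u x * \<psi> x)"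
    if "smooth u" "\<psi> \<in> test_functions \<Omega>" for u \<psi>
    using test_function_eq_0[OF that(2)] test_function_measurable[OF test_function_mult[OF that]]
    by (intro integral_lebesgue_on_support[OF \<Omega>]) auto
  show "(LINT x|lebesgue_on \<Omega>. f x * partial_deriv i \<phi> x) = - (LINT x|lebesgue_on \<Omega>. partial_deriv i f x * \<phi> x)"
    unfolding eq[OF f test_function_partial_deriv[OF \<phi>]] eq[OF smooth_partial_deriv[OF f] \<phi>]
    by (rule integration_by_parts[OF f \<phi>])
qed

section \<open>The Sobolev spaces as vector spaces\<close>

text \<open>The squared \<open>L\<^sup>2\<close> norm.\<close>

abbreviation L2_sq :: "(real^'n) set \<Rightarrow> (real^'n \<Rightarrow> real) \<Rightarrow> real" where
  "L2_sq \<Omega> f \<equiv> LINT x|lebesgue_on \<Omega>. (f x)\<^sup>2"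

lemma L2D: "f \<in> L2 \<Omega> \<Longrightarrow> f \<in> borel_measurable (lebesgue_on \<Omega>)"
  "f \<in> L2 \<Omega> \<Longrightarrow> integrable (lebesgue_on \<Omega>) (\<lambda>x. (f x)\<^sup>2)"
  by (auto simp: L2_def)

lemma lincomb_sq_le: "(a * x + b * y)\<^sup>2 \<le> 2 * a\<^sup>2 * x\<^sup>2 + 2 * b\<^sup>2 * (y::real)\<^sup>2"
  using sum_squares_bound[of "a * x" "b * y"] by (simp add: power2_eq_square algebra_simps)

lemma square_integrable_lincomb:
  fixes f g :: "'a \<Rightarrow> real"
  assumes [measurable]: "f \<in> borel_measurable M" "g \<in> borel_measurable M"
    and sq_int: "integrable M (\<lambda>x. (f x)\<^sup>2)" "integrable M (\<lambda>x. (g x)\<^sup>2)"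
  shows "integrable M (\<lambda>x. (a * f x + b * g x)\<^sup>2)"
    and "(LINT x|M. (a * f x + b * g x)\<^sup>2) \<le> 2 * a\<^sup>2 * (LINT x|M. (f x)\<^sup>2) + 2 * b\<^sup>2 * (LINT x|M. (g x)\<^sup>2)"
proof -
  have int: "integrable M (\<lambda>x. 2 * a\<^sup>2 * (f x)\<^sup>2 + 2 * b\<^sup>2 * (g x)\<^sup>2)"
    using sq_int by simp
  show sq: "integrable M (\<lambda>x. (a * f x + b * g x)\<^sup>2)"
    by (rule Bochner_Integration.integrable_bound[OF int])
       (auto intro!: order_trans[OF lincomb_sq_le])
  have "(LINT x|M. (a * f x + b * g x)\<^sup>2) \<le> (LINT x|M. 2 * a\<^sup>2 * (f x)\<^sup>2 + 2 * b\<^sup>2 * (g x)\<^sup>2)"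
    by (rule integral_mono[OF sq int lincomb_sq_le])
  then show "(LINT x|M. (a * f x + b * g x)\<^sup>2) \<le> 2 * a\<^sup>2 * (LINT x|M. (f x)\<^sup>2) + 2 * b\<^sup>2 * (LINT x|M. (g x)\<^sup>2)"
    using sq_int by simp
qed

lemma L2_lincomb:
  assumes f: "f \<in> L2 \<Omega>" and g: "g \<in> L2 \<Omega>"
  shows "(\<lambda>x. a * f x + b * g x) \<in> L2 \<Omega>"
    and "L2_sq \<Omega> (\<lambda>x. a * f x + b * g x) \<le>
      2 * a\<^sup>2 * L2_sq \<Omega> f + 2 * b\<^sup>2 * L2_sq \<Omega> g"
  using square_integrable_lincomb[OF L2D(1)[OF f] L2D(1)[OF g] L2D(2)[OF f] L2D(2)[OF g]]
    L2D(1)[OF f] L2D(1)[OF g]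
  by (auto simp: L2_def)

lemma L2_AE:
  assumes "\<Omega> \<in> sets lebesgue" "f \<in> L2 \<Omega>" "AE x in lebesgue_on \<Omega>. f x = g x"
  shows "g \<in> L2 \<Omega>" "L2_sq \<Omega> g = L2_sq \<Omega> f"
proof -
  note meas = measurable_lebesgue_on_AE[OF assms(1) L2D(1)[OF assms(2)] assms(3)]
  have sq: "AE x in lebesgue_on \<Omega>. (f x)\<^sup>2 = (g x)\<^sup>2"
    using assms(3) by eventually_elim simp
  show "g \<in> L2 \<Omega>"
    using integrable_lebesgue_on_AE[OF assms(1) L2D(2)[OF assms(2)] sq] meas by (simp add: L2_def)
  show "L2_sq \<Omega> g = L2_sq \<Omega> f"
    using sq meas L2D(1)[OF assms(2)] by (intro integral_cong_AE) auto
qed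

lemma test_function_L2:
  assumes "\<Omega> \<in> sets lebesgue" "\<phi> \<in> test_functions \<Omega>"
  shows "\<phi> \<in> L2 \<Omega>"
proof -
  have "\<phi> \<in> borel_measurable (lebesgue_on \<Omega>)"
    using integrable_lebesgue_onI[OF assms(1) test_function_integrable[OF assms(2)]] by auto
  then show ?thesis
    using integrable_lebesgue_onI[OF assms(1) test_function_sq_integrable[OF assms(2)]]
    by (simp add: L2_def)
qed

text \<open>
  The weak derivative chosen by \<open>weak_deriv\<close> is itself square integrable, because it agrees almost
  everywhere with the one that membership in \<open>H1\<close> provides and Lebesgue measure is complete.
\<close>

lemma H1D:
  assumes "open \<Omega>" "f \<in> H1 \<Omega>"
  shows "f \<in> L2 \<Omega>" "has_weak_deriv \<Omega> i f (weak_deriv \<Omega> i f)" "weak_deriv \<Omega> i f \<in> L2 \<Omega>"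
proof -
  show "f \<in> L2 \<Omega>" using assms(2) by (simp add: H1_def)
  obtain g where g: "g \<in> L2 \<Omega>" "has_weak_deriv \<Omega> i f g" using assms(2) by (auto simp: H1_def)
  show *: "has_weak_deriv \<Omega> i f (weak_deriv \<Omega> i f)"
    unfolding weak_deriv_def by (rule someI[where P = "has_weak_deriv \<Omega> i f", OF g(2)])
  show "weak_deriv \<Omega> i f \<in> L2 \<Omega>"
    using assms(1) by (intro L2_AE(1)[OF _ g(1) has_weak_deriv_unique[OF assms(1) g(2) *]]) auto
qed

lemma weak_deriv_eq:
  assumes "open \<Omega>" "has_weak_deriv \<Omega> i f g"
  shows "AE x in lebesgue_on \<Omega>. weak_deriv \<Omega> i f x = g x"
  using has_weak_deriv_unique[OF assms(1) someI[where P = "has_weak_deriv \<Omega> i f", OF assms(2)] assms(2)]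
  by (simp add: weak_deriv_def)

lemma H1_lincomb:
  assumes "open \<Omega>" "f \<in> H1 \<Omega>" "g \<in> H1 \<Omega>"
  shows "(\<lambda>x. a * f x + b * g x) \<in> H1 \<Omega>"
    and "AE x in lebesgue_on \<Omega>. weak_deriv \<Omega> i (\<lambda>x. a * f x + b * g x) x
          = a * weak_deriv \<Omega> i f x + b * weak_deriv \<Omega> i g x"
proof -
  have \<Omega>: "\<Omega> \<in> sets lebesgue" using assms(1) by auto
  have *: "has_weak_deriv \<Omega> i (\<lambda>x. a * f x + b * g x) (\<lambda>x. a * weak_deriv \<Omega> i f x + b * weak_deriv \<Omega> i g x)" for i
    by (rule has_weak_deriv_lincomb[OF \<Omega> H1D(2)[OF assms(1,2)] H1D(2)[OF assms(1,3)]])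
  show "(\<lambda>x. a * f x + b * g x) \<in> H1 \<Omega>"
    unfolding H1_def
    using * L2_lincomb(1)[OF H1D(1)[OF assms(1,2)] H1D(1)[OF assms(1,3)]]
      L2_lincomb(1)[OF H1D(3)[OF assms(1,2)] H1D(3)[OF assms(1,3)]] by blast
  show "AE x in lebesgue_on \<Omega>. weak_deriv \<Omega> i (\<lambda>x. a * f x + b * g x) x
          = a * weak_deriv \<Omega> i f x + b * weak_deriv \<Omega> i g x"
    by (rule weak_deriv_eq[OF assms(1) *])
qed

lemma H1_AE:
  assumes "open \<Omega>" "f \<in> H1 \<Omega>" "AE x in lebesgue_on \<Omega>. f x = g x"
  shows "g \<in> H1 \<Omega>" "AE x in lebesgue_on \<Omega>. weak_deriv \<Omega> i g x = weak_deriv \<Omega> i f x"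
proof -
  have \<Omega>: "\<Omega> \<in> sets lebesgue" using assms(1) by auto
  have *: "has_weak_deriv \<Omega> i g (weak_deriv \<Omega> i f)" for i
    by (rule has_weak_deriv_AE[OF \<Omega> H1D(2)[OF assms(1,2)] assms(3)]) simp
  show "g \<in> H1 \<Omega>"
    unfolding H1_def using * L2_AE(1)[OF \<Omega> H1D(1)[OF assms(1,2)] assms(3)] H1D(3)[OF assms(1,2)] by blast
  show "AE x in lebesgue_on \<Omega>. weak_deriv \<Omega> i g x = weak_deriv \<Omega> i f x"
    by (rule weak_deriv_eq[OF assms(1) *])
qed

lemma H2D:
  assumes "f \<in> H2 \<Omega>"
  shows "f \<in> H1 \<Omega>" "weak_deriv \<Omega> i f \<in> H1 \<Omega>"
  using assms by (auto simp: H2_def)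

lemma H2_lincomb:
  assumes "open \<Omega>" "f \<in> H2 \<Omega>" "g \<in> H2 \<Omega>"
  shows "(\<lambda>x. a * f x + b * g x) \<in> H2 \<Omega>"
    and "AE x in lebesgue_on \<Omega>. weak_deriv \<Omega> j (weak_deriv \<Omega> i (\<lambda>x. a * f x + b * g x)) x
          = a * weak_deriv \<Omega> j (weak_deriv \<Omega> i f) x + b * weak_deriv \<Omega> j (weak_deriv \<Omega> i g) x"
proof -
  note 1 = H1_lincomb[OF assms(1) H2D(1)[OF assms(2)] H2D(1)[OF assms(3)], where a = a and b = b]
  note 2 = H1_lincomb[OF assms(1) H2D(2)[OF assms(2)] H2D(2)[OF assms(3)], where a = a and b = b]
  have AE: "AE x in lebesgue_on \<Omega>. a * weak_deriv \<Omega> i f x + b * weak_deriv \<Omega> i g x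
      = weak_deriv \<Omega> i (\<lambda>x. a * f x + b * g x) x" for i
    using 1(2)[of i] by eventually_elim simp
  note 3 = H1_AE[OF assms(1) 2(1) AE]
  show "(\<lambda>x. a * f x + b * g x) \<in> H2 \<Omega>" using 1(1) 3(1) by (simp add: H2_def)
  show "AE x in lebesgue_on \<Omega>. weak_deriv \<Omega> j (weak_deriv \<Omega> i (\<lambda>x. a * f x + b * g x)) x
          = a * weak_deriv \<Omega> j (weak_deriv \<Omega> i f) x + b * weak_deriv \<Omega> j (weak_deriv \<Omega> i g) x"
    using 2(2)[of j i] 3(2)[of j i] by eventually_elim simp
qed

lemma smooth_weak_deriv:
  assumes "open \<Omega>" "smooth f"
  shows "AE x in lebesgue_on \<Omega>. weak_deriv \<Omega> i f x = partial_deriv i f x"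
  using assms by (intro weak_deriv_eq smooth_has_weak_deriv) auto

lemma test_function_H1:
  assumes "open \<Omega>" "\<phi> \<in> test_functions \<Omega>"
  shows "\<phi> \<in> H1 \<Omega>"
proof -
  have \<Omega>: "\<Omega> \<in> sets lebesgue" using assms(1) by auto
  show ?thesis unfolding H1_def
    using test_function_L2[OF \<Omega> assms(2)] test_function_L2[OF \<Omega> test_function_partial_deriv[OF assms(2)]]
      smooth_has_weak_deriv[OF \<Omega> test_functionD(1)[OF assms(2)]] by blast
qed

lemma test_function_H2:
  assumes "open \<Omega>" "\<phi> \<in> test_functions \<Omega>"
  shows "\<phi> \<in> H2 \<Omega>"
    and "AE x in lebesgue_on \<Omega>. weak_deriv \<Omega> j (weak_deriv \<Omega> i \<phi>) x = partial_deriv j (partial_deriv i \<phi>) x"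
proof -
  note 1 = test_function_H1[OF assms(1) test_function_partial_deriv[OF assms(2)]]
  have AE: "AE x in lebesgue_on \<Omega>. partial_deriv i \<phi> x = weak_deriv \<Omega> i \<phi> x" for i
    using smooth_weak_deriv[OF assms(1) test_functionD(1)[OF assms(2)], of i] by eventually_elim simp
  note 2 = H1_AE[OF assms(1) 1 AE]
  show "\<phi> \<in> H2 \<Omega>" using 2(1) test_function_H1[OF assms] by (simp add: H2_def)
  show "AE x in lebesgue_on \<Omega>. weak_deriv \<Omega> j (weak_deriv \<Omega> i \<phi>) x = partial_deriv j (partial_deriv i \<phi>) x"
    using 2(2)[of j i]
      smooth_weak_deriv[OF assms(1) smooth_partial_deriv[OF test_functionD(1)[OF assms(2)]], of j i]
    by eventually_elim simp
qed

text \<open>The squared \<open>L\<^sup>2\<close> norm of the Hessian.\<close>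

definition hess_sq :: "(real^'n) set \<Rightarrow> (real^'n \<Rightarrow> real) \<Rightarrow> real" where
  "hess_sq \<Omega> f = (\<Sum>i\<in>UNIV. \<Sum>j\<in>UNIV. L2_sq \<Omega> (weak_deriv \<Omega> j (weak_deriv \<Omega> i f)))"

lemma hess_sq_nonneg: "0 \<le> hess_sq \<Omega> f"
  unfolding hess_sq_def by (intro sum_nonneg integral_nonneg_AE) auto

lemma hess_sq_lincomb_le:
  assumes "open \<Omega>" "f \<in> H2 \<Omega>" "g \<in> H2 \<Omega>"
  shows "hess_sq \<Omega> (\<lambda>x. a * f x + b * g x) \<le> 2 * a\<^sup>2 * hess_sq \<Omega> f + 2 * b\<^sup>2 * hess_sq \<Omega> g"
proof -
  have \<Omega>: "\<Omega> \<in> sets lebesgue" using assms(1) by auto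
  have "hess_sq \<Omega> (\<lambda>x. a * f x + b * g x) \<le> (\<Sum>i\<in>UNIV. \<Sum>j\<in>UNIV.
      2 * a\<^sup>2 * L2_sq \<Omega> (weak_deriv \<Omega> j (weak_deriv \<Omega> i f)) +
      2 * b\<^sup>2 * L2_sq \<Omega> (weak_deriv \<Omega> j (weak_deriv \<Omega> i g)))"
    unfolding hess_sq_def
  proof (intro sum_mono)
    fix i j
    note l2 = L2_lincomb[OF H1D(3)[OF assms(1) H2D(2)[OF assms(2)]] H1D(3)[OF assms(1) H2D(2)[OF assms(3)]],
        where a = a and b = b]
    show "L2_sq \<Omega> (weak_deriv \<Omega> j (weak_deriv \<Omega> i (\<lambda>x. a * f x + b * g x))) \<le>
        2 * a\<^sup>2 * L2_sq \<Omega> (weak_deriv \<Omega> j (weak_deriv \<Omega> i f)) +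
        2 * b\<^sup>2 * L2_sq \<Omega> (weak_deriv \<Omega> j (weak_deriv \<Omega> i g))"
      using l2(2)[of j i j i] L2_AE(2)[OF \<Omega> l2(1)[of j i j i] AE_sym[OF H2_lincomb(2)[OF assms, of j i a b]]]
      by simp
  qed
  then show ?thesis by (simp add: hess_sq_def sum.distrib sum_distrib_left)
qed

text \<open>The square of the \<open>H\<^sup>2\<close> norm; a quadratic form, which avoids the square root.\<close>

definition H2_sq :: "(real^'n) set \<Rightarrow> (real^'n \<Rightarrow> real) \<Rightarrow> real" where
  "H2_sq \<Omega> f =
     L2_sq \<Omega> f
     + (\<Sum>i\<in>UNIV. L2_sq \<Omega> (weak_deriv \<Omega> i f))
     + hess_sq \<Omega> f"

lemma H2_norm_eq: "H2_norm \<Omega> f = sqrt (H2_sq \<Omega> f)"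
  by (simp add: H2_norm_def H2_sq_def hess_sq_def)

lemma H2_sq_nonneg: "0 \<le> H2_sq \<Omega> f"
  unfolding H2_sq_def by (intro add_nonneg_nonneg hess_sq_nonneg sum_nonneg integral_nonneg_AE) auto

lemma H2_sq_ge:
  shows "L2_sq \<Omega> f \<le> H2_sq \<Omega> f"
    and "L2_sq \<Omega> (weak_deriv \<Omega> i f)
      + (\<Sum>j\<in>UNIV. L2_sq \<Omega> (weak_deriv \<Omega> j (weak_deriv \<Omega> i f))) \<le> H2_sq \<Omega> f"
    and "hess_sq \<Omega> f \<le> H2_sq \<Omega> f"
proof -
  let ?A = "L2_sq \<Omega> f"
  let ?B = "\<lambda>i. L2_sq \<Omega> (weak_deriv \<Omega> i f)"
  let ?C = "\<lambda>i. \<Sum>j\<in>UNIV. L2_sq \<Omega> (weak_deriv \<Omega> j (weak_deriv \<Omega> i f))"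
  have nn: "0 \<le> ?A" "0 \<le> ?B k" "0 \<le> ?C k" for k
    by (intro sum_nonneg integral_nonneg_AE; simp)+
  have sums: "0 \<le> sum ?B UNIV" "0 \<le> sum ?C UNIV" "?B i \<le> sum ?B UNIV" "?C i \<le> sum ?C UNIV"
    by (intro sum_nonneg nn member_le_sum; simp add: nn)+
  show "?A \<le> H2_sq \<Omega> f" "?B i + ?C i \<le> H2_sq \<Omega> f" "hess_sq \<Omega> f \<le> H2_sq \<Omega> f"
    unfolding H2_sq_def hess_sq_def using nn(1) sums by linarith+
qed

lemma H2_sq_lincomb_le:
  assumes "open \<Omega>" "f \<in> H2 \<Omega>" "g \<in> H2 \<Omega>"
  shows "H2_sq \<Omega> (\<lambda>x. a * f x + b * g x) \<le> 2 * a\<^sup>2 * H2_sq \<Omega> f + 2 * b\<^sup>2 * H2_sq \<Omega> g"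
proof -
  have \<Omega>: "\<Omega> \<in> sets lebesgue" using assms(1) by auto
  let ?I = "L2_sq \<Omega>"
  note f1 = H2D[OF assms(2)] and g1 = H2D[OF assms(3)]
  have 0: "?I (\<lambda>x. a * f x + b * g x) \<le> 2 * a\<^sup>2 * ?I f + 2 * b\<^sup>2 * ?I g"
    by (rule L2_lincomb(2)[OF H1D(1)[OF assms(1) f1(1)] H1D(1)[OF assms(1) g1(1)]])
  have 1: "?I (weak_deriv \<Omega> i (\<lambda>x. a * f x + b * g x)) \<le> 2 * a\<^sup>2 * ?I (weak_deriv \<Omega> i f) + 2 * b\<^sup>2 * ?I (weak_deriv \<Omega> i g)" for i
  proof -
    note l2 = L2_lincomb[OF H1D(3)[OF assms(1) f1(1)] H1D(3)[OF assms(1) g1(1)], where a = a and b = b]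
    show ?thesis
      using l2(2)[of i i] L2_AE(2)[OF \<Omega> l2(1)[of i i]
        AE_sym[OF H1_lincomb(2)[OF assms(1) f1(1) g1(1), where i = i and a = a and b = b]]] by simp
  qed
  have "H2_sq \<Omega> (\<lambda>x. a * f x + b * g x) \<le>
      (2 * a\<^sup>2 * ?I f + 2 * b\<^sup>2 * ?I g)
      + (\<Sum>i\<in>UNIV. 2 * a\<^sup>2 * ?I (weak_deriv \<Omega> i f) + 2 * b\<^sup>2 * ?I (weak_deriv \<Omega> i g))
      + (2 * a\<^sup>2 * hess_sq \<Omega> f + 2 * b\<^sup>2 * hess_sq \<Omega> g)"
    unfolding H2_sq_def by (intro add_mono sum_mono 0 1 hess_sq_lincomb_le[OF assms])
  then show ?thesis
    by (simp add: H2_sq_def sum.distrib sum_distrib_left algebra_simps)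
qed

text \<open>
  Differences are written \<open>1 * w x + -1 * \<phi> n x\<close> here and below, in the form in which the lemmas on
  linear combinations apply to them.
\<close>

lemma H2_0D:
  assumes "w \<in> H2_0 \<Omega>"
  obtains \<phi> where "w \<in> H2 \<Omega>" "\<And>n. \<phi> n \<in> test_functions \<Omega>" "(\<lambda>n. H2_sq \<Omega> (\<lambda>x. 1 * w x + -1 * \<phi> n x)) \<longlonglongrightarrow> 0"
proof -
  obtain \<phi> where \<phi>: "w \<in> H2 \<Omega>" "\<And>n. \<phi> n \<in> test_functions \<Omega>" "(\<lambda>n. H2_norm \<Omega> (\<lambda>x. w x - \<phi> n x)) \<longlonglongrightarrow> 0"
    using assms by (auto simp: H2_0_def)
  have "(\<lambda>n. (H2_norm \<Omega> (\<lambda>x. w x - \<phi> n x))\<^sup>2) \<longlonglongrightarrow> 0\<^sup>2"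
    by (intro tendsto_power \<phi>(3))
  then have "(\<lambda>n. H2_sq \<Omega> (\<lambda>x. 1 * w x + -1 * \<phi> n x)) \<longlonglongrightarrow> 0"
    by (simp add: H2_norm_eq H2_sq_nonneg)
  with \<phi>(1,2) show ?thesis by (rule that)
qed

lemma H2_0_lincomb:
  assumes "open \<Omega>" "f \<in> H2_0 \<Omega>" "g \<in> H2_0 \<Omega>"
  shows "(\<lambda>x. a * f x + b * g x) \<in> H2_0 \<Omega>"
proof -
  obtain \<phi> where f: "f \<in> H2 \<Omega>" and \<phi>: "\<And>n. \<phi> n \<in> test_functions \<Omega>" "(\<lambda>n. H2_sq \<Omega> (\<lambda>x. 1 * f x + -1 * \<phi> n x)) \<longlonglongrightarrow> 0"
    using H2_0D[OF assms(2)] by metis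
  obtain \<psi> where g: "g \<in> H2 \<Omega>" and \<psi>: "\<And>n. \<psi> n \<in> test_functions \<Omega>" "(\<lambda>n. H2_sq \<Omega> (\<lambda>x. 1 * g x + -1 * \<psi> n x)) \<longlonglongrightarrow> 0"
    using H2_0D[OF assms(3)] by metis
  let ?h = "\<lambda>x. a * f x + b * g x" and ?\<chi> = "\<lambda>n x. a * \<phi> n x + b * \<psi> n x"
  let ?bd = "\<lambda>n. 2 * a\<^sup>2 * H2_sq \<Omega> (\<lambda>x. 1 * f x + -1 * \<phi> n x) + 2 * b\<^sup>2 * H2_sq \<Omega> (\<lambda>x. 1 * g x + -1 * \<psi> n x)"
  have "?bd \<longlonglongrightarrow> 2 * a\<^sup>2 * 0 + 2 * b\<^sup>2 * 0"
    by (intro tendsto_add tendsto_mult tendsto_const \<phi>(2) \<psi>(2))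
  then have bd: "?bd \<longlonglongrightarrow> 0" by simp
  have le: "H2_sq \<Omega> (\<lambda>x. ?h x - ?\<chi> n x) \<le> ?bd n" for n
  proof -
    have "(\<lambda>x. 1 * f x + -1 * \<phi> n x) \<in> H2 \<Omega>" "(\<lambda>x. 1 * g x + -1 * \<psi> n x) \<in> H2 \<Omega>"
      by (rule H2_lincomb(1)[OF assms(1) f test_function_H2(1)[OF assms(1) \<phi>(1)]],
          rule H2_lincomb(1)[OF assms(1) g test_function_H2(1)[OF assms(1) \<psi>(1)]])
    from H2_sq_lincomb_le[OF assms(1) this, of a b]
    show ?thesis by (simp add: algebra_simps)
  qed
  have "(\<lambda>n. H2_sq \<Omega> (\<lambda>x. ?h x - ?\<chi> n x)) \<longlonglongrightarrow> 0"
    by (rule tendsto_sandwich[OF _ _ tendsto_const bd])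
       (intro always_eventually allI H2_sq_nonneg le)+
  then have "(\<lambda>n. H2_norm \<Omega> (\<lambda>x. ?h x - ?\<chi> n x)) \<longlonglongrightarrow> 0"
    unfolding H2_norm_eq using tendsto_real_sqrt by fastforce
  moreover have "?\<chi> n \<in> test_functions \<Omega>" for n
    by (rule test_function_lincomb[OF \<phi>(1) \<psi>(1)])
  moreover have "?h \<in> H2 \<Omega>" by (rule H2_lincomb(1)[OF assms(1) f g])
  ultimately show ?thesis unfolding H2_0_def by (auto intro!: exI[of _ ?\<chi>])
qed

section \<open>Poincare inequality\<close>

lemma smooth_affine: "smooth (\<lambda>x::real^'n. b \<bullet> x + c)"
  and partial_deriv_affine: "partial_deriv i (\<lambda>x::real^'n. b \<bullet> x + c) = (\<lambda>x. b $ i)"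
proof -
  have der: "((\<lambda>x. b \<bullet> x + c) has_derivative (\<lambda>h. b \<bullet> h)) (at x)" for x :: "real^'n"
    by (auto intro!: derivative_eq_intros)
  show *: "partial_deriv i (\<lambda>x::real^'n. b \<bullet> x + c) = (\<lambda>x. b $ i)" for i
    by (rule ext, subst partial_deriv_eqI[OF der]) (simp add: inner_axis)
  have "C_k k (\<lambda>x::real^'n. b \<bullet> x + c)" for k
  proof (cases k)
    case 0
    then show ?thesis by (simp add: continuous_intros)
  next
    case (Suc k)
    have "(\<lambda>x. b \<bullet> x + c) differentiable (at x)" for x :: "real^'n"
      using der differentiableI by blast
    then show ?thesis by (simp add: Suc * C_k_const)
  qed
  then show "smooth (\<lambda>x::real^'n. b \<bullet> x + c)" by (simp add: smooth_def)
qed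

lemma smooth_component: "smooth (\<lambda>x::real^'n. x $ i)"
  and partial_deriv_component: "partial_deriv j (\<lambda>x::real^'n. x $ i) = (\<lambda>x. axis i 1 $ j)"
  using smooth_affine[of "axis i 1" 0] partial_deriv_affine[of j "axis i 1" 0] by (simp_all add: inner_axis')

text \<open>Integration by parts of \<open>\<phi>\<^sup>2 = \<phi>\<^sup>2 \<cdot> \<partial>\<^sub>i x\<^sub>i\<close>, followed by Young's inequality.\<close>

lemma Poincare_test_function:
  fixes \<phi> :: "real^'n \<Rightarrow> real"
  assumes \<phi>: "\<phi> \<in> test_functions \<Omega>" and \<Omega>: "\<Omega> \<subseteq> ball 0 R"
  shows "(LINT x|lborel. (\<phi> x)\<^sup>2) \<le> 4 * R\<^sup>2 * (LINT x|lborel. (partial_deriv i \<phi> x)\<^sup>2)"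
proof -
  let ?D = "partial_deriv i \<phi>"
  note sm = test_functionD(1)[OF \<phi>]
  note tD = test_function_partial_deriv[OF \<phi>, of i]
  note int1 = test_function_sq_integrable[OF \<phi>] and int2 = test_function_sq_integrable[OF tD]
  have "(LINT x|lborel. x $ i * partial_deriv i (\<lambda>x. \<phi> x * \<phi> x) x)
      = - (LINT x|lborel. partial_deriv i (\<lambda>x. x $ i) x * (\<phi> x * \<phi> x))"
    by (rule integration_by_parts[OF smooth_component test_function_mult[OF sm \<phi>]])
  then have "(LINT x|lborel. (\<phi> x)\<^sup>2) = - (LINT x|lborel. x $ i * (\<phi> x * ?D x + ?D x * \<phi> x))"
    by (simp add: partial_deriv_component axis_def power2_eq_square
        partial_deriv_mult[OF smooth_differentiable[OF sm] smooth_differentiable[OF sm]])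
  also have "\<dots> = (LINT x|lborel. - (x $ i * (\<phi> x * ?D x + ?D x * \<phi> x)))" by simp
  also have "\<dots> \<le> (LINT x|lborel. (\<phi> x)\<^sup>2 / 2 + 2 * R\<^sup>2 * (?D x)\<^sup>2)"
  proof (rule integral_mono)
    have "(\<lambda>x. \<phi> x * ?D x + ?D x * \<phi> x) \<in> test_functions \<Omega>"
      using test_function_lincomb[OF test_function_mult[OF sm tD] test_function_mult[OF sm tD], of 1 1]
      by (simp add: mult.commute)
    then have "integrable lborel (\<lambda>x. x $ i * (\<phi> x * ?D x + ?D x * \<phi> x))"
      by (rule test_function_integrable[OF test_function_mult[OF smooth_component]])
    then show "integrable lborel (\<lambda>x. - (x $ i * (\<phi> x * ?D x + ?D x * \<phi> x)))" by simp
    show "integrable lborel (\<lambda>x. (\<phi> x)\<^sup>2 / 2 + 2 * R\<^sup>2 * (?D x)\<^sup>2)" using int1 int2 by simp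
    show "- (x $ i * (\<phi> x * ?D x + ?D x * \<phi> x)) \<le> (\<phi> x)\<^sup>2 / 2 + 2 * R\<^sup>2 * (?D x)\<^sup>2" for x
    proof (cases "x \<in> \<Omega>")
      case True
      then have "\<bar>x $ i\<bar> \<le> R"
        using \<Omega> component_le_norm_cart[of x i] by (auto simp: dist_norm)
      then have "(x $ i)\<^sup>2 \<le> R\<^sup>2" by (metis abs_le_square_iff abs_ge_self order_trans)
      then have "2 * (x $ i)\<^sup>2 * (?D x)\<^sup>2 \<le> 2 * R\<^sup>2 * (?D x)\<^sup>2" by (intro mult_right_mono) auto
      moreover have "0 \<le> (\<phi> x + 2 * (x $ i * ?D x))\<^sup>2" by simp
      ultimately show ?thesis by (simp add: power2_eq_square algebra_simps)
    next
      case False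
      then show ?thesis using test_function_eq_0[OF \<phi> False] by simp
    qed
  qed
  also have "\<dots> = (LINT x|lborel. (\<phi> x)\<^sup>2) / 2 + 2 * R\<^sup>2 * (LINT x|lborel. (?D x)\<^sup>2)"
    using int1 int2 by simp
  finally show ?thesis by simp
qed

lemma test_function_norms:
  fixes \<phi> :: "real^'n \<Rightarrow> real"
  assumes \<Omega>: "open \<Omega>" and \<phi>: "\<phi> \<in> test_functions \<Omega>"
  shows "L2_sq \<Omega> \<phi> = (LINT x|lborel. (\<phi> x)\<^sup>2)"
    and "L2_sq \<Omega> (weak_deriv \<Omega> i \<phi>) = (LINT x|lborel. (partial_deriv i \<phi> x)\<^sup>2)"
    and "L2_sq \<Omega> (weak_deriv \<Omega> j (weak_deriv \<Omega> i \<phi>))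
          = (LINT x|lborel. (partial_deriv j (partial_deriv i \<phi>) x)\<^sup>2)"
proof -
  have \<Omega>': "\<Omega> \<in> sets lebesgue" using \<Omega> by auto
  have *: "L2_sq \<Omega> \<phi> = (LINT x|lborel. (\<phi> x)\<^sup>2)" if "\<phi> \<in> test_functions \<Omega>" for \<phi>
    using test_function_eq_0[OF that] test_function_measurable[OF that]
    by (intro integral_lebesgue_on_support[OF \<Omega>']) auto
  note t1 = test_function_partial_deriv[OF \<phi>]
  note t2 = test_function_partial_deriv[OF t1]
  show "L2_sq \<Omega> (weak_deriv \<Omega> i \<phi>) = (LINT x|lborel. (partial_deriv i \<phi> x)\<^sup>2)"
    using L2_AE(2)[OF \<Omega>' test_function_L2[OF \<Omega>' t1] AE_sym[OF smooth_weak_deriv[OF \<Omega> test_functionD(1)[OF \<phi>]]]]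
      *[OF t1] by simp
  show "L2_sq \<Omega> (weak_deriv \<Omega> j (weak_deriv \<Omega> i \<phi>))
          = (LINT x|lborel. (partial_deriv j (partial_deriv i \<phi>) x)\<^sup>2)"
    using L2_AE(2)[OF \<Omega>' test_function_L2[OF \<Omega>' t2] AE_sym[OF test_function_H2(2)[OF \<Omega> \<phi>]]]
      *[OF t2] by simp
  show "L2_sq \<Omega> \<phi> = (LINT x|lborel. (\<phi> x)\<^sup>2)" by (rule *[OF \<phi>])
qed

lemma H2_sq_le_hess_sq_test_function:
  fixes \<phi> :: "real^'n \<Rightarrow> real"
  assumes "open \<Omega>" "\<Omega> \<subseteq> ball 0 R" "\<phi> \<in> test_functions \<Omega>"
  shows "H2_sq \<Omega> \<phi> \<le> (1 + 4 * R\<^sup>2 + (4 * R\<^sup>2)\<^sup>2) * hess_sq \<Omega> \<phi>"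
proof -
  let ?c = "4 * R\<^sup>2"
  let ?A = "LINT x|lborel. (\<phi> x)\<^sup>2"
  let ?B = "\<lambda>i. LINT x|lborel. (partial_deriv i \<phi> x)\<^sup>2"
  let ?C = "\<lambda>i j. LINT x|lborel. (partial_deriv j (partial_deriv i \<phi>) x)\<^sup>2"
  have h: "hess_sq \<Omega> \<phi> = (\<Sum>i\<in>UNIV. \<Sum>j\<in>UNIV. ?C i j)"
    by (simp add: hess_sq_def test_function_norms[OF assms(1,3)])
  have "?B i \<le> ?c * (\<Sum>j\<in>UNIV. ?C i j)" for i
  proof -
    have "?B i \<le> ?c * ?C i i"
      by (rule Poincare_test_function[OF test_function_partial_deriv[OF assms(3)] assms(2)])
    also have "\<dots> \<le> ?c * (\<Sum>j\<in>UNIV. ?C i j)"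
      by (intro mult_left_mono member_le_sum) auto
    finally show ?thesis .
  qed
  then have B: "(\<Sum>i\<in>UNIV. ?B i) \<le> ?c * hess_sq \<Omega> \<phi>"
    unfolding h sum_distrib_left[of ?c] by (intro sum_mono)
  fix k :: 'n
  have "?A \<le> ?c * ?B k" by (rule Poincare_test_function[OF assms(3,2)])
  also have "\<dots> \<le> ?c * (\<Sum>i\<in>UNIV. ?B i)"
    by (intro mult_left_mono member_le_sum) auto
  also have "\<dots> \<le> ?c * (?c * hess_sq \<Omega> \<phi>)" by (intro mult_left_mono B) auto
  finally have "?A \<le> ?c * (?c * hess_sq \<Omega> \<phi>)" .
  moreover have "H2_sq \<Omega> \<phi> = ?A + (\<Sum>i\<in>UNIV. ?B i) + hess_sq \<Omega> \<phi>"
    by (simp add: H2_sq_def h test_function_norms[OF assms(1,3)])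
  ultimately show ?thesis using B by (simp add: power2_eq_square algebra_simps)
qed

text \<open>
  Poincare's inequality on the closure of the test functions, in the only form needed: a function
  whose Hessian vanishes has norm \<open>0\<close>.
\<close>

lemma H2_0_hess_zero_imp_zero:
  fixes w :: "real^'n \<Rightarrow> real"
  assumes \<Omega>: "open \<Omega>" "\<Omega> \<subseteq> ball 0 R" and w: "w \<in> H2_0 \<Omega>" and hz: "hess_sq \<Omega> w = 0"
  shows "H2_sq \<Omega> w = 0"
proof -
  obtain \<phi> where wH: "w \<in> H2 \<Omega>" and \<phi>: "\<And>n. \<phi> n \<in> test_functions \<Omega>"
    and lim: "(\<lambda>n. H2_sq \<Omega> (\<lambda>x. 1 * w x + -1 * \<phi> n x)) \<longlonglongrightarrow> 0"
    by (rule H2_0D[OF w]) (rule that)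
  let ?q = "\<lambda>n. H2_sq \<Omega> (\<lambda>x. 1 * w x + -1 * \<phi> n x)" and ?K = "1 + 4 * R\<^sup>2 + (4 * R\<^sup>2)\<^sup>2"
  have "H2_sq \<Omega> w \<le> (2 + 4 * ?K) * ?q n" for n
  proof -
    let ?d = "\<lambda>x. 1 * w x + -1 * \<phi> n x"
    have \<phi>H: "\<phi> n \<in> H2 \<Omega>" by (rule test_function_H2(1)[OF \<Omega>(1) \<phi>])
    have dH: "?d \<in> H2 \<Omega>" by (rule H2_lincomb(1)[OF \<Omega>(1) wH \<phi>H])
    have "hess_sq \<Omega> (\<phi> n) \<le> 2 * ?q n"
      using hess_sq_lincomb_le[OF \<Omega>(1) wH dH, of 1 "-1"] H2_sq_ge(3)[of \<Omega> ?d] hz by simp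
    then have "?K * hess_sq \<Omega> (\<phi> n) \<le> ?K * (2 * ?q n)"
      by (intro mult_left_mono) auto
    then have "H2_sq \<Omega> (\<phi> n) \<le> ?K * (2 * ?q n)"
      using H2_sq_le_hess_sq_test_function[OF \<Omega> \<phi>, of n] by linarith
    moreover have "H2_sq \<Omega> w \<le> 2 * ?q n + 2 * H2_sq \<Omega> (\<phi> n)"
      using H2_sq_lincomb_le[OF \<Omega>(1) dH \<phi>H, of 1 1] by simp
    ultimately show ?thesis by (simp add: algebra_simps)
  qed
  moreover have "(\<lambda>n. (2 + 4 * ?K) * ?q n) \<longlonglongrightarrow> (2 + 4 * ?K) * 0"
    by (intro tendsto_mult tendsto_const lim)
  ultimately have "H2_sq \<Omega> w \<le> 0"
    by (intro LIMSEQ_le_const[of _ 0]) auto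
  then show ?thesis using H2_sq_nonneg[of \<Omega> w] by linarith
qed

section \<open>Continuous representatives in two dimensions\<close>

lemma vector_2_in_box:
  "(vector [a, b] :: real^2) \<in> box l u \<longleftrightarrow> a \<in> {l$1<..<u$1} \<and> b \<in> {l$2<..<u$2}"
  by (auto simp: mem_box_cart forall_2)

lemma measurable_vector_2 [measurable]: "(\<lambda>(a, b). vector [a, b] :: real^2) \<in> borel_measurable (borel \<Otimes>\<^sub>M borel)"
proof -
  have "continuous_on UNIV (\<lambda>p. vector [fst p, snd p] :: real^2)"
    by (subst continuous_on_componentwise) (auto simp: Basis_vec_def inner_axis forall_2
        intro!: continuous_intros)
  then show ?thesis by (simp add: borel_prod case_prod_unfold borel_measurable_continuous_onI)
qed

text \<open>Lebesgue measure on \<open>real^2\<close> is the image of the product measure, which gives access to Fubini.\<close>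

lemma distr_vector_2: "distr (lborel \<Otimes>\<^sub>M lborel) borel (\<lambda>(a, b). vector [a, b] :: real^2) = lborel"
proof (rule lborel_eqI[symmetric])
  fix l u :: "real^2"
  assume lu: "\<And>b. b \<in> Basis \<Longrightarrow> l \<bullet> b \<le> u \<bullet> b"
  have le: "l$i \<le> u$i" for i
    using lu[of "axis i 1"] by (auto simp: inner_axis Basis_vec_def)
  have "(\<lambda>(a, b). vector [a, b] :: real^2) -` box l u = {l$1<..<u$1} \<times> {l$2<..<u$2}"
    by (auto simp: vector_2_in_box)
  then have "emeasure (distr (lborel \<Otimes>\<^sub>M lborel) borel (\<lambda>(a, b). vector [a, b] :: real^2)) (box l u)
      = emeasure (lborel \<Otimes>\<^sub>M lborel) ({l$1<..<u$1} \<times> {l$2<..<u$2})"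
    by (subst emeasure_distr) (auto simp: space_pair_measure)
  also have "\<dots> = ennreal (u$1 - l$1) * ennreal (u$2 - l$2)"
    using le by (subst lborel.emeasure_pair_measure_Times) auto
  also have "\<dots> = ennreal (\<Prod>b\<in>Basis. (u - l) \<bullet> b)"
  proof -
    have "(\<Prod>b\<in>Basis. (u - l) \<bullet> b) = (\<Prod>i\<in>UNIV. (u - l) \<bullet> axis i 1)"
      unfolding Basis_vec_def by (subst prod.UNION_disjoint) (auto simp: axis_eq_axis)
    also have "\<dots> = (u$1 - l$1) * (u$2 - l$2)" by (simp add: inner_axis UNIV_2)
    finally show ?thesis using le by (simp add: ennreal_mult)
  qed
  finally show "emeasure (distr (lborel \<Otimes>\<^sub>M lborel) borel (\<lambda>(a, b). vector [a, b] :: real^2)) (box l u)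
      = ennreal (\<Prod>b\<in>Basis. (u - l) \<bullet> b)" .
qed simp

lemma nn_integral_real2:
  fixes f :: "real^2 \<Rightarrow> ennreal"
  assumes [measurable]: "f \<in> borel_measurable borel"
  shows "(\<integral>\<^sup>+x. f x \<partial>lborel) = (\<integral>\<^sup>+a. \<integral>\<^sup>+b. f (vector [a, b]) \<partial>lborel \<partial>lborel)"
proof -
  have "(\<integral>\<^sup>+x. f x \<partial>lborel) = (\<integral>\<^sup>+x. f x \<partial>distr (lborel \<Otimes>\<^sub>M lborel) borel (\<lambda>(a, b). vector [a, b] :: real^2))"
    by (simp only: distr_vector_2)
  also have "\<dots> = (\<integral>\<^sup>+p. f (vector [fst p, snd p]) \<partial>(lborel \<Otimes>\<^sub>M lborel))"
    by (subst nn_integral_distr) (auto simp: case_prod_unfold)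
  also have "\<dots> = (\<integral>\<^sup>+a. \<integral>\<^sup>+b. f (vector [a, b]) \<partial>lborel \<partial>lborel)"
    by (subst lborel.nn_integral_fst[symmetric]) (auto simp: case_prod_unfold)
  finally show ?thesis .
qed

lemma abs_le_nn_integral_deriv:
  fixes g g' :: "real \<Rightarrow> real"
  assumes der: "\<And>t. (g has_real_derivative g' t) (at t)" and cont: "continuous_on UNIV g'"
    and zero: "\<And>t. t \<le> a \<Longrightarrow> g t = 0"
  shows "ennreal \<bar>g x\<bar> \<le> (\<integral>\<^sup>+t. ennreal \<bar>g' t\<bar> \<partial>lborel)"
proof (cases "a \<le> x")
  case True
  have "has_bochner_integral lborel (\<lambda>t. g' t * indicator {a..x} t) (g x - g a)"
    by (rule has_bochner_integral_FTC_Icc_real[OF True der])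
       (use cont in \<open>auto simp: continuous_on_eq_continuous_at\<close>)
  then have "integrable lborel (\<lambda>t. g' t * indicator {a..x} t)" "(LINT t|lborel. g' t * indicator {a..x} t) = g x"
    using zero[of a] by (auto simp: has_bochner_integral_iff)
  then have "ennreal \<bar>g x\<bar> \<le> (\<integral>\<^sup>+t. ennreal (norm (g' t * indicator {a..x} t)) \<partial>lborel)"
    using integral_norm_bound_ennreal by fastforce
  also have "\<dots> \<le> (\<integral>\<^sup>+t. ennreal \<bar>g' t\<bar> \<partial>lborel)"
    by (intro nn_integral_mono) (auto simp: indicator_def)
  finally show ?thesis .
next
  case False
  then show ?thesis using zero[of x] by simp
qed

text \<open>
  In the plane a test function is bounded by the \<open>L\<^sup>1\<close> norm of its mixed second derivative, since
  it is the iterated integral of that derivative over a quadrant.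
\<close>

lemma test_function_sup_bound:
  fixes \<phi> :: "real^2 \<Rightarrow> real"
  assumes \<phi>: "\<phi> \<in> test_functions \<Omega>"
  shows "\<bar>\<phi> x\<bar> \<le> (LINT y|lborel. \<bar>partial_deriv 2 (partial_deriv 1 \<phi>) y\<bar>)"
proof -
  let ?D1 = "partial_deriv 1 \<phi>" and ?D = "partial_deriv 2 (partial_deriv 1 \<phi>)"
  note t1 = test_function_partial_deriv[OF \<phi>, of 1]
  note t2 = test_function_partial_deriv[OF t1, of 2]
  obtain r where r: "\<And>x. x \<in> closure {x. \<phi> x \<noteq> 0} \<Longrightarrow> norm x \<le> r"
    using compact_imp_bounded[OF test_functionD(2)[OF \<phi>]] unfolding bounded_iff by auto
  have out: "vector [a, b] \<notin> closure {x. \<phi> x \<noteq> 0}" if "a < - r \<or> b < - r" for a b :: real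
  proof
    assume "vector [a, b] \<in> closure {x. \<phi> x \<noteq> 0}"
    then have "norm (vector [a, b] :: real^2) \<le> r" by (rule r)
    then show False
      using that component_le_norm_cart[of "vector [a, b] :: real^2" 1]
        component_le_norm_cart[of "vector [a, b] :: real^2" 2] by auto
  qed
  have vec1: "vector [a, b] = (vector [0, b] :: real^2) + a *\<^sub>R axis 1 1" for a b :: real
    by (simp add: vec_eq_iff forall_2 axis_def)
  have vec2: "vector [a, b] = (vector [a, 0] :: real^2) + b *\<^sub>R axis 2 1" for a b :: real
    by (simp add: vec_eq_iff forall_2 axis_def)
  have cont1: "continuous_on UNIV (\<lambda>a. vector [a, b] :: real^2)" for b
    by (subst vec1) (intro continuous_intros)
  have cont2: "continuous_on UNIV (\<lambda>b. vector [a, b] :: real^2)" for a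
    by (subst vec2) (intro continuous_intros)
  have x: "x = vector [x$1, x$2]" by (simp add: vec_eq_iff forall_2)
  have "ennreal \<bar>\<phi> (vector [x$1, x$2])\<bar> \<le> (\<integral>\<^sup>+a. ennreal \<bar>?D1 (vector [a, x$2])\<bar> \<partial>lborel)"
  proof (rule abs_le_nn_integral_deriv[where a = "- r - 1" and x = "x$1"
          and g = "\<lambda>a. \<phi> (vector [a, x$2])" and g' = "\<lambda>a. ?D1 (vector [a, x$2])"])
    show "((\<lambda>a. \<phi> (vector [a, x$2])) has_real_derivative ?D1 (vector [t, x$2])) (at t)" for t
      using smooth_DERIV_line[OF test_functionD(1)[OF \<phi>], of "vector [0, x$2]" 1 t]
      by (simp only: vec1[symmetric])
    show "continuous_on UNIV (\<lambda>a. ?D1 (vector [a, x$2]))"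
      by (rule continuous_on_compose2[OF smooth_continuous_on[OF test_functionD(1)[OF t1], of UNIV] cont1]) simp
    show "\<phi> (vector [t, x$2]) = 0" if "t \<le> - r - 1" for t
      using test_function_zero[OF \<phi> out[of t "x$2"]] that by simp
  qed
  also have "\<dots> \<le> (\<integral>\<^sup>+a. \<integral>\<^sup>+b. ennreal \<bar>?D (vector [a, b])\<bar> \<partial>lborel \<partial>lborel)"
  proof (rule nn_integral_mono)
    fix a
    show "ennreal \<bar>?D1 (vector [a, x$2])\<bar> \<le> (\<integral>\<^sup>+b. ennreal \<bar>?D (vector [a, b])\<bar> \<partial>lborel)"
    proof (rule abs_le_nn_integral_deriv[where a = "- r - 1" and x = "x$2"
            and g = "\<lambda>b. ?D1 (vector [a, b])" and g' = "\<lambda>b. ?D (vector [a, b])"])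
      show "((\<lambda>b. ?D1 (vector [a, b])) has_real_derivative ?D (vector [a, t])) (at t)" for t
        using smooth_DERIV_line[OF test_functionD(1)[OF t1], of "vector [a, 0]" 2 t]
        by (simp only: vec2[symmetric])
      show "continuous_on UNIV (\<lambda>b. ?D (vector [a, b]))"
        by (rule continuous_on_compose2[OF smooth_continuous_on[OF test_functionD(1)[OF t2], of UNIV] cont2]) simp
      show "?D1 (vector [a, t]) = 0" if "t \<le> - r - 1" for t
        using partial_deriv_outside_support[OF out[of a t]] that by simp
    qed
  qed
  also have "\<dots> = (\<integral>\<^sup>+y. ennreal \<bar>?D y\<bar> \<partial>lborel)"
    using test_function_measurable[OF t2] by (subst nn_integral_real2) auto
  also have "\<dots> = ennreal (LINT y|lborel. \<bar>?D y\<bar>)"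
    using test_function_integrable[OF t2] by (intro nn_integral_eq_integral) auto
  finally show ?thesis
    by (subst (asm) ennreal_le_iff) (auto simp: x[symmetric] intro!: integral_nonneg_AE)
qed

text \<open>
  Young's inequality replaces the \<open>L\<^sup>1\<close> norm by the \<open>H\<^sup>2\<close> norm; the free parameter \<open>\<delta>\<close> takes the place
  of the Cauchy-Schwarz inequality.
\<close>

lemma test_function_sup_bound_H2:
  fixes \<phi> :: "real^2 \<Rightarrow> real"
  assumes \<phi>: "\<phi> \<in> test_functions (ball 0 R)" and "0 < \<delta>"
  shows "\<bar>\<phi> x\<bar> \<le> \<delta> * measure lborel (ball (0::real^2) R) + H2_sq (ball 0 R) \<phi> / \<delta>"
proof -
  let ?B = "ball (0::real^2) R" and ?D = "partial_deriv 2 (partial_deriv 1 \<phi>)"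
  note t = test_function_partial_deriv[OF test_function_partial_deriv[OF \<phi>, of 1], of 2]
  note int = test_function_sq_integrable[OF t]
  have intB: "integrable lborel (indicator ?B :: _ \<Rightarrow> real)"
    using emeasure_bounded_finite[OF bounded_ball, of "0::real^2" R]
    by (simp add: integrable_indicator_iff)
  have "\<bar>\<phi> x\<bar> \<le> (LINT y|lborel. \<bar>?D y\<bar>)" by (rule test_function_sup_bound[OF \<phi>])
  also have "\<dots> \<le> (LINT y|lborel. \<delta> * indicator ?B y + (?D y)\<^sup>2 / \<delta>)"
  proof (rule integral_mono)
    show "integrable lborel (\<lambda>y. \<bar>?D y\<bar>)" using test_function_integrable[OF t] by simp
    show "integrable lborel (\<lambda>y. \<delta> * indicator ?B y + (?D y)\<^sup>2 / \<delta>)" using int intB by simp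
    show "\<bar>?D y\<bar> \<le> \<delta> * indicator ?B y + (?D y)\<^sup>2 / \<delta>" for y
    proof (cases "y \<in> ?B")
      case True
      have "2 * (\<delta> * \<bar>?D y\<bar>) \<le> \<delta>\<^sup>2 + (?D y)\<^sup>2"
        using sum_squares_bound[of \<delta> "\<bar>?D y\<bar>"] by simp
      moreover have "0 \<le> \<delta> * \<bar>?D y\<bar>" using assms(2) by simp
      ultimately have "\<delta> * \<bar>?D y\<bar> \<le> \<delta>\<^sup>2 + (?D y)\<^sup>2" by linarith
      then show ?thesis using True assms(2) by (simp add: field_simps power2_eq_square)
    next
      case False
      then show ?thesis using test_function_eq_0[OF t False] by simp
    qed
  qed
  also have "\<dots> = \<delta> * measure lborel ?B + (LINT y|lborel. (?D y)\<^sup>2) / \<delta>"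
    using int intB by simp
  also have "(LINT y|lborel. (?D y)\<^sup>2) \<le> H2_sq ?B \<phi>"
  proof -
    have "(LINT y|lborel. (?D y)\<^sup>2) = (LINT y|lebesgue_on ?B. (weak_deriv ?B 2 (weak_deriv ?B 1 \<phi>) y)\<^sup>2)"
      by (simp add: test_function_norms(3)[OF _ \<phi>])
    also have "\<dots> \<le> (\<Sum>j\<in>UNIV. LINT y|lebesgue_on ?B. (weak_deriv ?B j (weak_deriv ?B 1 \<phi>) y)\<^sup>2)"
      by (rule member_le_sum) auto
    also have "\<dots> \<le> H2_sq ?B \<phi>"
    proof -
      have "0 \<le> (LINT y|lebesgue_on ?B. (weak_deriv ?B 1 \<phi> y)\<^sup>2)" by (rule integral_nonneg_AE) simp
      then show ?thesis using H2_sq_ge(2)[of ?B 1 \<phi>] by linarith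
    qed
    finally show ?thesis .
  qed
  finally show ?thesis using assms(2) by (simp add: divide_right_mono)
qed

lemma continuous_L2_ball:
  fixes v :: "real^'n \<Rightarrow> real"
  assumes "continuous_on UNIV v"
  shows "v \<in> L2 (ball 0 R)"
proof -
  have "integrable lborel (\<lambda>x. indicator (cball 0 R) x *\<^sub>R (v x)\<^sup>2)"
    using assms by (intro borel_integrable_compact continuous_on_power)
      (auto intro: continuous_on_subset)
  then have "integrable (lebesgue_on (ball 0 R)) (\<lambda>x. indicator (cball 0 R) x *\<^sub>R (v x)\<^sup>2)"
    by (intro integrable_lebesgue_onI) auto
  moreover have "indicator (cball 0 R) x *\<^sub>R (v x)\<^sup>2 = (v x)\<^sup>2" if "x \<in> ball 0 R" for x
    using that by (auto simp: indicator_def)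
  ultimately have "integrable (lebesgue_on (ball 0 R)) (\<lambda>x. (v x)\<^sup>2)"
    by (subst (asm) Bochner_Integration.integrable_cong[OF refl]) auto
  moreover have "v \<in> borel_measurable (lebesgue_on (ball 0 R))"
    using borel_measurable_continuous_onI[OF assms]
    by (intro measurable_restrict_space1 measurable_completion) simp
  ultimately show ?thesis by (simp add: L2_def)
qed

text \<open>
  The approximating test functions converge uniformly, by the sup bound. Their uniform limit is
  continuous and coincides with their \<open>L\<^sup>2\<close> limit \<open>w\<close>.
\<close>

theorem H2_0_continuous_representative:
  fixes w :: "real^2 \<Rightarrow> real"
  assumes w: "w \<in> H2_0 (ball 0 R)"
  obtains v where "continuous_on UNIV v" "AE x in lebesgue_on (ball 0 R). v x = w x"
proof -
  let ?B = "ball (0::real^2) R"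
  define m where "m = measure lborel ?B + 1"
  have B: "?B \<in> sets lebesgue" by simp
  have m: "0 < m" "measure lborel ?B \<le> m" by (simp_all add: m_def add_nonneg_pos)
  obtain \<phi> where wH: "w \<in> H2 ?B" and \<phi>: "\<And>n. \<phi> n \<in> test_functions ?B"
    and lim: "(\<lambda>n. H2_sq ?B (\<lambda>x. 1 * w x + -1 * \<phi> n x)) \<longlonglongrightarrow> 0"
    by (rule H2_0D[OF w]) (rule that)
  let ?q = "\<lambda>n. H2_sq ?B (\<lambda>x. 1 * w x + -1 * \<phi> n x)"
  have dH: "(\<lambda>x. 1 * w x + -1 * \<phi> n x) \<in> H2 ?B" for n
    by (rule H2_lincomb(1)[OF open_ball wH test_function_H2(1)[OF open_ball \<phi>]])
  have "uniformly_Cauchy_on UNIV \<phi>"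
    unfolding uniformly_Cauchy_on_def
  proof (intro allI impI)
    fix e :: real
    assume e: "0 < e"
    \<comment> \<open>\<open>\<delta>\<close> makes the first term of the sup bound at most \<open>e/2\<close>, and \<open>N\<close> the second one smaller\<close>
    define \<delta> where "\<delta> = e / (2 * m)"
    have \<delta>: "0 < \<delta>" "\<delta> * m = e / 2" using e m(1) by (simp_all add: \<delta>_def)
    have "0 < e * \<delta> / 8" using e \<delta>(1) by simp
    then obtain N where N: "\<And>n. n \<ge> N \<Longrightarrow> ?q n < e * \<delta> / 8"
      using order_tendstoD(2)[OF lim] unfolding eventually_sequentially by blast
    show "\<exists>M. \<forall>x\<in>UNIV. \<forall>i\<ge>M. \<forall>j\<ge>M. dist (\<phi> i x) (\<phi> j x) < e"
    proof (intro exI[of _ N] ballI allI impI)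
      fix x i j
      assume ij: "i \<ge> N" "j \<ge> N"
      let ?d = "\<lambda>x. 1 * \<phi> i x + -1 * \<phi> j x"
      have t: "?d \<in> test_functions ?B" by (rule test_function_lincomb[OF \<phi> \<phi>])
      have "H2_sq ?B ?d \<le> 2 * ?q j + 2 * ?q i"
        using H2_sq_lincomb_le[OF open_ball dH[of j] dH[of i], of 1 "-1"] by simp
      also have "\<dots> < e * \<delta> / 2" using N[OF ij(1)] N[OF ij(2)] by simp
      finally have "H2_sq ?B ?d / \<delta> < e / 2"
        using \<delta>(1) by (simp add: pos_divide_less_eq)
      moreover have "\<delta> * measure lborel ?B \<le> e / 2"
        using mult_left_mono[OF m(2), of \<delta>] \<delta> by simp
      ultimately have "\<bar>?d x\<bar> < e"
        using test_function_sup_bound_H2[OF t \<delta>(1), of x] by linarith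
      then show "dist (\<phi> i x) (\<phi> j x) < e" by (simp add: dist_real_def)
    qed
  qed
  then obtain v where v: "uniform_limit UNIV \<phi> v sequentially"
    using Cauchy_uniformly_convergent unfolding uniformly_convergent_on_def by blast
  have cont: "continuous_on UNIV v"
    by (rule uniform_limit_theorem[OF _ v])
       (auto intro!: always_eventually smooth_continuous_on test_functionD(1)[OF \<phi>])
  have vL: "v \<in> L2 ?B" by (rule continuous_L2_ball[OF cont])
  have wL: "w \<in> L2 ?B" by (rule H1D(1)[OF open_ball H2D(1)[OF wH]])
  note dL = L2_lincomb(1)[OF vL wL, of 1 "-1"]
  let ?I = "L2_sq ?B (\<lambda>x. 1 * v x + -1 * w x)"
  have "?I \<le> e" if e: "0 < e" for e
  proof -
    \<comment> \<open>chosen so that \<open>s\<^sup>2\<close> times the area of the disc is at most \<open>e/4\<close>\<close>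
    let ?s = "sqrt (e / (4 * m))"
    have s: "0 < ?s" "?s\<^sup>2 = e / (4 * m)" using e m by simp_all
    have "\<forall>\<^sub>F n in sequentially. \<forall>x\<in>UNIV. dist (\<phi> n x) (v x) < ?s"
      using v s(1) unfolding uniform_limit_iff by blast
    moreover have "\<forall>\<^sub>F n in sequentially. ?q n < e / 4"
      by (rule order_tendstoD(2)[OF lim]) (use e in simp)
    ultimately have "\<forall>\<^sub>F n in sequentially. ?I \<le> e"
    proof eventually_elim
      case (elim n)
      note pL = test_function_L2[OF B \<phi>, of n]
      have 1: "L2_sq ?B (\<lambda>x. 1 * v x + -1 * \<phi> n x) \<le> e / 4"
      proof -
        have cm: "integrable (lebesgue_on ?B) (\<lambda>x. e / (4 * m))"
        proof -
          have "finite_measure (lebesgue_on ?B)"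
            using emeasure_bounded_finite[OF bounded_ball, of "0::real^2" R]
            by (intro finite_measureI) (simp add: emeasure_restrict_space)
          then show ?thesis by (rule finite_measure.integrable_const)
        qed
        have "L2_sq ?B (\<lambda>x. 1 * v x + -1 * \<phi> n x) \<le> (LINT x|lebesgue_on ?B. e / (4 * m))"
        proof (rule integral_mono[OF L2D(2)[OF L2_lincomb(1)[OF vL pL]] cm])
          fix x
          have "\<bar>v x - \<phi> n x\<bar> \<le> ?s" using elim(1) by (auto simp: dist_real_def abs_minus_commute less_imp_le)
          then have "(v x - \<phi> n x)\<^sup>2 \<le> ?s\<^sup>2" by (metis abs_le_square_iff abs_of_pos s(1))
          then show "(1 * v x + -1 * \<phi> n x)\<^sup>2 \<le> e / (4 * m)" by (simp add: s(2))
        qed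
        also have "\<dots> = measure lborel ?B * (e / (4 * m))"
          by (simp add: measure_restrict_space)
        also have "\<dots> \<le> m * (e / (4 * m))" using m e by (intro mult_right_mono) auto
        also have "\<dots> = e / 4" using m(1) by simp
        finally show ?thesis .
      qed
      have 2: "L2_sq ?B (\<lambda>x. 1 * w x + -1 * \<phi> n x) \<le> e / 4"
        using H2_sq_ge(1)[of ?B "\<lambda>x. 1 * w x + -1 * \<phi> n x"] elim(2) by linarith
      show ?case
        using L2_lincomb(2)[OF L2_lincomb(1)[OF vL pL, of 1 "-1"] L2_lincomb(1)[OF wL pL, of 1 "-1"], of 1 "-1"]
          1 2 by simp
    qed
    then show ?thesis by (simp add: eventually_const_iff)
  qed
  then have "?I \<le> 0" by (rule field_le_epsilon[where y = 0, simplified])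
  moreover have "0 \<le> ?I" by (rule integral_nonneg_AE) simp
  ultimately have "?I = 0" by linarith
  then have "AE x in lebesgue_on ?B. (1 * v x + -1 * w x)\<^sup>2 = 0"
    using L2D(2)[OF dL] by (subst (asm) integral_nonneg_eq_0_iff_AE) auto
  then have "AE x in lebesgue_on ?B. v x = w x" by eventually_elim simp
  with cont show ?thesis by (rule that)
qed

section \<open>One-dimensional Hausdorff measure on circles\<close>

text \<open>The countable covers of \<open>A\<close> by bounded sets of diameter at most \<open>\<delta>\<close>.\<close>

definition hausdorff_covers :: "real \<Rightarrow> 'a::metric_space set \<Rightarrow> (nat \<Rightarrow> 'a set) set" where
  "hausdorff_covers \<delta> A = {C. A \<subseteq> (\<Union>i. C i) \<and> (\<forall>i. bounded (C i) \<and> diameter (C i) \<le> \<delta>)}"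

lemma hausdorff_outer1_leI:
  assumes "\<And>\<delta>. 0 < \<delta> \<Longrightarrow> (INF C\<in>hausdorff_covers \<delta> A. \<Sum>i. ennreal (diameter (C i))) \<le> c"
  shows "hausdorff_outer1 A \<le> c"
  unfolding hausdorff_outer1_def by (rule SUP_least) (use assms in \<open>auto simp: hausdorff_covers_def\<close>)

lemma hausdorff_outer1_ge:
  assumes "0 < \<delta>"
  shows "(INF C\<in>hausdorff_covers \<delta> A. \<Sum>i. ennreal (diameter (C i))) \<le> hausdorff_outer1 A"
  unfolding hausdorff_outer1_def hausdorff_covers_def by (rule SUP_upper) (use assms in simp)

lemma hausdorff_outer1_empty: "hausdorff_outer1 {} = 0"
proof -
  have "hausdorff_outer1 ({} :: 'a set) \<le> 0"
  proof (rule hausdorff_outer1_leI)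
    fix \<delta> :: real assume "0 < \<delta>"
    then have "(\<lambda>_. {}) \<in> hausdorff_covers \<delta> ({} :: 'a set)" by (auto simp: hausdorff_covers_def)
    then show "(INF C\<in>hausdorff_covers \<delta> ({} :: 'a set). \<Sum>i. ennreal (diameter (C i))) \<le> 0"
      by (rule INF_lower2) simp
  qed
  then show ?thesis by simp
qed

lemma hausdorff_outer1_Lipschitz_image:
  fixes f :: "'a::metric_space \<Rightarrow> 'b::real_normed_vector"
  assumes L: "0 < L" and lip: "\<And>x y. x \<in> A \<Longrightarrow> y \<in> A \<Longrightarrow> dist (f x) (f y) \<le> L * dist x y"
  shows "hausdorff_outer1 (f ` A) \<le> ennreal L * hausdorff_outer1 A"
proof (rule hausdorff_outer1_leI)
  fix \<delta> :: real assume \<delta>: "0 < \<delta>"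
  let ?Y = "INF C\<in>hausdorff_covers \<delta> (f ` A). \<Sum>i. ennreal (diameter (C i))"
  have "ennreal (1 / L) * ?Y \<le> (INF C\<in>hausdorff_covers (\<delta> / L) A. \<Sum>i. ennreal (diameter (C i)))"
  proof (rule INF_greatest)
    fix C assume "C \<in> hausdorff_covers (\<delta> / L) A"
    then have C: "A \<subseteq> (\<Union>i. C i)" "\<And>i. bounded (C i)" "\<And>i. diameter (C i) \<le> \<delta> / L"
      by (auto simp: hausdorff_covers_def)
    let ?C = "\<lambda>i. f ` (C i \<inter> A)"
    have d: "norm (u - v) \<le> L * diameter (C i)" if uv: "u \<in> ?C i" "v \<in> ?C i" for u v i
    proof -
      obtain x y where xy: "x \<in> C i" "x \<in> A" "y \<in> C i" "y \<in> A" "u = f x" "v = f y"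
        using uv by auto
      have "dist (f x) (f y) \<le> L * dist x y" using lip xy by blast
      also have "\<dots> \<le> L * diameter (C i)"
        using diameter_bounded_bound[OF C(2) xy(1,3)] L by simp
      finally show ?thesis using xy by (simp add: dist_norm)
    qed
    have diam: "diameter (?C i) \<le> L * diameter (C i)" for i
      by (rule diameter_le) (use d diameter_ge_0[OF C(2)] L in auto)
    have "bounded (?C i)" for i
    proof (cases "?C i = {}")
      case False
      then obtain u where "u \<in> ?C i" by blast
      then show ?thesis
        unfolding bounded_def using d[of u i] by (metis dist_norm)
    qed simp
    moreover have "diameter (?C i) \<le> \<delta>" for i
      using diam[of i] C(3)[of i] L by (simp add: pos_le_divide_eq mult.commute)
    moreover have "f ` A \<subseteq> (\<Union>i. ?C i)" using C(1) by blast
    ultimately have "?C \<in> hausdorff_covers \<delta> (f ` A)" by (simp add: hausdorff_covers_def)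
    then have "?Y \<le> (\<Sum>i. ennreal (diameter (?C i)))" by (rule INF_lower)
    also have "\<dots> \<le> (\<Sum>i. ennreal L * ennreal (diameter (C i)))"
      using diam L by (intro suminf_le) (auto simp: ennreal_mult[symmetric] diameter_ge_0[OF C(2)])
    also have "\<dots> = ennreal L * (\<Sum>i. ennreal (diameter (C i)))" by simp
    finally have "ennreal (1 / L) * ?Y \<le> ennreal (1 / L) * (ennreal L * (\<Sum>i. ennreal (diameter (C i))))"
      by (rule mult_left_mono) simp
    also have "\<dots> = (\<Sum>i. ennreal (diameter (C i)))"
      using L by (simp add: mult.assoc[symmetric] ennreal_mult[symmetric])
    finally show "ennreal (1 / L) * ?Y \<le> (\<Sum>i. ennreal (diameter (C i)))" .
  qed
  also have "\<dots> \<le> hausdorff_outer1 A" by (rule hausdorff_outer1_ge) (use L \<delta> in simp)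
  finally have "ennreal L * (ennreal (1 / L) * ?Y) \<le> ennreal L * hausdorff_outer1 A"
    by (rule mult_left_mono) simp
  then show "?Y \<le> ennreal L * hausdorff_outer1 A"
    using L by (simp add: mult.assoc[symmetric] ennreal_mult[symmetric])
qed

lemma hausdorff_outer1_scale:
  fixes A :: "'a::real_normed_vector set"
  assumes "0 < c"
  shows "hausdorff_outer1 ((\<lambda>x. c *\<^sub>R x) ` A) = ennreal c * hausdorff_outer1 A"
proof (rule antisym)
  have d: "dist (b *\<^sub>R x) (b *\<^sub>R y) \<le> b * dist x y" if "0 < b" for b and x y :: 'a
    using that by (simp add: dist_norm scaleR_diff_right[symmetric])
  show "hausdorff_outer1 ((\<lambda>x. c *\<^sub>R x) ` A) \<le> ennreal c * hausdorff_outer1 A"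
    by (rule hausdorff_outer1_Lipschitz_image[OF assms d[OF assms]])
  have "hausdorff_outer1 ((\<lambda>x. (1/c) *\<^sub>R x) ` ((\<lambda>x. c *\<^sub>R x) ` A)) \<le> ennreal (1/c) * hausdorff_outer1 ((\<lambda>x. c *\<^sub>R x) ` A)"
    using assms by (intro hausdorff_outer1_Lipschitz_image d) auto
  also have "(\<lambda>x. (1/c) *\<^sub>R x) ` ((\<lambda>x. c *\<^sub>R x) ` A) = A"
    using assms by (simp add: image_image)
  finally have "ennreal c * hausdorff_outer1 A \<le> ennreal c * (ennreal (1/c) * hausdorff_outer1 ((\<lambda>x. c *\<^sub>R x) ` A))"
    by (rule mult_left_mono) simp
  also have "\<dots> = hausdorff_outer1 ((\<lambda>x. c *\<^sub>R x) ` A)"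
    using assms by (simp add: mult.assoc[symmetric] ennreal_mult[symmetric])
  finally show "ennreal c * hausdorff_outer1 A \<le> hausdorff_outer1 ((\<lambda>x. c *\<^sub>R x) ` A)" .
qed

lemma hausdorff_outer1_interval_le:
  fixes a b :: real
  assumes "a \<le> b"
  shows "hausdorff_outer1 {a..b} \<le> ennreal (b - a)"
proof (rule hausdorff_outer1_leI)
  fix \<delta> :: real assume \<delta>: "0 < \<delta>"
  obtain m :: nat where m: "(b - a) / \<delta> < real m" using reals_Archimedean2 by blast
  define N where "N = Suc m"
  define h where "h = (b - a) / real N"
  have h: "0 \<le> h" "real N * h = b - a" using assms by (auto simp: h_def N_def)
  have "b - a < \<delta> * real N"
    using m \<delta> by (simp add: pos_divide_less_eq N_def mult.commute algebra_simps)
  then have h\<delta>: "h \<le> \<delta>" by (simp add: h_def N_def pos_divide_le_eq)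
  \<comment> \<open>\<open>N\<close> consecutive intervals of length \<open>h\<close>, the remaining members of the cover being empty\<close>
  define C where "C i = (if i < N then {a + real i * h .. a + real (Suc i) * h} else {})" for i
  have diam: "diameter (C i) = (if i < N then h else 0)" for i
    using h(1) by (simp add: C_def algebra_simps)
  have "x \<in> (\<Union>i. C i)" if x: "x \<in> {a..b}" for x
  proof (cases "h = 0")
    case True
    then have "x = a" using x h by auto
    then have "x \<in> C 0" using True by (simp add: C_def N_def)
    then show ?thesis by blast
  next
    case False
    then have hp: "0 < h" using h by simp
    show ?thesis
    proof (cases "x = b")
      case True
      have "a + real N * h = b" using h by simp
      then have "b \<in> C m" using hp by (simp add: C_def N_def algebra_simps)
      then show ?thesis using True by blast
    next
      case False
      define i where "i = nat \<lfloor>(x - a) / h\<rfloor>"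
      have nn: "0 \<le> (x - a) / h" using x hp by simp
      have "real i \<le> (x - a) / h" "(x - a) / h < real i + 1"
        using nn unfolding i_def by linarith+
      then have 1: "real i * h \<le> x - a" "x - a < (real i + 1) * h"
        using hp by (simp_all add: pos_le_divide_eq pos_divide_less_eq)
      have "real i * h < real N * h" using 1(1) x False h(2) by auto
      then have "i < N" using hp by simp
      then have "x \<in> C i" using 1 by (simp add: C_def algebra_simps)
      then show ?thesis by blast
    qed
  qed
  then have "C \<in> hausdorff_covers \<delta> {a..b}"
    using diam h\<delta> \<delta> by (auto simp: hausdorff_covers_def C_def)
  then have "(INF C\<in>hausdorff_covers \<delta> {a..b}. \<Sum>i. ennreal (diameter (C i))) \<le> (\<Sum>i. ennreal (diameter (C i)))"
    by (rule INF_lower)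
  also have "\<dots> = (\<Sum>i<N. ennreal (diameter (C i)))"
    by (rule suminf_finite) (auto simp: diam)
  also have "\<dots> = ennreal (b - a)"
    using h by (simp add: diam ennreal_of_nat_eq_real_of_nat ennreal_mult[symmetric])
  finally show "(INF C\<in>hausdorff_covers \<delta> {a..b}. \<Sum>i. ennreal (diameter (C i))) \<le> ennreal (b - a)" .
qed

subsection \<open>The measure on a set\<close>

lemma sigma_sets_restrict_borel:
  "sigma_sets S (sets (restrict_space borel S)) = sets (restrict_space (borel :: 'a::topological_space measure) S)"
  using sets.sigma_sets_eq[of "restrict_space (borel :: 'a measure) S"] by (simp add: space_restrict_space)

lemma subset_Pow_restrict: "sets (restrict_space (borel :: 'a::topological_space measure) S) \<subseteq> Pow S"
  using sets.space_closed[of "restrict_space (borel :: 'a measure) S"] by (simp add: space_restrict_space)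

lemma space_hausdorff1_on [simp]: "space (hausdorff1_on S) = S"
  unfolding hausdorff1_on_def by (rule space_measure_of[OF subset_Pow_restrict])

lemma sets_hausdorff1_on [simp]: "sets (hausdorff1_on S) = sets (restrict_space borel S)"
  unfolding hausdorff1_on_def by (simp add: sets_measure_of[OF subset_Pow_restrict] sigma_sets_restrict_borel)

text \<open>Countable additivity of the Hausdorff outer measure on the Borel subsets of \<open>S\<close>.\<close>

definition hausdorff1_is_measure :: "'a::metric_space set \<Rightarrow> bool" where
  "hausdorff1_is_measure S \<longleftrightarrow> measure_space S (sets (restrict_space borel S)) hausdorff_outer1"

text \<open>
  If the outer measure were not countably additive on the Borel sets, \<open>measure_of\<close> would return the
  zero measure. Carrying both cases along makes Caratheodory's theorem unnecessary: the scaling law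
  and the upper bound below hold in either case.
\<close>

lemma emeasure_hausdorff1_on:
  "emeasure (hausdorff1_on S) B =
    (if B \<in> sets (restrict_space borel S) \<and> hausdorff1_is_measure S then hausdorff_outer1 B else 0)"
  unfolding hausdorff1_on_def emeasure_measure_of_conv sigma_sets_restrict_borel hausdorff1_is_measure_def ..

lemma emeasure_hausdorff1_on_le: "emeasure (hausdorff1_on S) B \<le> hausdorff_outer1 B"
  by (simp add: emeasure_hausdorff1_on)

lemma hausdorff1_is_measure_scale:
  fixes S :: "'a::euclidean_space set"
  assumes c: "0 < c" and S: "hausdorff1_is_measure S"
  shows "hausdorff1_is_measure ((\<lambda>x. c *\<^sub>R x) ` S)"
proof -
  let ?S = "(\<lambda>x. c *\<^sub>R x) ` S"
  let ?g = "\<lambda>x::'a. (1/c) *\<^sub>R x"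
  have sa: "sigma_algebra ?S (sets (restrict_space borel ?S))"
    using sets.sigma_algebra_axioms[of "restrict_space (borel :: 'a measure) ?S"] by (simp add: space_restrict_space)
  have inv: "(\<lambda>x. c *\<^sub>R x) ` (?g ` X) = X" for X using c by (simp add: image_image)
  have pull: "?g ` X \<in> sets (restrict_space borel S)" if X: "X \<in> sets (restrict_space borel ?S)" for X
  proof -
    obtain Y where Y: "Y \<in> sets borel" "X = ?S \<inter> Y" using X by (auto simp: sets_restrict_space)
    have "(\<lambda>x::'a. c *\<^sub>R x) -` Y \<in> sets borel"
      using measurable_sets[of "\<lambda>x::'a. c *\<^sub>R x" borel borel Y] Y(1) by simp
    moreover have "?g ` X = S \<inter> ((\<lambda>x. c *\<^sub>R x) -` Y)"
      unfolding Y(2) using c by (force simp: image_iff)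
    ultimately show ?thesis by (auto simp: sets_restrict_space)
  qed
  have "countably_additive (sets (restrict_space borel ?S)) hausdorff_outer1"
    unfolding countably_additive_def
  proof (intro allI impI)
    fix A :: "nat \<Rightarrow> 'a set"
    assume A: "range A \<subseteq> sets (restrict_space borel ?S)" "disjoint_family A" "(\<Union>i. A i) \<in> sets (restrict_space borel ?S)"
    let ?B = "\<lambda>i. ?g ` A i"
    have B: "range ?B \<subseteq> sets (restrict_space borel S)" using A(1) pull by blast
    have "inj ?g" using c by (auto simp: inj_on_def)
    then have disj: "disjoint_family ?B"
      using A(2) unfolding disjoint_family_on_def by (simp add: image_Int[symmetric])
    have U: "(\<Union>i. ?B i) = ?g ` (\<Union>i. A i)" by blast
    have "(\<Union>i. ?B i) \<in> sets (restrict_space borel S)" unfolding U using A(3) by (rule pull)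
    then have sum: "(\<Sum>i. hausdorff_outer1 (?B i)) = hausdorff_outer1 (\<Union>i. ?B i)"
      using S B disj unfolding hausdorff1_is_measure_def measure_space_def countably_additive_def by blast
    have "(\<Sum>i. hausdorff_outer1 (A i)) = (\<Sum>i. ennreal c * hausdorff_outer1 (?B i))"
      using hausdorff_outer1_scale[OF c] inv by metis
    also have "\<dots> = ennreal c * hausdorff_outer1 (?g ` (\<Union>i. A i))" by (simp add: sum[unfolded U])
    also have "\<dots> = hausdorff_outer1 (\<Union>i. A i)"
      using hausdorff_outer1_scale[OF c] inv by metis
    finally show "(\<Sum>i. hausdorff_outer1 (A i)) = hausdorff_outer1 (\<Union>i. A i)" .
  qed
  then show ?thesis
    using sa unfolding hausdorff1_is_measure_def measure_space_def
    by (simp add: positive_def hausdorff_outer1_empty)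
qed

text \<open>The ratio of length and radius is the same for all spheres about the origin.\<close>

lemma measure_hausdorff1_sphere:
  fixes r r' :: real
  assumes "0 < r" "0 < r'"
  shows "measure (hausdorff1_on (sphere (0::'a::euclidean_space) r)) (sphere 0 r) / r
       = measure (hausdorff1_on (sphere (0::'a) r')) (sphere 0 r') / r'"
proof -
  let ?S = "\<lambda>r. sphere (0::'a) r"
  have im: "?S b = (\<lambda>x. (b / a) *\<^sub>R x) ` ?S a" if "0 < a" "0 < b" for a b
  proof (intro equalityI subsetI)
    fix x assume "x \<in> ?S b"
    then have "(a / b) *\<^sub>R x \<in> ?S a" "x = (b / a) *\<^sub>R ((a / b) *\<^sub>R x)" using that by auto
    then show "x \<in> (\<lambda>x. (b / a) *\<^sub>R x) ` ?S a" by blast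
  qed (use that in auto)
  have meas: "hausdorff1_is_measure (?S b)" if "0 < a" "0 < b" "hausdorff1_is_measure (?S a)" for a b
    using hausdorff1_is_measure_scale[of "b / a" "?S a"] that by (simp add: im[OF that(1,2), symmetric])
  have top: "?S a \<in> sets (restrict_space borel (?S a))" for a
    using sets.top[of "restrict_space borel (?S a)"] by (simp add: space_restrict_space)
  have "hausdorff_outer1 (?S r') = ennreal (r' / r) * hausdorff_outer1 (?S r)"
    using hausdorff_outer1_scale[of "r' / r" "?S r"] assms by (simp add: im[OF assms, symmetric])
  moreover have "hausdorff1_is_measure (?S r') \<longleftrightarrow> hausdorff1_is_measure (?S r)"
    using meas assms by blast
  ultimately have "emeasure (hausdorff1_on (?S r')) (?S r') = ennreal (r' / r) * emeasure (hausdorff1_on (?S r)) (?S r)"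
    using top by (simp add: emeasure_hausdorff1_on)
  then have "measure (hausdorff1_on (?S r')) (?S r') = r' / r * measure (hausdorff1_on (?S r)) (?S r)"
    using assms by (simp add: measure_def enn2real_mult)
  then show ?thesis using assms by simp
qed

subsection \<open>Comparison with the arc length parametrisation\<close>

text \<open>The point with polar coordinates \<open>r\<close> (radius) and \<open>t\<close> (angle).\<close>

definition circle_point :: "real \<Rightarrow> real \<Rightarrow> real^2" where
  "circle_point r t = vector [r * cos t, r * sin t]"

lemma norm_vector_2: "norm (vector [a, b] :: real^2) = sqrt (a\<^sup>2 + b\<^sup>2)"
  by (simp add: norm_vec_def L2_set_def UNIV_2)

lemma norm_circle_point: "norm (circle_point r t) = \<bar>r\<bar>"
proof -
  have "(r * cos t)\<^sup>2 + (r * sin t)\<^sup>2 = r\<^sup>2"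
    by (simp add: power_mult_distrib distrib_left[symmetric])
  then show ?thesis by (simp add: circle_point_def norm_vector_2)
qed

lemma dist_circle_point_le:
  assumes "0 \<le> r"
  shows "dist (circle_point r s) (circle_point r t) \<le> r * dist s t"
proof -
  have "circle_point r s - circle_point r t = vector [r * (cos s - cos t), r * (sin s - sin t)]"
    by (simp add: circle_point_def vec_eq_iff forall_2 algebra_simps)
  then have "dist (circle_point r s) (circle_point r t) = sqrt ((r * (cos s - cos t))\<^sup>2 + (r * (sin s - sin t))\<^sup>2)"
    by (simp add: dist_norm norm_vector_2)
  also have "(r * (cos s - cos t))\<^sup>2 + (r * (sin s - sin t))\<^sup>2 = r\<^sup>2 * (2 - 2 * cos (s - t))"
  proof -
    have "(cos s - cos t)\<^sup>2 + (sin s - sin t)\<^sup>2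
        = ((sin s)\<^sup>2 + (cos s)\<^sup>2) + ((sin t)\<^sup>2 + (cos t)\<^sup>2) - 2 * (cos s * cos t + sin s * sin t)"
      by (simp add: power2_diff algebra_simps)
    also have "\<dots> = 2 - 2 * cos (s - t)" by (simp add: cos_diff)
    finally show ?thesis by (simp only: power_mult_distrib distrib_left[symmetric])
  qed
  also have "2 - 2 * cos (s - t) = (2 * sin ((s - t) / 2))\<^sup>2"
  proof -
    have "cos (s - t) = cos (2 * ((s - t) / 2))" by (rule arg_cong[where f = cos]) (rule field_sum_of_halves[of "s - t", folded mult_2, symmetric])
    also have "\<dots> = 1 - 2 * (sin ((s - t) / 2))\<^sup>2" by (rule cos_double_sin)
    finally show ?thesis by (simp add: power_mult_distrib)
  qed
  also have "sqrt (r\<^sup>2 * (2 * sin ((s - t) / 2))\<^sup>2) = r * (2 * \<bar>sin ((s - t) / 2)\<bar>)"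
    using assms by (simp add: real_sqrt_mult abs_mult)
  also have "\<dots> \<le> r * dist s t"
    using abs_sin_x_le_abs_x[of "(s - t) / 2"] assms by (intro mult_left_mono) (auto simp: dist_real_def)
  finally show ?thesis .
qed

lemma circle_point_axis:
  "circle_point r t = (r * cos t) *\<^sub>R axis 1 1 + (r * sin t) *\<^sub>R axis 2 1"
  by (simp add: circle_point_def vec_eq_iff forall_2 axis_def)

lemma continuous_circle_point: "continuous_on S (circle_point r)"
  unfolding circle_point_axis[abs_def] by (intro continuous_intros)

lemma sphere_circle_point:
  assumes "0 < r" "x \<in> sphere 0 r"
  obtains t where "0 \<le> t" "t < 2 * pi" "x = circle_point r t"
proof -
  have "(x$1)\<^sup>2 + (x$2)\<^sup>2 = r\<^sup>2"
  proof -
    have "sqrt ((x$1)\<^sup>2 + (x$2)\<^sup>2) = r" using assms by (simp add: norm_vec_def L2_set_def UNIV_2)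
    then show ?thesis by (metis real_sqrt_pow2 sum_power2_ge_zero)
  qed
  then have "(x$1 / r)\<^sup>2 + (x$2 / r)\<^sup>2 = 1"
    using assms(1) by (simp add: power_divide add_divide_distrib[symmetric])
  then obtain t where t: "0 \<le> t" "t < 2 * pi" "x$1 / r = cos t" "x$2 / r = sin t"
    by (rule sincos_total_2pi)
  have "x = circle_point r t"
    using t(3,4) assms(1) by (simp add: circle_point_def vec_eq_iff forall_2 field_simps)
  with t(1,2) show ?thesis by (rule that)
qed

lemma sum_indicator_intervals:
  fixes h :: real
  assumes "0 \<le> h"
  shows "(\<Sum>i<N. indicator {real i * h..<real (Suc i) * h} t) = (indicator {0..<real N * h} t :: ennreal)"
proof (induction N)
  case (Suc N)
  have "0 \<le> real N * h" "real N * h \<le> real (Suc N) * h" using assms by (auto intro: mult_right_mono)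
  then have "indicator {0..<real N * h} t + indicator {real N * h..<real (Suc N) * h} t
      = (indicator {0..<real (Suc N) * h} t :: ennreal)"
    by (auto simp: indicator_def simp del: of_nat_Suc)
  then show ?case by (simp only: sum.lessThan_Suc Suc)
qed simp

text \<open>
  The inequality between Hausdorff measure and arc length that the trace estimate needs follows
  from upper Riemann sums, as an arc of angle \<open>\<alpha>\<close> has Hausdorff measure at most \<open>r \<alpha>\<close>.
\<close>

lemma nn_integral_hausdorff1_sphere_le:
  fixes f :: "real^2 \<Rightarrow> real"
  assumes r: "0 < r" and cont: "continuous_on UNIV f" and nonneg: "\<And>x. 0 \<le> f x"
  shows "(\<integral>\<^sup>+x. ennreal (f x) \<partial>hausdorff1_on (sphere 0 r))
      \<le> ennreal r * (\<integral>\<^sup>+t. ennreal (f (circle_point r t)) * indicator {0..<2*pi} t \<partial>lborel)"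
    (is "?I \<le> ennreal r * ?J")
proof (rule ennreal_le_epsilon)
  fix e :: real assume e: "0 < e"
  let ?M = "hausdorff1_on (sphere (0::real^2) r)"
  let ?g = "\<lambda>t. f (circle_point r t)"
  \<comment> \<open>\<open>\<eta>\<close> bounds the oscillation of \<open>f\<close> on each arc; it enters twice, over a circle of length \<open>2 \<pi> r\<close>\<close>
  define \<eta> where "\<eta> = e / (4 * pi * r)"
  have \<eta>: "0 < \<eta>" "r * (2 * \<eta> * (2 * pi)) = e" using e r by (auto simp: \<eta>_def)
  have contg: "continuous_on S ?g" for S
    by (rule continuous_on_compose2[OF cont continuous_circle_point]) simp
  have "uniformly_continuous_on {0..2*pi} ?g"
    by (rule compact_uniformly_continuous[OF contg compact_Icc])
  then obtain \<delta> where \<delta>: "0 < \<delta>"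
    "\<And>s t. s \<in> {0..2*pi} \<Longrightarrow> t \<in> {0..2*pi} \<Longrightarrow> dist s t < \<delta> \<Longrightarrow> dist (?g s) (?g t) < \<eta>"
    using \<eta>(1) unfolding uniformly_continuous_on_def by metis
  obtain m :: nat where m: "2 * pi / \<delta> < real m" using reals_Archimedean2 by blast
  define N where "N = Suc m"
  define h where "h = 2 * pi / real N"
  have h: "0 < h" "real N * h = 2 * pi" by (auto simp: h_def N_def)
  have "2 * pi < \<delta> * real N"
    using m \<delta>(1) by (simp add: pos_divide_less_eq N_def mult.commute algebra_simps)
  then have h\<delta>: "h < \<delta>" by (simp add: h_def N_def pos_divide_less_eq)
  let ?I = "\<lambda>i. {real i * h..<real (Suc i) * h}" and ?K = "\<lambda>i. {real i * h..real (Suc i) * h}"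
  let ?A = "\<lambda>i. circle_point r ` ?K i"
  let ?c = "\<lambda>i. ?g (real i * h)"
  have near: "dist (?g t) (?c i) < \<eta>" if "i < N" "t \<in> ?K i" for i t
  proof (rule \<delta>(2))
    have "real (Suc i) * h \<le> real N * h" using that(1) h(1) by (intro mult_right_mono) auto
    then have "real (Suc i) * h \<le> 2 * pi" using h(2) by simp
    moreover have "0 \<le> real i * h" using h(1) by simp
    moreover have "real (Suc i) * h = real i * h + h" by (simp add: algebra_simps)
    moreover have "real i * h \<le> t" "t \<le> real (Suc i) * h" using that(2) by auto
    ultimately show "t \<in> {0..2*pi}" "real i * h \<in> {0..2*pi}" "dist t (real i * h) < \<delta>"
      unfolding atLeastAtMost_iff dist_real_def using h(1) h\<delta> by linarith+
  qed
  have A_sets: "?A i \<in> sets ?M" for i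
  proof -
    have "compact (?A i)" by (rule compact_continuous_image[OF continuous_circle_point compact_Icc])
    then have "?A i \<in> sets borel" by (rule borel_compact)
    moreover have "?A i \<subseteq> sphere 0 r" using r by (auto simp: norm_circle_point)
    ultimately show ?thesis by (auto simp: sets_restrict_space)
  qed
  have A_le: "emeasure ?M (?A i) \<le> ennreal (r * h)" for i
  proof -
    have "emeasure ?M (?A i) \<le> hausdorff_outer1 (?A i)" by (rule emeasure_hausdorff1_on_le)
    also have "\<dots> \<le> ennreal r * hausdorff_outer1 (?K i)"
      using r by (intro hausdorff_outer1_Lipschitz_image dist_circle_point_le) auto
    also have "\<dots> \<le> ennreal r * ennreal (real (Suc i) * h - real i * h)"
      using h(1) by (intro mult_left_mono hausdorff_outer1_interval_le) (auto intro: mult_right_mono)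
    also have "\<dots> = ennreal (r * h)" using r h(1) by (simp add: ennreal_mult[symmetric] algebra_simps)
    finally show ?thesis .
  qed
  have upper: "ennreal (f x) \<le> (\<Sum>i<N. ennreal (?c i + \<eta>) * indicator (?A i) x)" if x: "x \<in> space ?M" for x
  proof -
    obtain t where t: "0 \<le> t" "t < 2 * pi" "x = circle_point r t"
      using sphere_circle_point[OF r, of x] x by auto
    have "(\<Sum>i<N. indicator (?I i) t) = (1::ennreal)"
      using sum_indicator_intervals[where h = h and N = N and t = t] h t by simp
    then have "\<exists>i<N. t \<in> ?I i"
      by (metis (no_types, lifting) indicator_simps(2) lessThan_iff sum.neutral zero_neq_one)
    then obtain i where i: "i < N" "t \<in> ?I i" by blast
    then have "t \<in> ?K i" by auto
    then have "x \<in> ?A i" using t(3) by blast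
    have "f x \<le> ?c i + \<eta>" using near[OF i(1) \<open>t \<in> ?K i\<close>] t(3) by (auto simp: dist_real_def)
    then have "ennreal (f x) \<le> ennreal (?c i + \<eta>) * indicator (?A i) x"
      using \<open>x \<in> ?A i\<close> by (simp add: ennreal_leI)
    also have "\<dots> \<le> (\<Sum>i<N. ennreal (?c i + \<eta>) * indicator (?A i) x)"
      by (rule member_le_sum) (use i in auto)
    finally show ?thesis .
  qed
  have "(\<integral>\<^sup>+x. ennreal (f x) \<partial>?M) \<le> (\<integral>\<^sup>+x. (\<Sum>i<N. ennreal (?c i + \<eta>) * indicator (?A i) x) \<partial>?M)"
    by (rule nn_integral_mono) (rule upper)
  also have "\<dots> = (\<Sum>i<N. ennreal (?c i + \<eta>) * emeasure ?M (?A i))"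
  proof (subst nn_integral_sum)
    show "(\<lambda>x. ennreal (?c i + \<eta>) * indicator (?A i) x) \<in> borel_measurable ?M" for i
      by (intro borel_measurable_times_ennreal borel_measurable_const borel_measurable_indicator A_sets)
    show "(\<Sum>i<N. \<integral>\<^sup>+x. ennreal (?c i + \<eta>) * indicator (?A i) x \<partial>?M)
        = (\<Sum>i<N. ennreal (?c i + \<eta>) * emeasure ?M (?A i))"
      by (simp only: nn_integral_cmult_indicator[OF A_sets])
  qed
  also have "\<dots> \<le> (\<Sum>i<N. ennreal (?c i + \<eta>) * ennreal (r * h))"
    by (intro sum_mono mult_left_mono A_le) simp
  also have "\<dots> = (\<Sum>i<N. ennreal r * (\<integral>\<^sup>+t. ennreal (?c i + \<eta>) * indicator (?I i) t \<partial>lborel))"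
  proof (rule sum.cong[OF refl])
    fix i
    have "(\<integral>\<^sup>+t. ennreal (?c i + \<eta>) * indicator (?I i) t \<partial>lborel) = ennreal (?c i + \<eta>) * ennreal h"
      using h(1) by (subst nn_integral_cmult_indicator) (auto simp: algebra_simps)
    then show "ennreal (?c i + \<eta>) * ennreal (r * h)
        = ennreal r * (\<integral>\<^sup>+t. ennreal (?c i + \<eta>) * indicator (?I i) t \<partial>lborel)"
      using r h(1) by (simp add: ennreal_mult mult.left_commute)
  qed
  also have "\<dots> \<le> (\<Sum>i<N. ennreal r * (\<integral>\<^sup>+t. (ennreal (?g t) + ennreal (2 * \<eta>)) * indicator (?I i) t \<partial>lborel))"
  proof (intro sum_mono mult_left_mono nn_integral_mono)
    fix i t assume i: "i \<in> {..<N}"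
    show "ennreal (?c i + \<eta>) * indicator (?I i) t \<le> (ennreal (?g t) + ennreal (2 * \<eta>)) * indicator (?I i) t"
    proof (cases "t \<in> ?I i")
      case True
      then have "dist (?g t) (?c i) < \<eta>" using i by (intro near) auto
      then have "?c i + \<eta> \<le> ?g t + 2 * \<eta>" by (auto simp: dist_real_def)
      then show ?thesis using True nonneg \<eta>(1) by (simp add: ennreal_plus[symmetric] ennreal_leI del: ennreal_plus)
    qed simp
  qed simp
  also have "\<dots> = ennreal r * (\<Sum>i<N. \<integral>\<^sup>+t. (ennreal (?g t) + ennreal (2 * \<eta>)) * indicator (?I i) t \<partial>lborel)"
    by (simp add: sum_distrib_left)
  also have "(\<Sum>i<N. \<integral>\<^sup>+t. (ennreal (?g t) + ennreal (2 * \<eta>)) * indicator (?I i) t \<partial>lborel)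
      = (\<integral>\<^sup>+t. (\<Sum>i<N. (ennreal (?g t) + ennreal (2 * \<eta>)) * indicator (?I i) t) \<partial>lborel)"
    using borel_measurable_continuous_onI[OF contg] by (subst nn_integral_sum) auto
  also have "\<dots> = (\<integral>\<^sup>+t. ennreal (?g t) * indicator {0..<2*pi} t + ennreal (2 * \<eta>) * indicator {0..<2*pi} t \<partial>lborel)"
    by (intro nn_integral_cong)
       (simp only: sum_distrib_left[symmetric] sum_indicator_intervals[OF less_imp_le[OF h(1)]] h(2),
        simp only: distrib_right)
  also have "\<dots> = ?J + ennreal (2 * \<eta> * (2 * pi))"
  proof (subst nn_integral_add)
    have "(\<integral>\<^sup>+t. ennreal (2 * \<eta>) * indicator {0..<2*pi} t \<partial>lborel) = ennreal (2 * \<eta>) * ennreal (2 * pi)"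
      by (subst nn_integral_cmult_indicator) auto
    also have "\<dots> = ennreal (2 * \<eta> * (2 * pi))"
      using \<eta>(1) by (intro ennreal_mult[symmetric]) auto
    finally show "?J + (\<integral>\<^sup>+t. ennreal (2 * \<eta>) * indicator {0..<2*pi} t \<partial>lborel)
        = ?J + ennreal (2 * \<eta> * (2 * pi))"
      by (rule arg_cong)
  qed (use borel_measurable_continuous_onI[OF contg] in auto)
  also have "ennreal r * (?J + ennreal (2 * \<eta> * (2 * pi))) = ennreal r * ?J + ennreal e"
    using r \<eta> by (simp add: distrib_left ennreal_mult[symmetric])
  finally show "(\<integral>\<^sup>+x. ennreal (f x) \<partial>?M) \<le> ennreal r * ?J + ennreal e" .
qed

lemma finite_measure_hausdorff1_sphere:
  assumes "0 < r"
  shows "finite_measure (hausdorff1_on (sphere (0::real^2) r))"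
proof (rule finite_measureI)
  let ?M = "hausdorff1_on (sphere (0::real^2) r)"
  have "emeasure ?M (space ?M) = (\<integral>\<^sup>+x. ennreal 1 \<partial>?M)" by simp
  also have "\<dots> \<le> ennreal r * (\<integral>\<^sup>+t. ennreal 1 * indicator {0..<2*pi} t \<partial>lborel)"
    by (rule nn_integral_hausdorff1_sphere_le[OF assms]) auto
  also have "\<dots> < \<infinity>" by (simp add: ennreal_mult_less_top)
  finally show "emeasure ?M (space ?M) \<noteq> \<infinity>" by simp
qed

section \<open>Polar coordinates and the trace inequality\<close>

lemma nn_integral_absolutely_integrable_on:
  fixes F :: "'a::euclidean_space \<Rightarrow> real"
  assumes "F absolutely_integrable_on S" "\<And>x. 0 \<le> F x"
  shows "(\<integral>\<^sup>+x. ennreal (F x) * indicator S x \<partial>lborel) = ennreal (integral S F)"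
proof -
  have int: "integrable lebesgue (\<lambda>x. indicator S x *\<^sub>R F x)"
    using assms(1) by (simp add: set_integrable_def)
  have "(\<integral>\<^sup>+x. ennreal (F x) * indicator S x \<partial>lborel) = (\<integral>\<^sup>+x. ennreal (indicator S x *\<^sub>R F x) \<partial>lebesgue)"
    unfolding nn_integral_completion by (intro nn_integral_cong) (auto simp: indicator_def)
  also have "\<dots> = ennreal (LINT x|lebesgue. indicator S x *\<^sub>R F x)"
    using int assms(2) by (intro nn_integral_eq_integral) auto
  also have "(LINT x|lebesgue. indicator S x *\<^sub>R F x) = integral S F"
    using set_lebesgue_integral_eq_integral(2)[OF assms(1)] by (simp add: set_lebesgue_integral_def)
  finally show ?thesis .
qed

lemma circle_point_eq: "circle_point r t = r *\<^sub>R circle_point 1 t"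
  by (simp add: circle_point_def vec_eq_iff forall_2)

lemma circle_point_inj:
  assumes "circle_point r s = circle_point r' t" "0 < r" "0 < r'"
    and "s \<in> {0<..<2*pi}" "t \<in> {0<..<2*pi}"
  shows "r = r' \<and> s = t"
proof -
  have r: "r = r'" using arg_cong[OF assms(1), of norm] assms(2,3) by (simp add: norm_circle_point)
  then have "sin s = sin t \<and> cos s = cos t"
    using assms(1,2) by (auto simp: circle_point_def vec_eq_iff forall_2)
  then obtain n :: int where n: "s = t + 2 * pi * n" using sin_cos_eq_iff by blast
  have "\<bar>2 * pi * n\<bar> < 2 * pi" using n assms(4,5) by auto
  then have "\<bar>real_of_int n\<bar> < 1" by (simp add: abs_mult)
  then have "n = 0" by linarith
  then show ?thesis using r n by simp
qed

text \<open>
  Polar coordinates, with the angle as the first and the radius as the second coordinate. Only an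
  inequality is needed, so the ray of angle \<open>0\<close> that the open rectangle misses plays no role.
\<close>

lemma polar_coordinates_le:
  fixes G :: "real^2 \<Rightarrow> real"
  assumes cont: "continuous_on UNIV G" and nonneg: "\<And>x. 0 \<le> G x" and r: "0 < r"
  shows "(\<integral>\<^sup>+t. (\<integral>\<^sup>+\<rho>. ennreal (\<rho> * G (circle_point \<rho> t)) * indicator {0<..<r} \<rho> \<partial>lborel)
            * indicator {0<..<2*pi} t \<partial>lborel)
      \<le> (\<integral>\<^sup>+x. ennreal (G x) * indicator (ball 0 r) x \<partial>lborel)"
proof -
  let ?g = "\<lambda>x::real^2. circle_point (x$2) (x$1)"
  let ?g' = "\<lambda>(x::real^2) h::real^2. vector [cos (x$1) * h$2 - x$2 * sin (x$1) * h$1,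
                                  sin (x$1) * h$2 + x$2 * cos (x$1) * h$1] :: real^2"
  let ?a = "vector [0, 0] :: real^2" and ?b = "vector [2*pi, r] :: real^2"
  let ?S = "box ?a ?b"
  let ?F = "\<lambda>x::real^2. \<bar>x$2\<bar> * G (?g x)"
  have nth: "((\<lambda>x::real^2. x$i) has_derivative (\<lambda>h. h$i)) (at x within S)" for i x S
    by (rule bounded_linear_imp_has_derivative[OF bounded_linear_vec_nth])
  have der: "(?g has_derivative ?g' x) (at x within ?S)" for x
    unfolding circle_point_axis
    by (rule derivative_eq_intros nth refl)+
       (auto simp: fun_eq_iff vec_eq_iff forall_2 axis_def algebra_simps)
  have det: "\<bar>det (matrix (?g' x))\<bar> = \<bar>x$2\<bar>" for x
  proof -
    have "det (matrix (?g' x)) = - (x$2 * (sin (x$1) * sin (x$1)) + x$2 * (cos (x$1) * cos (x$1)))"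
      by (simp add: det_2 matrix_def axis_def algebra_simps)
    also have "\<dots> = - (x$2 * ((sin (x$1))\<^sup>2 + (cos (x$1))\<^sup>2))"
      by (simp only: power2_eq_square distrib_left)
    finally show ?thesis by simp
  qed
  have inj: "inj_on ?g ?S"
  proof (rule inj_onI)
    fix x y assume "x \<in> ?S" "y \<in> ?S" "?g x = ?g y"
    then have "x$2 = y$2 \<and> x$1 = y$1"
      by (intro circle_point_inj) (auto simp: mem_box_cart forall_2)
    then show "x = y" by (simp add: vec_eq_iff forall_2)
  qed
  have contF: "continuous_on UNIV ?F"
  proof -
    have "continuous_on UNIV ?g" unfolding circle_point_axis by (intro continuous_intros)
    then have "continuous_on UNIV (\<lambda>x. G (?g x))"
      by (intro continuous_on_compose2[OF cont]) auto
    then show ?thesis by (intro continuous_intros)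
  qed
  have "?F absolutely_integrable_on cbox ?a ?b"
    by (rule absolutely_integrable_continuous[OF continuous_on_subset[OF contF subset_UNIV]])
  then have F_int: "?F absolutely_integrable_on ?S"
    by (rule set_integrable_subset) (auto simp: box_subset_cbox)
  \<comment> \<open>the change of variables theorem is about functions into \<open>real^'n\<close>, whence the detour through \<open>real^1\<close>\<close>
  then have A: "(\<lambda>x. \<bar>det (matrix (?g' x))\<bar> *\<^sub>R (vec (G (?g x)) :: real^1)) absolutely_integrable_on ?S"
    unfolding absolutely_integrable_on_1_iff by (simp add: det)
  have cov: "(\<lambda>y. vec (G y) :: real^1) absolutely_integrable_on ?g ` ?S \<and>
      integral (?g ` ?S) (\<lambda>y. vec (G y) :: real^1)
        = integral ?S (\<lambda>x. \<bar>det (matrix (?g' x))\<bar> *\<^sub>R (vec (G (?g x)) :: real^1))"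
    by (rule has_absolute_integral_change_of_variables[THEN iffD1, OF _ der inj conjI[OF A refl]]) simp
  have G_int: "G absolutely_integrable_on ?g ` ?S"
    using cov unfolding absolutely_integrable_on_1_iff by simp
  have "integral (?g ` ?S) G = integral ?S ?F"
    using cov unfolding integral_on_1_eq by (simp add: det vec_eq_iff)
  then have eq: "(\<integral>\<^sup>+x. ennreal (?F x) * indicator ?S x \<partial>lborel)
      = (\<integral>\<^sup>+x. ennreal (G x) * indicator (?g ` ?S) x \<partial>lborel)"
    using nn_integral_absolutely_integrable_on[OF F_int] nn_integral_absolutely_integrable_on[OF G_int] nonneg
    by simp
  have img: "?g ` ?S \<subseteq> ball 0 r"
    by (auto simp: norm_circle_point mem_box_cart forall_2)
  have meas: "(\<lambda>x. ennreal (?F x) * indicator ?S x) \<in> borel_measurable borel"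
    using borel_measurable_continuous_onI[OF contF] by measurable
  have "(\<integral>\<^sup>+t. (\<integral>\<^sup>+\<rho>. ennreal (\<rho> * G (circle_point \<rho> t)) * indicator {0<..<r} \<rho> \<partial>lborel) * indicator {0<..<2*pi} t \<partial>lborel)
      = (\<integral>\<^sup>+t. \<integral>\<^sup>+\<rho>. ennreal (?F (vector [t, \<rho>])) * indicator ?S (vector [t, \<rho>]) \<partial>lborel \<partial>lborel)"
  proof (rule nn_integral_cong)
    fix t :: real
    show "(\<integral>\<^sup>+\<rho>. ennreal (\<rho> * G (circle_point \<rho> t)) * indicator {0<..<r} \<rho> \<partial>lborel) * indicator {0<..<2*pi} t
      = (\<integral>\<^sup>+\<rho>. ennreal (?F (vector [t, \<rho>])) * indicator ?S (vector [t, \<rho>]) \<partial>lborel)"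
    proof (cases "t \<in> {0<..<2*pi}")
      case True
      then show ?thesis
        by (auto simp: vector_2_in_box indicator_def intro!: nn_integral_cong)
    next
      case False
      then show ?thesis by (auto simp: vector_2_in_box indicator_def)
    qed
  qed
  also have "\<dots> = (\<integral>\<^sup>+x. ennreal (?F x) * indicator ?S x \<partial>lborel)"
    by (rule nn_integral_real2[OF meas, symmetric])
  also have "\<dots> = (\<integral>\<^sup>+x. ennreal (G x) * indicator (?g ` ?S) x \<partial>lborel)" by (rule eq)
  also have "\<dots> \<le> (\<integral>\<^sup>+x. ennreal (G x) * indicator (ball 0 r) x \<partial>lborel)"
    using img by (intro nn_integral_mono mult_left_mono) (auto simp: indicator_def)
  finally show ?thesis .
qed

text \<open>The squared length of the classical gradient.\<close>

definition gradient_sq :: "(real^'n \<Rightarrow> real) \<Rightarrow> real^'n \<Rightarrow> real" where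
  "gradient_sq f x = (\<Sum>i\<in>UNIV. (partial_deriv i f x)\<^sup>2)"

text \<open>
  The derivative of \<open>\<rho>\<^sup>2 \<psi>(\<rho> \<omega>)\<^sup>2\<close> in \<open>\<rho>\<close>, integrated over \<open>[0, r]\<close>. The factor \<open>\<rho>\<^sup>2\<close> makes the boundary
  term at \<open>0\<close> vanish and supplies the Jacobian \<open>\<rho>\<close> of polar coordinates.
\<close>

lemma radial_inequality:
  fixes \<psi> :: "real^2 \<Rightarrow> real"
  assumes \<psi>: "smooth \<psi>" and r: "0 < r"
  shows "ennreal (r\<^sup>2 * (\<psi> (circle_point r t))\<^sup>2) \<le>
    ennreal (2 + r) * (\<integral>\<^sup>+\<rho>. ennreal (\<rho> * ((\<psi> (circle_point \<rho> t))\<^sup>2 + gradient_sq \<psi> (circle_point \<rho> t)))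
        * indicator {0<..<r} \<rho> \<partial>lborel)"
proof -
  let ?\<omega> = "circle_point 1 t"
  let ?u = "\<lambda>\<rho>. \<psi> (\<rho> *\<^sub>R ?\<omega>)"
  let ?u' = "\<lambda>\<rho>. cos t * partial_deriv 1 \<psi> (\<rho> *\<^sub>R ?\<omega>) + sin t * partial_deriv 2 \<psi> (\<rho> *\<^sub>R ?\<omega>)"
  let ?G = "\<lambda>\<rho>. (?u \<rho>)\<^sup>2 + gradient_sq \<psi> (\<rho> *\<^sub>R ?\<omega>)"
  let ?f = "\<lambda>\<rho>. 2 * \<rho> * (?u \<rho>)\<^sup>2 + \<rho>\<^sup>2 * (2 * ?u \<rho> * ?u' \<rho>)"
  have ray: "continuous_on S (\<lambda>\<rho>. \<rho> *\<^sub>R ?\<omega>)" for S by (intro continuous_intros)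
  have comp: "continuous_on S (\<lambda>\<rho>. f (\<rho> *\<^sub>R ?\<omega>))" if "smooth f" for f S
    by (rule continuous_on_compose2[OF smooth_continuous_on[OF that, of UNIV] ray]) simp
  have cont_G: "continuous_on S ?G" for S
    unfolding gradient_sq_def
    by (intro continuous_intros comp \<psi> smooth_partial_deriv)
  have cont_f: "continuous_on S ?f" for S
    by (intro continuous_intros comp \<psi> smooth_partial_deriv)
  have du: "(?u has_real_derivative ?u' \<rho>) (at \<rho>)" for \<rho>
  proof -
    have "((\<lambda>\<rho>. \<rho> *\<^sub>R ?\<omega>) has_derivative (\<lambda>h. h *\<^sub>R ?\<omega>)) (at \<rho>)"
      by (auto intro!: derivative_eq_intros)
    from has_derivative_compose[OF this smooth_has_derivative[OF \<psi>]]
    have D: "(?u has_derivative (\<lambda>h. \<Sum>i\<in>UNIV. (h *\<^sub>R ?\<omega>) $ i * partial_deriv i \<psi> (\<rho> *\<^sub>R ?\<omega>))) (at \<rho>)" .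
    have "(\<lambda>h. \<Sum>i\<in>UNIV. (h *\<^sub>R ?\<omega>) $ i * partial_deriv i \<psi> (\<rho> *\<^sub>R ?\<omega>)) = (*) (?u' \<rho>)"
    proof
      fix h
      have "(\<Sum>i\<in>UNIV. (h *\<^sub>R ?\<omega>) $ i * partial_deriv i \<psi> y)
          = (cos t * partial_deriv 1 \<psi> y + sin t * partial_deriv 2 \<psi> y) * h" for y
        by (simp add: UNIV_2 circle_point_def algebra_simps)
      then show "(\<Sum>i\<in>UNIV. (h *\<^sub>R ?\<omega>) $ i * partial_deriv i \<psi> (\<rho> *\<^sub>R ?\<omega>)) = ?u' \<rho> * h" .
    qed
    with D show ?thesis unfolding has_field_derivative_def by (simp only:)
  qed
  have dF: "((\<lambda>\<rho>. \<rho>\<^sup>2 * (?u \<rho>)\<^sup>2) has_real_derivative ?f \<rho>) (at \<rho>)" for \<rho>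
    by (rule derivative_eq_intros du refl)+ (simp add: algebra_simps power2_eq_square)
  have "has_bochner_integral lborel (\<lambda>\<rho>. ?f \<rho> * indicator {0..r} \<rho>) (r\<^sup>2 * (?u r)\<^sup>2 - 0\<^sup>2 * (?u 0)\<^sup>2)"
    by (rule has_bochner_integral_FTC_Icc_real[OF less_imp_le[OF r] dF])
       (use cont_f[of UNIV] in \<open>auto simp: continuous_on_eq_continuous_at\<close>)
  then have f_int: "integrable lborel (\<lambda>\<rho>. ?f \<rho> * indicator {0..r} \<rho>)"
    "(LINT \<rho>|lborel. ?f \<rho> * indicator {0..r} \<rho>) = r\<^sup>2 * (?u r)\<^sup>2"
    by (auto simp: has_bochner_integral_iff)
  let ?H = "\<lambda>\<rho>. (2 + r) * (\<rho> * ?G \<rho>) * indicator {0..r} \<rho>"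
  have H_int: "integrable lborel ?H"
  proof -
    have "integrable lborel (\<lambda>\<rho>. indicator {0..r} \<rho> *\<^sub>R ((2 + r) * (\<rho> * ?G \<rho>)))"
      by (intro borel_integrable_compact compact_Icc continuous_on_mult continuous_on_const continuous_on_id cont_G)
    then show ?thesis by (simp add: mult.commute)
  qed
  have G_nn: "0 \<le> ?G \<rho>" for \<rho> unfolding gradient_sq_def by (intro add_nonneg_nonneg sum_nonneg) auto
  have H_nn: "0 \<le> ?H \<rho>" for \<rho>
    using r G_nn[of \<rho>] by (simp add: indicator_def del: sum_power2_ge_zero)
  have le: "?f \<rho> * indicator {0..r} \<rho> \<le> ?H \<rho>" for \<rho>
  proof (cases "\<rho> \<in> {0..r}")
    case True
    let ?p = "partial_deriv 1 \<psi> (\<rho> *\<^sub>R ?\<omega>)" and ?q = "partial_deriv 2 \<psi> (\<rho> *\<^sub>R ?\<omega>)"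
    \<comment> \<open>Lagrange's identity: the radial derivative is bounded by the gradient\<close>
    have "(?u' \<rho>)\<^sup>2 + (cos t * ?q - sin t * ?p)\<^sup>2 = ((sin t)\<^sup>2 + (cos t)\<^sup>2) * (?p\<^sup>2 + ?q\<^sup>2)"
      unfolding power2_eq_square by (simp only: algebra_simps)
    then have "(?u' \<rho>)\<^sup>2 + (cos t * ?q - sin t * ?p)\<^sup>2 = gradient_sq \<psi> (\<rho> *\<^sub>R ?\<omega>)"
      by (simp add: gradient_sq_def UNIV_2)
    then have CS: "(?u' \<rho>)\<^sup>2 \<le> gradient_sq \<psi> (\<rho> *\<^sub>R ?\<omega>)"
      using zero_le_power2[of "cos t * ?q - sin t * ?p"] by linarith
    have "2 * ?u \<rho> * ?u' \<rho> \<le> ?G \<rho>"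
      using sum_squares_bound[of "?u \<rho>" "?u' \<rho>"] CS by linarith
    then have "\<rho>\<^sup>2 * (2 * ?u \<rho> * ?u' \<rho>) \<le> \<rho>\<^sup>2 * ?G \<rho>" by (intro mult_left_mono) auto
    also have "\<dots> \<le> r * \<rho> * ?G \<rho>"
      using True G_nn[of \<rho>] by (intro mult_right_mono) (auto simp: power2_eq_square intro: mult_right_mono)
    finally have 1: "\<rho>\<^sup>2 * (2 * ?u \<rho> * ?u' \<rho>) \<le> r * \<rho> * ?G \<rho>" .
    have "(?u \<rho>)\<^sup>2 \<le> ?G \<rho>" using CS zero_le_power2[of "?u' \<rho>"] by linarith
    then have 2: "2 * \<rho> * (?u \<rho>)\<^sup>2 \<le> 2 * \<rho> * ?G \<rho>" using True by (intro mult_left_mono) auto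
    have "?f \<rho> \<le> 2 * \<rho> * ?G \<rho> + r * \<rho> * ?G \<rho>" using 1 2 by (rule add_mono[rotated])
    also have "\<dots> = (2 + r) * (\<rho> * ?G \<rho>)" by (simp only: distrib_right mult.assoc)
    finally show ?thesis using True by simp
  qed simp
  have "ennreal (r\<^sup>2 * (?u r)\<^sup>2) \<le> ennreal (LINT \<rho>|lborel. ?H \<rho>)"
    unfolding f_int(2)[symmetric] by (intro ennreal_leI integral_mono f_int(1) H_int le)
  also have "\<dots> = (\<integral>\<^sup>+\<rho>. ennreal (?H \<rho>) \<partial>lborel)"
    by (rule nn_integral_eq_integral[symmetric, OF H_int]) (use H_nn in simp)
  also have "\<dots> = (\<integral>\<^sup>+\<rho>. ennreal (2 + r) * (ennreal (\<rho> * ?G \<rho>) * indicator {0<..<r} \<rho>) \<partial>lborel)"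
  proof (rule nn_integral_cong_AE)
    show "AE \<rho> in lborel. ennreal (?H \<rho>) = ennreal (2 + r) * (ennreal (\<rho> * ?G \<rho>) * indicator {0<..<r} \<rho>)"
      using AE_lborel_singleton[of 0] AE_lborel_singleton[of r]
    proof eventually_elim
      case (elim \<rho>)
      show ?case
      proof (cases "\<rho> \<in> {0<..<r}")
        case True
        then have "ennreal ((2 + r) * (\<rho> * ?G \<rho>)) = ennreal (2 + r) * ennreal (\<rho> * ?G \<rho>)"
          using r G_nn[of \<rho>] by (intro ennreal_mult) auto
        then show ?thesis using True by simp
      next
        case False
        then show ?thesis using elim by auto
      qed
    qed
  qed
  also have "\<dots> = ennreal (2 + r) * (\<integral>\<^sup>+\<rho>. ennreal (\<rho> * ?G \<rho>) * indicator {0<..<r} \<rho> \<partial>lborel)"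
  proof (rule nn_integral_cmult)
    have "continuous_on UNIV (\<lambda>\<rho>. \<rho> * ?G \<rho>)" by (intro continuous_on_mult continuous_on_id cont_G)
    note [measurable] = borel_measurable_continuous_onI[OF this]
    show "(\<lambda>\<rho>. ennreal (\<rho> * ?G \<rho>) * indicator {0<..<r} \<rho>) \<in> borel_measurable lborel"
      by measurable
  qed
  finally show ?thesis unfolding circle_point_eq[of _ t, symmetric] .
qed

theorem trace_inequality:
  fixes \<psi> :: "real^2 \<Rightarrow> real"
  assumes \<psi>: "smooth \<psi>" and r: "0 < r"
  shows "(LINT x|hausdorff1_on (sphere 0 r). (\<psi> x)\<^sup>2)
    \<le> (2 + r) / r * (LINT x|lebesgue_on (ball 0 r). (\<psi> x)\<^sup>2 + gradient_sq \<psi> x)"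
proof -
  let ?M = "hausdorff1_on (sphere (0::real^2) r)" and ?G = "\<lambda>x. (\<psi> x)\<^sup>2 + gradient_sq \<psi> x"
  let ?L = "LINT x|lebesgue_on (ball 0 r). ?G x"
  let ?P = "\<lambda>t. \<integral>\<^sup>+\<rho>. ennreal (\<rho> * ?G (circle_point \<rho> t)) * indicator {0<..<r} \<rho> \<partial>lborel"
  have contG: "continuous_on S ?G" for S
    unfolding gradient_sq_def by (intro continuous_intros smooth_continuous_on \<psi> smooth_partial_deriv)
  have cont\<psi>: "continuous_on S (\<lambda>x. (\<psi> x)\<^sup>2)" for S
    by (intro continuous_intros smooth_continuous_on \<psi>)
  have G_nn: "0 \<le> ?G x" for x unfolding gradient_sq_def by (intro add_nonneg_nonneg sum_nonneg) auto
  let ?c = "ennreal ((2 + r) / r\<^sup>2)"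
  have "(\<integral>\<^sup>+x. ennreal ((\<psi> x)\<^sup>2) \<partial>?M)
      \<le> ennreal r * (\<integral>\<^sup>+t. ennreal ((\<psi> (circle_point r t))\<^sup>2) * indicator {0..<2*pi} t \<partial>lborel)"
    by (rule nn_integral_hausdorff1_sphere_le[OF r cont\<psi>]) simp
  also have "\<dots> \<le> ennreal r * (\<integral>\<^sup>+t. ?c * (?P t * indicator {0<..<2*pi} t) \<partial>lborel)"
  proof (intro mult_left_mono nn_integral_mono_AE)
    show "AE t in lborel. ennreal ((\<psi> (circle_point r t))\<^sup>2) * indicator {0..<2*pi} t \<le> ?c * (?P t * indicator {0<..<2*pi} t)"
      using AE_lborel_singleton[of 0]
    proof eventually_elim
      case (elim t)
      have "ennreal ((\<psi> (circle_point r t))\<^sup>2) = ennreal (1 / r\<^sup>2) * ennreal (r\<^sup>2 * (\<psi> (circle_point r t))\<^sup>2)"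
        using r by (simp add: ennreal_mult[symmetric])
      also have "\<dots> \<le> ennreal (1 / r\<^sup>2) * (ennreal (2 + r) * ?P t)"
        by (intro mult_left_mono radial_inequality[OF \<psi> r]) simp
      also have "\<dots> = ?c * ?P t"
      proof -
        have "ennreal (1 / r\<^sup>2) * ennreal (2 + r) = ?c"
          using r by (subst ennreal_mult[symmetric]) auto
        then show ?thesis by (simp only: mult.assoc[symmetric])
      qed
      finally show ?case using elim by (auto simp: indicator_def)
    qed
  qed simp
  also have "\<dots> = ennreal r * (?c * (\<integral>\<^sup>+t. ?P t * indicator {0<..<2*pi} t \<partial>lborel))"
  proof -
    have "continuous_on UNIV (\<lambda>p::real\<times>real. circle_point (snd p) (fst p))"
      unfolding circle_point_axis by (intro continuous_intros)
    then have "continuous_on UNIV (\<lambda>p::real\<times>real. snd p * ?G (circle_point (snd p) (fst p)))"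
      by (intro continuous_on_mult continuous_on_snd continuous_on_id continuous_on_compose2[OF contG[of UNIV]]) auto
    then have [measurable]: "(\<lambda>p::real\<times>real. snd p * ?G (circle_point (snd p) (fst p))) \<in> borel_measurable (borel \<Otimes>\<^sub>M borel)"
      unfolding borel_prod by (rule borel_measurable_continuous_onI)
    have "(\<lambda>(t, \<rho>). ennreal (\<rho> * ?G (circle_point \<rho> t)) * indicator {0<..<r} \<rho>) \<in> borel_measurable (lborel \<Otimes>\<^sub>M lborel)"
      unfolding case_prod_unfold by measurable
    then have "?P \<in> borel_measurable lborel" by (rule lborel.borel_measurable_nn_integral)
    then show ?thesis by (subst nn_integral_cmult) auto
  qed
  also have "\<dots> \<le> ennreal r * (?c * (\<integral>\<^sup>+x. ennreal (?G x) * indicator (ball 0 r) x \<partial>lborel))"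
    by (intro mult_left_mono polar_coordinates_le[OF contG G_nn r]) auto
  also have "(\<integral>\<^sup>+x. ennreal (?G x) * indicator (ball 0 r) x \<partial>lborel) = ennreal ?L"
  proof -
    have "integrable lborel (\<lambda>x. indicator (cball 0 r) x *\<^sub>R ?G x)"
      by (intro borel_integrable_compact contG) auto
    then have "integrable lborel (\<lambda>x. indicator (ball 0 r) x *\<^sub>R (indicator (cball 0 r) x *\<^sub>R ?G x))"
      by (rule integrable_mult_indicator[rotated]) simp
    also have "(\<lambda>x. indicator (ball 0 r) x *\<^sub>R (indicator (cball 0 r) x *\<^sub>R ?G x)) = (\<lambda>x. indicator (ball 0 r) x * ?G x)"
      by (auto simp: indicator_def fun_eq_iff)
    finally have int: "integrable lborel (\<lambda>x. indicator (ball 0 r) x * ?G x)" .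
    have "(\<integral>\<^sup>+x. ennreal (?G x) * indicator (ball 0 r) x \<partial>lborel) = (\<integral>\<^sup>+x. ennreal (indicator (ball 0 r) x * ?G x) \<partial>lborel)"
      by (intro nn_integral_cong) (auto simp: indicator_def)
    also have "\<dots> = ennreal (LINT x|lborel. indicator (ball 0 r) x * ?G x)"
      using int G_nn by (intro nn_integral_eq_integral) (auto simp: indicator_def)
    also have "(LINT x|lborel. indicator (ball 0 r) x * ?G x) = ?L"
      by (subst integral_lebesgue_on) (simp_all only: integral_completion[OF borel_measurable_integrable[OF int]]
            lmeasurable_ball fmeasurableD)
    finally show ?thesis .
  qed
  also have "ennreal r * (?c * ennreal ?L)
      = ennreal ((2 + r) / r * ?L)"
  proof -
    have prod: "ennreal a * (ennreal b * ennreal c) = ennreal (a * (b * c))" if "0 \<le> a" "0 \<le> b" "0 \<le> c" for a b c :: real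
      using that by (simp add: ennreal_mult)
    have "0 \<le> ?L" by (rule integral_nonneg_AE) (use G_nn in simp)
    then have "ennreal r * (?c * ennreal ?L)
        = ennreal (r * ((2 + r) / r\<^sup>2 * ?L))"
      using r by (intro prod) auto
    also have "r * ((2 + r) / r\<^sup>2 * ?L)
        = (2 + r) / r * ?L"
      using r by (simp add: power2_eq_square)
    finally show ?thesis .
  qed
  finally have le: "(\<integral>\<^sup>+x. ennreal ((\<psi> x)\<^sup>2) \<partial>?M) \<le> ennreal ((2 + r) / r * ?L)" .
  have "0 \<le> (2 + r) / r * ?L"
    using r by (intro mult_nonneg_nonneg integral_nonneg_AE) (use G_nn in auto)
  then show ?thesis using le by (rule integral_real_bounded)
qed

section \<open>Traces of locally constant functions\<close>

lemma integral_lebesgue_on_mono_set: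
  fixes F :: "'a::euclidean_space \<Rightarrow> real"
  assumes A: "A \<in> sets lebesgue" and B: "B \<in> sets lebesgue" and "A \<subseteq> B"
    and int: "integrable (lebesgue_on B) F" and nonneg: "\<And>x. 0 \<le> F x"
  shows "(LINT x|lebesgue_on A. F x) \<le> (LINT x|lebesgue_on B. F x)"
proof -
  have intB: "integrable lebesgue (\<lambda>x. indicator B x * F x)"
    using int by (simp add: integrable_lebesgue_on[OF B])
  have "integrable lebesgue (\<lambda>x. indicator A x *\<^sub>R (indicator B x * F x))"
    by (rule integrable_mult_indicator[OF A intB])
  also have "(\<lambda>x. indicator A x *\<^sub>R (indicator B x * F x)) = (\<lambda>x. indicator A x * F x)"
    using assms(3) by (auto simp: indicator_def fun_eq_iff)
  finally have intA: "integrable lebesgue (\<lambda>x. indicator A x * F x)" .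
  show ?thesis unfolding integral_lebesgue_on[OF A] integral_lebesgue_on[OF B]
    using assms(3) nonneg by (intro integral_mono intA intB) (auto simp: indicator_def)
qed

lemma weak_deriv_eq_locally:
  fixes g f :: "real^'n \<Rightarrow> real"
  assumes A: "open A" and \<Omega>: "open \<Omega>" "A \<subseteq> \<Omega>" and g: "g \<in> H1 \<Omega>" and f: "smooth f"
    and eq: "AE x in lebesgue_on A. g x = f x"
  shows "AE x in lebesgue_on A. weak_deriv \<Omega> i g x = partial_deriv i f x"
proof (rule has_weak_deriv_unique[OF A])
  have A': "A \<in> sets lebesgue" "\<Omega> \<in> sets lebesgue" using A \<Omega> by auto
  show g': "has_weak_deriv A i g (weak_deriv \<Omega> i g)"
    by (rule has_weak_deriv_mono[OF A' \<Omega>(2) H1D(2)[OF \<Omega>(1) g]])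
  show "has_weak_deriv A i g (partial_deriv i f)"
    by (rule has_weak_deriv_AE[OF A'(1) smooth_has_weak_deriv[OF A'(1) f] AE_sym[OF eq]]) simp
qed

lemma H1_norm_sq:
  "(H1_norm \<Omega> f)\<^sup>2 = L2_sq \<Omega> f + (\<Sum>i\<in>UNIV. L2_sq \<Omega> (weak_deriv \<Omega> i f))"
  unfolding H1_norm_def by (intro real_sqrt_pow2 add_nonneg_nonneg sum_nonneg integral_nonneg_AE) auto

text \<open>
  If \<open>g\<close> equals \<open>b\<close> on the disc, then \<open>\<phi> - b\<close> agrees there with \<open>\<phi> - g\<close>, weak derivatives included, so the
  trace inequality bounds it on the circle by the distance of \<open>\<phi>\<close> to \<open>g\<close> in \<open>H1\<close>.
\<close>

lemma trace_difference_le: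
  fixes g \<phi> :: "real^2 \<Rightarrow> real"
  assumes r: "0 < r" "r \<le> R" and g: "g \<in> H1 (ball 0 R)"
    and const: "AE x in lebesgue_on (ball 0 r). g x = b"
    and \<phi>: "smooth \<phi>" "\<phi> \<in> H1 (ball 0 R)"
  shows "(LINT x|hausdorff1_on (sphere 0 r). (b - \<phi> x)\<^sup>2)
      \<le> (2 + r) / r * (H1_norm (ball 0 R) (\<lambda>x. g x - \<phi> x))\<^sup>2"
proof -
  let ?\<Omega> = "ball (0::real^2) R" and ?A = "ball (0::real^2) r"
  let ?d = "\<lambda>x. 1 * g x + -1 * \<phi> x"
  define \<psi> where "\<psi> x = \<phi> x + - b" for x
  have sub: "?A \<subseteq> ?\<Omega>" using r by auto
  have ms: "?A \<in> sets lebesgue" "?\<Omega> \<in> sets lebesgue" by auto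
  have \<psi>: "smooth \<psi>" unfolding \<psi>_def by (rule smooth_add[OF \<phi>(1) smooth_const])
  have pd: "partial_deriv i \<psi> = partial_deriv i \<phi>" for i
    unfolding \<psi>_def
    by (simp only: partial_deriv_add[OF smooth_differentiable[OF \<phi>(1)] differentiable_const] partial_deriv_const)
       simp
  have dH: "?d \<in> H1 ?\<Omega>" by (rule H1_lincomb(1)[OF open_ball g \<phi>(2)])
  let ?F = "\<lambda>x. (?d x)\<^sup>2 + (\<Sum>i\<in>UNIV. (weak_deriv ?\<Omega> i ?d x)\<^sup>2)"
  have F_int: "integrable (lebesgue_on ?\<Omega>) ?F"
    by (intro Bochner_Integration.integrable_add Bochner_Integration.integrable_sum
        L2D(2)[OF H1D(1)[OF open_ball dH]] L2D(2)[OF H1D(3)[OF open_ball dH]])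
  have grad: "AE x in lebesgue_on ?A. weak_deriv ?\<Omega> i ?d x = - partial_deriv i \<phi> x" for i
    using AE_lebesgue_on_subset[OF ms sub H1_lincomb(2)[OF open_ball g \<phi>(2), where i = i and a = 1 and b = "-1"]]
      weak_deriv_eq_locally[OF open_ball open_ball sub g smooth_const const, where i = i]
      AE_lebesgue_on_subset[OF ms sub smooth_weak_deriv[OF open_ball \<phi>(1), where i = i]]
    by eventually_elim (simp add: partial_deriv_const)
  have AE: "AE x in lebesgue_on ?A. (\<psi> x)\<^sup>2 + gradient_sq \<psi> x = ?F x"
    using const grad[of 1] grad[of 2]
    by eventually_elim (simp add: \<psi>_def gradient_sq_def UNIV_2 pd power2_commute)
  have meas: "(\<lambda>x. (\<psi> x)\<^sup>2 + gradient_sq \<psi> x) \<in> borel_measurable (lebesgue_on ?A)"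
  proof (intro measurable_restrict_space1 measurable_completion)
    have "continuous_on UNIV (\<lambda>x. (\<psi> x)\<^sup>2 + gradient_sq \<psi> x)"
      unfolding gradient_sq_def by (intro continuous_intros smooth_continuous_on \<psi> smooth_partial_deriv)
    then show "(\<lambda>x. (\<psi> x)\<^sup>2 + gradient_sq \<psi> x) \<in> borel_measurable lborel"
      by (simp add: borel_measurable_continuous_onI)
  qed
  have "(LINT x|hausdorff1_on (sphere 0 r). (b - \<phi> x)\<^sup>2) = (LINT x|hausdorff1_on (sphere 0 r). (\<psi> x)\<^sup>2)"
    by (simp add: \<psi>_def power2_commute)
  also have "\<dots> \<le> (2 + r) / r * (LINT x|lebesgue_on ?A. (\<psi> x)\<^sup>2 + gradient_sq \<psi> x)"
    by (rule trace_inequality[OF \<psi> r(1)])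
  also have "(LINT x|lebesgue_on ?A. (\<psi> x)\<^sup>2 + gradient_sq \<psi> x) = (LINT x|lebesgue_on ?A. ?F x)"
    by (rule integral_cong_AE[OF meas measurable_lebesgue_on_AE[OF ms(1) meas AE] AE])
  also have "\<dots> \<le> (LINT x|lebesgue_on ?\<Omega>. ?F x)"
    by (rule integral_lebesgue_on_mono_set[OF ms sub F_int]) (intro add_nonneg_nonneg sum_nonneg, auto)
  also have "\<dots> = (H1_norm ?\<Omega> ?d)\<^sup>2"
    unfolding H1_norm_sq
    using L2D(2)[OF H1D(1)[OF open_ball dH]] L2D(2)[OF H1D(3)[OF open_ball dH]]
    by (subst Bochner_Integration.integral_add) (auto simp: Bochner_Integration.integral_sum)
  also have "?d = (\<lambda>x. g x - \<phi> x)" by simp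
  finally show ?thesis using r(1) by (simp add: divide_right_mono mult_left_mono)
qed

lemma square_integrable_hausdorff1_sphere:
  fixes f :: "real^2 \<Rightarrow> real"
  assumes r: "0 < r" and f: "continuous_on UNIV f"
  shows "f \<in> borel_measurable (hausdorff1_on (sphere 0 r))"
    and "integrable (hausdorff1_on (sphere 0 r)) (\<lambda>x. (f x)\<^sup>2)"
proof -
  let ?M = "hausdorff1_on (sphere (0::real^2) r)"
  interpret finite_measure ?M by (rule finite_measure_hausdorff1_sphere[OF r])
  have meas: "g \<in> borel_measurable ?M" if "continuous_on UNIV g" for g :: "real^2 \<Rightarrow> real"
  proof -
    have "g \<in> borel_measurable (restrict_space borel (sphere 0 r))"
      by (rule measurable_restrict_space1[OF borel_measurable_continuous_onI[OF that]])
    then show ?thesis by (simp cong: measurable_cong_sets)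
  qed
  show "f \<in> borel_measurable ?M" by (rule meas[OF f])
  have cont2: "continuous_on UNIV (\<lambda>x. (f x)\<^sup>2)" using f by (intro continuous_intros)
  have "bounded ((\<lambda>x. (f x)\<^sup>2) ` sphere 0 r)"
    by (intro compact_imp_bounded compact_continuous_image continuous_on_subset[OF cont2]) auto
  then obtain B where "\<forall>x\<in>sphere 0 r. norm ((f x)\<^sup>2) \<le> B" unfolding bounded_iff by blast
  then show "integrable ?M (\<lambda>x. (f x)\<^sup>2)"
    by (intro integrable_const_bound[of _ B] meas cont2 AE_I2) auto
qed

text \<open>
  Every trace on the circle bounding the disc where the function is constant agrees with that
  constant almost everywhere; hence the choice made by \<open>trace_on\<close> does not affect the integral.
\<close>

lemma integral_is_trace:
  fixes g :: "real^2 \<Rightarrow> real"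
  assumes r: "0 < r" "r \<le> R" and const: "AE x in lebesgue_on (ball 0 r). g x = b"
    and tr: "is_trace (ball 0 R) (sphere 0 r) g t"
  shows "(LINT x|hausdorff1_on (sphere 0 r). t x) = b * measure (hausdorff1_on (sphere (0::real^2) r)) (sphere 0 r)"
proof -
  let ?M = "hausdorff1_on (sphere (0::real^2) r)" and ?\<Omega> = "ball (0::real^2) R"
  obtain \<phi> where g: "g \<in> H1 ?\<Omega>" and t: "t \<in> borel_measurable ?M" "integrable ?M (\<lambda>x. (t x)\<^sup>2)"
    and \<phi>: "\<And>n. smooth (\<phi> n)" "\<And>n. \<phi> n \<in> H1 ?\<Omega>"
    and lim: "(\<lambda>n. H1_norm ?\<Omega> (\<lambda>x. g x - \<phi> n x)) \<longlonglongrightarrow> 0"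
      "(\<lambda>n. LINT x|?M. (t x - \<phi> n x)\<^sup>2) \<longlonglongrightarrow> 0"
    using tr unfolding is_trace_def by blast
  note sq = square_integrable_hausdorff1_sphere[OF r(1)]
  note c = sq[OF continuous_on_const[of UNIV b]]
  note p = sq[OF smooth_continuous_on[OF \<phi>(1)]]
  let ?I = "LINT x|?M. (1 * t x + -1 * b)\<^sup>2"
  let ?h = "\<lambda>n. H1_norm ?\<Omega> (\<lambda>x. g x - \<phi> n x)"
  have "?I \<le> 2 * (LINT x|?M. (t x - \<phi> n x)\<^sup>2) + 2 * ((2 + r) / r * (?h n)\<^sup>2)" for n
  proof -
    note s1 = square_integrable_lincomb[OF t(1) p(1)[of n] t(2) p(2)[of n], where a = 1 and b = "-1"]
    note s2 = square_integrable_lincomb[OF c(1) p(1)[of n] c(2) p(2)[of n], where a = 1 and b = "-1"]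
    have "(\<lambda>x. 1 * t x + -1 * \<phi> n x) \<in> borel_measurable ?M" "(\<lambda>x. 1 * b + -1 * \<phi> n x) \<in> borel_measurable ?M"
      using t(1) p(1)[of n] by simp_all
    from square_integrable_lincomb(2)[OF this s1(1) s2(1), where a = 1 and b = "-1"]
      trace_difference_le[OF r g const \<phi>, of n]
    show ?thesis by simp
  qed
  moreover have "(\<lambda>n. 2 * (LINT x|?M. (t x - \<phi> n x)\<^sup>2) + 2 * ((2 + r) / r * (?h n)\<^sup>2))
      \<longlonglongrightarrow> 2 * 0 + 2 * ((2 + r) / r * 0\<^sup>2)"
    by (intro tendsto_add tendsto_mult tendsto_const tendsto_power lim)
  ultimately have "?I \<le> 0" by (intro LIMSEQ_le_const[of _ 0]) auto
  moreover have "0 \<le> ?I" by (rule integral_nonneg_AE) simp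
  ultimately have "?I = 0" by linarith
  then have "AE x in ?M. (1 * t x + -1 * b)\<^sup>2 = 0"
    using square_integrable_lincomb(1)[OF t(1) c(1) t(2) c(2), of 1 "-1"]
    by (subst (asm) integral_nonneg_eq_0_iff_AE) auto
  then have "AE x in ?M. t x = b" by eventually_elim simp
  then have "(LINT x|?M. t x) = (LINT x|?M. b)"
    using t(1) by (intro integral_cong_AE) auto
  then show ?thesis by simp
qed

text \<open>The approximating functions are the derivatives of test functions converging to \<open>w\<close> in \<open>H2\<close>.\<close>

lemma is_trace_const:
  fixes w :: "real^2 \<Rightarrow> real"
  assumes r: "0 < r" "r \<le> R" and w: "w \<in> H2_0 (ball 0 R)"
    and const: "AE x in lebesgue_on (ball 0 r). weak_deriv (ball 0 R) i w x = b"
  shows "is_trace (ball 0 R) (sphere 0 r) (weak_deriv (ball 0 R) i w) (\<lambda>x. b)"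
proof -
  let ?M = "hausdorff1_on (sphere (0::real^2) r)" and ?\<Omega> = "ball (0::real^2) R"
  let ?g = "weak_deriv ?\<Omega> i w"
  have \<Omega>: "?\<Omega> \<in> sets lebesgue" by simp
  obtain \<phi> where wH: "w \<in> H2 ?\<Omega>" and \<phi>: "\<And>n. \<phi> n \<in> test_functions ?\<Omega>"
    and lim: "(\<lambda>n. H2_sq ?\<Omega> (\<lambda>x. 1 * w x + -1 * \<phi> n x)) \<longlonglongrightarrow> 0"
    by (rule H2_0D[OF w]) (rule that)
  let ?d = "\<lambda>n x. 1 * w x + -1 * \<phi> n x"
  let ?p = "\<lambda>n. partial_deriv i (\<phi> n)"
  have pH: "?p n \<in> H1 ?\<Omega>" for n
    by (rule test_function_H1[OF open_ball test_function_partial_deriv[OF \<phi>]])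
  have sm: "smooth (?p n)" for n
    by (rule smooth_partial_deriv[OF test_functionD(1)[OF \<phi>]])
  have g: "?g \<in> H1 ?\<Omega>" by (rule H2D(2)[OF wH])
  have le: "(H1_norm ?\<Omega> (\<lambda>x. ?g x - ?p n x))\<^sup>2 \<le> H2_sq ?\<Omega> (?d n)" for n
  proof -
    have dH: "?d n \<in> H2 ?\<Omega>"
      by (rule H2_lincomb(1)[OF open_ball wH test_function_H2(1)[OF open_ball \<phi>]])
    have AE: "AE x in lebesgue_on ?\<Omega>. weak_deriv ?\<Omega> i (?d n) x = ?g x - ?p n x"
      using H1_lincomb(2)[OF open_ball H2D(1)[OF wH] test_function_H1[OF open_ball \<phi>[of n]], where i = i and a = 1 and b = "-1"]
        smooth_weak_deriv[OF open_ball test_functionD(1)[OF \<phi>[of n]], where i = i]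
      by eventually_elim simp
    note H = H1_AE[OF open_ball H2D(2)[OF dH] AE]
    have "(H1_norm ?\<Omega> (\<lambda>x. ?g x - ?p n x))\<^sup>2 = L2_sq ?\<Omega> (weak_deriv ?\<Omega> i (?d n))
      + (\<Sum>j\<in>UNIV. L2_sq ?\<Omega> (weak_deriv ?\<Omega> j (weak_deriv ?\<Omega> i (?d n))))"
      unfolding H1_norm_sq
      using L2_AE(2)[OF \<Omega> H1D(1)[OF open_ball H2D(2)[OF dH]] AE]
        L2_AE(2)[OF \<Omega> H1D(3)[OF open_ball H2D(2)[OF dH]] AE_sym[OF H(2)]]
      by simp
    also have "\<dots> \<le> H2_sq ?\<Omega> (?d n)" by (rule H2_sq_ge(2))
    finally show ?thesis .
  qed
  have "(\<lambda>n. (H1_norm ?\<Omega> (\<lambda>x. ?g x - ?p n x))\<^sup>2) \<longlonglongrightarrow> 0"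
    by (rule tendsto_sandwich[OF _ _ tendsto_const lim])
       (intro always_eventually allI zero_le_power2 le)+
  then have "(\<lambda>n. sqrt ((H1_norm ?\<Omega> (\<lambda>x. ?g x - ?p n x))\<^sup>2)) \<longlonglongrightarrow> sqrt 0"
    by (rule tendsto_real_sqrt)
  then have lim1: "(\<lambda>n. H1_norm ?\<Omega> (\<lambda>x. ?g x - ?p n x)) \<longlonglongrightarrow> 0"
    by (simp add: tendsto_rabs_zero_iff)
  have "(\<lambda>n. (2 + r) / r * (H1_norm ?\<Omega> (\<lambda>x. ?g x - ?p n x))\<^sup>2) \<longlonglongrightarrow> (2 + r) / r * 0\<^sup>2"
    by (intro tendsto_mult tendsto_const tendsto_power lim1)
  then have bd: "(\<lambda>n. (2 + r) / r * (H1_norm ?\<Omega> (\<lambda>x. ?g x - ?p n x))\<^sup>2) \<longlonglongrightarrow> 0" by simp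
  have lim2: "(\<lambda>n. LINT x|?M. (b - ?p n x)\<^sup>2) \<longlonglongrightarrow> 0"
  proof (rule tendsto_sandwich[OF _ _ tendsto_const bd])
    show "\<forall>\<^sub>F n in sequentially. 0 \<le> (LINT x|?M. (b - ?p n x)\<^sup>2)"
      by (intro always_eventually allI integral_nonneg_AE) simp
    show "\<forall>\<^sub>F n in sequentially. (LINT x|?M. (b - ?p n x)\<^sup>2) \<le> (2 + r) / r * (H1_norm ?\<Omega> (\<lambda>x. ?g x - ?p n x))\<^sup>2"
      by (intro always_eventually allI trace_difference_le[OF r g const sm pH])
  qed
  show ?thesis
    unfolding is_trace_def
    using g square_integrable_hausdorff1_sphere[OF r(1) continuous_on_const[of UNIV b]] sm pH lim1 lim2
    by (intro conjI exI[of _ ?p]) auto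
qed

section \<open>The two functionals agree on admissible functions\<close>

lemma continuous_AE_eq_open:
  fixes f g :: "real^'n \<Rightarrow> real"
  assumes U: "open U" and f: "continuous_on U f" and g: "continuous_on U g"
    and AE: "AE x in lebesgue_on U. f x = g x" and x: "x \<in> U"
  shows "f x = g x"
proof (rule ccontr)
  assume ne: "f x \<noteq> g x"
  let ?V = "{x \<in> U. f x - g x \<noteq> 0}"
  have "?V = U \<inter> (\<lambda>x. f x - g x) -` (- {0})" by auto
  moreover have "open (U \<inter> (\<lambda>x. f x - g x) -` (- {0}))"
    by (rule continuous_open_preimage[OF continuous_on_diff[OF f g] U]) auto
  ultimately have "open ?V" by simp
  moreover have "?V \<noteq> {}" using ne x by auto
  ultimately have "\<not> negligible ?V" by (rule open_not_negligible)
  moreover have "AE x in lebesgue. x \<notin> ?V"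
    using AE U by (simp add: AE_lebesgue_on AE_completion_iff) 
  then have "?V \<in> null_sets lebesgue"
    using \<open>open ?V\<close> by (subst AE_iff_null_sets) auto
  ultimately show False by (simp add: negligible_iff_null_sets)
qed

text \<open>The shifted circle stays in the disc where \<open>w\<close> is affine, with slope \<open>b $ 1\<close> along \<open>e1\<close>.\<close>

lemma dipole_energy_eq:
  fixes w :: "real^2 \<Rightarrow> real"
  assumes h: "0 < h" "h < \<epsilon>" and "\<epsilon> \<le> R" and w: "w \<in> H2_0 (ball 0 R)"
    and affine: "AE x in lebesgue_on (ball 0 \<epsilon>). w x = b \<bullet> x + c"
  shows "dipole_energy E \<nu> s R \<epsilon> h w = elastic_energy E \<nu> w (ball 0 R)
    + s / (2 * pi) * (b $ 1) * (measure (hausdorff1_on (sphere (0::real^2) \<epsilon>)) (sphere 0 \<epsilon>) / \<epsilon>)"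
proof -
  let ?\<Omega> = "ball (0::real^2) R" and ?A = "ball (0::real^2) \<epsilon>"
  let ?S = "sphere (0::real^2) (\<epsilon> - h)"
  define v where "v = continuous_rep ?\<Omega> w"
  have sub: "?A \<subseteq> ?\<Omega>" using assms(3) by auto
  obtain v0 where "continuous_on UNIV v0" "AE x in lebesgue_on ?\<Omega>. v0 x = w x"
    using H2_0_continuous_representative[OF w] by blast
  then have "continuous_on ?\<Omega> v0 \<and> (AE x in lebesgue_on ?\<Omega>. v0 x = w x)"
    using continuous_on_subset by blast
  then have v: "continuous_on ?\<Omega> v \<and> (AE x in lebesgue_on ?\<Omega>. v x = w x)"
    unfolding v_def continuous_rep_def
    by (rule someI[where P = "\<lambda>v. continuous_on ?\<Omega> v \<and> (AE x in lebesgue_on ?\<Omega>. v x = w x)"])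
  have v_eq: "v x = b \<bullet> x + c" if "x \<in> ?A" for x
  proof (rule continuous_AE_eq_open[OF open_ball _ _ _ that])
    show "continuous_on ?A v" using v sub continuous_on_subset by blast
    show "continuous_on ?A (\<lambda>x. b \<bullet> x + c)" by (intro continuous_intros)
    have "AE x in lebesgue_on ?A. v x = w x"
      by (rule AE_lebesgue_on_subset[OF _ _ sub conjunct2[OF v]]) auto
    with affine show "AE x in lebesgue_on ?A. v x = b \<bullet> x + c" by eventually_elim simp
  qed
  have "(v (x + (h/2) *\<^sub>R e1) - v (x - (h/2) *\<^sub>R e1)) / h = b $ 1" if "x \<in> ?S" for x
  proof -
    have "norm x = \<epsilon> - h" using that by simp
    moreover have "norm (x + (h/2) *\<^sub>R e1) \<le> norm x + h/2" "norm (x - (h/2) *\<^sub>R e1) \<le> norm x + h/2"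
      using norm_triangle_ineq[of x "(h/2) *\<^sub>R e1"] norm_triangle_ineq4[of x "(h/2) *\<^sub>R e1"] h
      by (auto simp: norm_axis_1)
    ultimately have "x + (h/2) *\<^sub>R e1 \<in> ?A" "x - (h/2) *\<^sub>R e1 \<in> ?A" using h by auto
    then show ?thesis
      using h by (simp add: v_eq inner_add_right inner_diff_right inner_axis field_simps)
  qed
  then have "(LINT x|hausdorff1_on ?S. (v (x + (h/2) *\<^sub>R e1) - v (x - (h/2) *\<^sub>R e1)) / h)
      = (LINT x|hausdorff1_on ?S. b $ 1)"
    by (intro Bochner_Integration.integral_cong) auto
  also have "\<dots> = b $ 1 * measure (hausdorff1_on ?S) ?S" by simp
  finally have int: "(LINT x|hausdorff1_on ?S. (v (x + (h/2) *\<^sub>R e1) - v (x - (h/2) *\<^sub>R e1)) / h)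
      = b $ 1 * measure (hausdorff1_on ?S) ?S" .
  have "measure (hausdorff1_on ?S) ?S / (\<epsilon> - h) = measure (hausdorff1_on (sphere (0::real^2) \<epsilon>)) (sphere 0 \<epsilon>) / \<epsilon>"
    by (rule measure_hausdorff1_sphere) (use h in auto)
  moreover have "s / (2 * pi * (\<epsilon> - h)) * (b $ 1 * m) = s / (2 * pi) * (b $ 1) * (m / (\<epsilon> - h))" for m
    by simp
  ultimately show ?thesis
    unfolding dipole_energy_def v_def[symmetric] int by (simp only:)
qed

lemma dislocation_energy_eq:
  fixes w :: "real^2 \<Rightarrow> real"
  assumes \<epsilon>: "0 < \<epsilon>" "\<epsilon> \<le> R" and w: "w \<in> H2_0 (ball 0 R)"
    and affine: "AE x in lebesgue_on (ball 0 \<epsilon>). w x = b \<bullet> x + c"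
  shows "dislocation_energy E \<nu> s R \<epsilon> w = elastic_energy E \<nu> w (ball 0 R)
    + s / (2 * pi) * (b $ 1) * (measure (hausdorff1_on (sphere (0::real^2) \<epsilon>)) (sphere 0 \<epsilon>) / \<epsilon>)"
proof -
  let ?\<Omega> = "ball (0::real^2) R" and ?A = "ball (0::real^2) \<epsilon>"
  have wH: "w \<in> H1 ?\<Omega>" using w by (simp add: H2_0_def H2_def)
  have "?A \<subseteq> ?\<Omega>" using \<epsilon> by auto
  then have const: "AE x in lebesgue_on ?A. weak_deriv ?\<Omega> 1 w x = b $ 1"
    using weak_deriv_eq_locally[OF open_ball open_ball _ wH smooth_affine affine, where i = 1]
    by (simp add: partial_deriv_affine)
  have "is_trace ?\<Omega> (sphere 0 \<epsilon>) (weak_deriv ?\<Omega> 1 w) (trace_on ?\<Omega> (sphere 0 \<epsilon>) (weak_deriv ?\<Omega> 1 w))"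
    unfolding trace_on_def by (rule someI[where P = "is_trace _ _ _"], rule is_trace_const[OF \<epsilon> w const])
  then have "(LINT x|hausdorff1_on (sphere 0 \<epsilon>). trace_on ?\<Omega> (sphere 0 \<epsilon>) (weak_deriv ?\<Omega> 1 w) x)
      = b $ 1 * measure (hausdorff1_on (sphere (0::real^2) \<epsilon>)) (sphere 0 \<epsilon>)"
    by (rule integral_is_trace[OF \<epsilon> const])
  then show ?thesis unfolding dislocation_energy_def by simp
qed

section \<open>Strict convexity of the elastic energy\<close>

text \<open>The integrand of the elastic energy, as a function of the Hessian.\<close>

definition elastic_density :: "real \<Rightarrow> (2 \<Rightarrow> 2 \<Rightarrow> real) \<Rightarrow> real" where
  "elastic_density \<nu> H = (\<Sum>i\<in>UNIV. \<Sum>j\<in>UNIV. (H i j)\<^sup>2) - \<nu> * (\<Sum>i\<in>UNIV. H i i)\<^sup>2"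

lemma elastic_density_parallelogram:
  "elastic_density \<nu> (\<lambda>i j. 1/2 * A i j + 1/2 * B i j) + elastic_density \<nu> (\<lambda>i j. 1/2 * A i j + -1/2 * B i j)
    = 1/2 * (elastic_density \<nu> A + elastic_density \<nu> B)"
  by (simp add: elastic_density_def UNIV_2 power2_eq_square field_simps)

text \<open>
  The squared trace of a two by two matrix is at most twice its squared Frobenius norm. The factor on
  the left is positive if and only if \<open>\<nu> < 1/2\<close>.
\<close>

lemma elastic_density_ge:
  "min 1 (1 - 2 * \<nu>) * (\<Sum>i\<in>UNIV. \<Sum>j\<in>UNIV. (H i j)\<^sup>2) \<le> elastic_density \<nu> H"
proof -
  let ?N = "\<Sum>i\<in>UNIV. \<Sum>j\<in>UNIV. (H i j)\<^sup>2" and ?T = "(\<Sum>i\<in>UNIV. H i i)\<^sup>2"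
  have N: "0 \<le> ?N" by (intro sum_nonneg) auto
  have "2 * (H 1 1 * H 2 2) \<le> (H 1 1)\<^sup>2 + (H 2 2)\<^sup>2" using sum_squares_bound[of "H 1 1" "H 2 2"] by simp
  moreover have "0 \<le> (H 1 2)\<^sup>2" "0 \<le> (H 2 1)\<^sup>2" by auto
  moreover have "?T = (H 1 1)\<^sup>2 + (H 2 2)\<^sup>2 + 2 * (H 1 1 * H 2 2)"
    by (simp add: UNIV_2 power2_sum)
  moreover have "?N = (H 1 1)\<^sup>2 + (H 1 2)\<^sup>2 + ((H 2 1)\<^sup>2 + (H 2 2)\<^sup>2)"
    by (simp add: UNIV_2)
  ultimately have T: "?T \<le> 2 * ?N" by linarith
  show ?thesis
  proof (cases "0 \<le> \<nu>")
    case True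
    have "\<nu> * ?T \<le> \<nu> * (2 * ?N)" using T True by (rule mult_left_mono)
    moreover have "min 1 (1 - 2 * \<nu>) * ?N = ?N - \<nu> * (2 * ?N)" using True by (simp add: algebra_simps)
    ultimately show ?thesis unfolding elastic_density_def by linarith
  next
    case False
    have "\<nu> * ?T \<le> 0" using False by (intro mult_nonpos_nonneg) auto
    moreover have "min 1 (1 - 2 * \<nu>) * ?N = ?N" using False by simp
    ultimately show ?thesis unfolding elastic_density_def by linarith
  qed
qed

lemma elastic_energy_eq:
  "elastic_energy E \<nu> w A = 1/2 * ((1 + \<nu>) / E) *
    (LINT x|lebesgue_on A. elastic_density \<nu> (\<lambda>i j. weak_deriv A j (weak_deriv A i w) x))"
  by (simp add: elastic_energy_def elastic_density_def)

lemma elastic_density_integrable: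
  fixes w :: "real^2 \<Rightarrow> real"
  assumes "open A" "w \<in> H2 A"
  shows "integrable (lebesgue_on A) (\<lambda>x. elastic_density \<nu> (\<lambda>i j. weak_deriv A j (weak_deriv A i w) x))"
proof -
  let ?H = "\<lambda>i j. weak_deriv A j (weak_deriv A i w)"
  have L: "?H i j \<in> L2 A" for i j by (rule H1D(3)[OF assms(1) H2D(2)[OF assms(2)]])
  have "integrable (lebesgue_on A) (\<lambda>x. (?H 1 1 x + ?H 2 2 x)\<^sup>2)"
    using L2D(2)[OF L2_lincomb(1)[OF L[of 1 1] L[of 2 2], of 1 1]] by simp
  then show ?thesis
    unfolding elastic_density_def
    by (intro Bochner_Integration.integrable_diff Bochner_Integration.integrable_sum L2D(2)[OF L])
       (simp add: UNIV_2)
qed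

lemma elastic_energy_parallelogram:
  fixes u v :: "real^2 \<Rightarrow> real"
  assumes A: "open A" and u: "u \<in> H2 A" and v: "v \<in> H2 A"
  shows "elastic_energy E \<nu> (\<lambda>x. 1/2 * u x + 1/2 * v x) A + elastic_energy E \<nu> (\<lambda>x. 1/2 * u x + -1/2 * v x) A
    = 1/2 * (elastic_energy E \<nu> u A + elastic_energy E \<nu> v A)"
proof -
  let ?H = "\<lambda>w x i j. weak_deriv A j (weak_deriv A i w) x"
  let ?e = "\<lambda>w x. elastic_density \<nu> (?H w x)"
  let ?p = "\<lambda>x. 1/2 * u x + 1/2 * v x" and ?m = "\<lambda>x. 1/2 * u x + -1/2 * v x"
  note intg = elastic_density_integrable[OF A, where \<nu> = \<nu>]
  have pH: "?p \<in> H2 A" and mH: "?m \<in> H2 A" by (rule H2_lincomb(1)[OF A u v])+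
  have Hp: "AE x in lebesgue_on A. ?H ?p x i j = 1/2 * ?H u x i j + 1/2 * ?H v x i j" for i j
    by (rule H2_lincomb(2)[OF A u v])
  have Hm: "AE x in lebesgue_on A. ?H ?m x i j = 1/2 * ?H u x i j + -1/2 * ?H v x i j" for i j
    by (rule H2_lincomb(2)[OF A u v])
  have AE: "AE x in lebesgue_on A. ?e ?p x + ?e ?m x = 1/2 * (?e u x + ?e v x)"
    using Hp[of 1 1] Hp[of 1 2] Hp[of 2 1] Hp[of 2 2] Hm[of 1 1] Hm[of 1 2] Hm[of 2 1] Hm[of 2 2]
  proof eventually_elim
    case (elim x)
    have "?H ?p x = (\<lambda>i j. 1/2 * ?H u x i j + 1/2 * ?H v x i j)"
      using elim by (auto simp: fun_eq_iff forall_2)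
    moreover have "?H ?m x = (\<lambda>i j. 1/2 * ?H u x i j + -1/2 * ?H v x i j)"
      using elim by (auto simp: fun_eq_iff forall_2)
    ultimately show ?case by (simp only: elastic_density_parallelogram)
  qed
  have "(LINT x|lebesgue_on A. ?e ?p x) + (LINT x|lebesgue_on A. ?e ?m x) = (LINT x|lebesgue_on A. ?e ?p x + ?e ?m x)"
    by (rule Bochner_Integration.integral_add[OF intg[OF pH] intg[OF mH], symmetric])
  also have "\<dots> = (LINT x|lebesgue_on A. 1/2 * (?e u x + ?e v x))"
    by (rule integral_cong_AE[OF _ _ AE])
       (intro borel_measurable_integrable Bochner_Integration.integrable_add
          Bochner_Integration.integrable_mult_right intg pH mH u v)+
  also have "\<dots> = 1/2 * ((LINT x|lebesgue_on A. ?e u x) + (LINT x|lebesgue_on A. ?e v x))"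
    using intg[OF u] intg[OF v] by simp
  finally have eq: "(LINT x|lebesgue_on A. ?e ?p x) + (LINT x|lebesgue_on A. ?e ?m x)
      = 1/2 * ((LINT x|lebesgue_on A. ?e u x) + (LINT x|lebesgue_on A. ?e v x))" .
  define k where "k = 1/2 * ((1 + \<nu>) / E)"
  show ?thesis
    unfolding elastic_energy_eq k_def[symmetric] distrib_left[of k, symmetric] eq
    by (simp only: mult.left_commute)
qed

lemma elastic_energy_ge:
  fixes w :: "real^2 \<Rightarrow> real"
  assumes A: "open A" and w: "w \<in> H2 A" and "0 < E" "-1 < \<nu>"
  shows "1/2 * ((1 + \<nu>) / E) * (min 1 (1 - 2 * \<nu>) * hess_sq A w) \<le> elastic_energy E \<nu> w A"
proof -
  let ?H = "\<lambda>i j. weak_deriv A j (weak_deriv A i w)"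
  have L: "?H i j \<in> L2 A" for i j by (rule H1D(3)[OF A H2D(2)[OF w]])
  have sum: "integrable (lebesgue_on A) (\<lambda>x. \<Sum>i\<in>UNIV. \<Sum>j\<in>UNIV. (?H i j x)\<^sup>2)"
    by (intro Bochner_Integration.integrable_sum L2D(2)[OF L])
  have "min 1 (1 - 2 * \<nu>) * hess_sq A w
      = (LINT x|lebesgue_on A. min 1 (1 - 2 * \<nu>) * (\<Sum>i\<in>UNIV. \<Sum>j\<in>UNIV. (?H i j x)\<^sup>2))"
    unfolding hess_sq_def
    by (simp add: Bochner_Integration.integral_sum L2D(2)[OF L] Bochner_Integration.integrable_sum)
  also have "\<dots> \<le> (LINT x|lebesgue_on A. elastic_density \<nu> (\<lambda>i j. ?H i j x))"
    by (rule integral_mono[OF _ elastic_density_integrable[OF A w] elastic_density_ge])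
       (rule Bochner_Integration.integrable_mult_right[OF sum])
  finally show ?thesis
    unfolding elastic_energy_eq using assms(3,4) by (intro mult_left_mono) auto
qed

text \<open>
  Two minimisers of the elastic energy plus a linear term coincide: their midpoint would otherwise
  have smaller energy. Here \<open>lu\<close> and \<open>lv\<close> are the values of the linear term at \<open>u\<close> and \<open>v\<close>, hence
  \<open>(lu + lv) / 2\<close> its value at the midpoint, and \<open>m\<close> is the minimum.
\<close>

lemma minimizers_coincide:
  fixes u v :: "real^2 \<Rightarrow> real"
  assumes "0 < E" "-1 < \<nu>" "\<nu> < 1/2"
    and u: "u \<in> H2_0 (ball 0 R)" and v: "v \<in> H2_0 (ball 0 R)"
    and Fu: "elastic_energy E \<nu> u (ball 0 R) + lu = m"
    and Fv: "elastic_energy E \<nu> v (ball 0 R) + lv = m"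
    and mid: "m \<le> elastic_energy E \<nu> (\<lambda>x. 1/2 * u x + 1/2 * v x) (ball 0 R) + (lu + lv) / 2"
  shows "H2_norm (ball 0 R) (\<lambda>x. u x - v x) = 0"
proof -
  let ?\<Omega> = "ball (0::real^2) R" and ?d = "\<lambda>x. 1/2 * u x + -1/2 * v x"
  have cancel: "x \<le> 0" if "k * (m * x) \<le> 0" "0 < k" "0 < m" for k m x :: real
    using that by (simp add: mult_le_0_iff)
  have uH: "u \<in> H2 ?\<Omega>" and vH: "v \<in> H2 ?\<Omega>" using u v by (auto simp: H2_0_def)
  have dH0: "?d \<in> H2_0 ?\<Omega>" by (rule H2_0_lincomb[OF open_ball u v])
  then have dH: "?d \<in> H2 ?\<Omega>" by (simp add: H2_0_def)
  have "elastic_energy E \<nu> ?d ?\<Omega> \<le> 0"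
    using elastic_energy_parallelogram[OF open_ball uH vH, of E \<nu>] Fu Fv mid by argo
  then have "1/2 * ((1 + \<nu>) / E) * (min 1 (1 - 2 * \<nu>) * hess_sq ?\<Omega> ?d) \<le> 0"
    using elastic_energy_ge[OF open_ball dH assms(1,2)] by linarith
  moreover have "0 < 1/2 * ((1 + \<nu>) / E)" "0 < min 1 (1 - 2 * \<nu>)" using assms(1-3) by auto
  ultimately have "hess_sq ?\<Omega> ?d \<le> 0" by (rule cancel)
  then have "hess_sq ?\<Omega> ?d = 0" using hess_sq_nonneg[of ?\<Omega> ?d] by linarith
  then have zero: "H2_sq ?\<Omega> ?d = 0" by (rule H2_0_hess_zero_imp_zero[OF open_ball order_refl dH0])
  have "H2_sq ?\<Omega> (\<lambda>x. 1 * ?d x + 1 * ?d x) \<le> 2 * 1\<^sup>2 * H2_sq ?\<Omega> ?d + 2 * 1\<^sup>2 * H2_sq ?\<Omega> ?d"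
    by (rule H2_sq_lincomb_le[OF open_ball dH dH])
  moreover have "(\<lambda>x. 1 * ?d x + 1 * ?d x) = (\<lambda>x. u x - v x)" by (auto simp: fun_eq_iff)
  ultimately have "H2_sq ?\<Omega> (\<lambda>x. u x - v x) \<le> 0" using zero by simp
  then have "H2_sq ?\<Omega> (\<lambda>x. u x - v x) = 0" using H2_sq_nonneg[of ?\<Omega> "\<lambda>x. u x - v x"] by linarith
  then show ?thesis by (simp add: H2_norm_eq)
qed

section \<open>Convergence of the minimisers\<close>

theorem proposition3p5:
  fixes E \<nu> s \<epsilon> R :: real
    and W :: "real \<Rightarrow> real^2 \<Rightarrow> real" and W0 :: "real^2 \<Rightarrow> real"
  assumes "E > 0" and "-1 < \<nu>" and "\<nu> < 1/2"
    and "s \<noteq> 0" and "0 < \<epsilon>" and "\<epsilon> < R"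
    and "\<And>h. 0 < h \<Longrightarrow> h < \<epsilon> \<Longrightarrow>
           is_arg_min (dipole_energy E \<nu> s R \<epsilon> h) (\<lambda>w. w \<in> admissible \<epsilon> R) (W h)"
    and "is_arg_min (dislocation_energy E \<nu> s R \<epsilon>) (\<lambda>w. w \<in> admissible \<epsilon> R) W0"
  shows "((\<lambda>h. H2_norm (ball 0 R) (\<lambda>x. W h x - W0 x)) \<longlongrightarrow> 0) (at_right 0)
       \<and> ((\<lambda>h. dipole_energy E \<nu> s R \<epsilon> h (W h)) \<longlongrightarrow> dislocation_energy E \<nu> s R \<epsilon> W0) (at_right 0)"
proof -
  let ?\<Omega> = "ball (0::real^2) R" and ?A = "ball (0::real^2) \<epsilon>"
  let ?G = "\<lambda>w. elastic_energy E \<nu> w ?\<Omega>"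
  let ?D = "\<lambda>h. dipole_energy E \<nu> s R \<epsilon> h" and ?I = "dislocation_energy E \<nu> s R \<epsilon>"
  define \<kappa> where "\<kappa> = measure (hausdorff1_on (sphere (0::real^2) \<epsilon>)) (sphere 0 \<epsilon>) / \<epsilon>"
  define l where "l b = s / (2 * pi) * (b $ 1) * \<kappa>" for b :: "real^2"
  have R: "\<epsilon> \<le> R" using assms(6) by simp
  have D: "?D h w = ?G w + l b"
    if "0 < h" "h < \<epsilon>" "w \<in> H2_0 ?\<Omega>" "AE x in lebesgue_on ?A. w x = b \<bullet> x + c" for h w b c
    using dipole_energy_eq[OF that(1,2) R that(3,4)] by (simp add: l_def \<kappa>_def)
  have D0: "?I w = ?G w + l b"
    if "w \<in> H2_0 ?\<Omega>" "AE x in lebesgue_on ?A. w x = b \<bullet> x + c" for w b c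
    using dislocation_energy_eq[OF assms(5) R that] by (simp add: l_def \<kappa>_def)
  \<comment> \<open>\<open>D\<close> and \<open>D0\<close> have the same right-hand side, so the two functionals agree on the admissible class\<close>
  have same: "?D h w = ?I w" if h: "0 < h" "h < \<epsilon>" and w: "w \<in> admissible \<epsilon> R" for h w
  proof -
    obtain b c where bc: "w \<in> H2_0 ?\<Omega>" "AE x in lebesgue_on ?A. w x = b \<bullet> x + c"
      using w by (auto simp: admissible_def)
    show ?thesis using D[OF h bc] D0[OF bc] by simp
  qed
  have W0: "W0 \<in> admissible \<epsilon> R" and W0_min: "\<And>w. w \<in> admissible \<epsilon> R \<Longrightarrow> ?I W0 \<le> ?I w"
    using assms(8) by (auto simp: is_arg_min_def not_less)
  have main: "H2_norm ?\<Omega> (\<lambda>x. W h x - W0 x) = 0 \<and> ?D h (W h) = ?I W0" if h: "0 < h" "h < \<epsilon>" for h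
  proof -
    have Wh: "W h \<in> admissible \<epsilon> R" and "\<And>w. w \<in> admissible \<epsilon> R \<Longrightarrow> ?D h (W h) \<le> ?D h w"
      using assms(7)[OF h] by (auto simp: is_arg_min_def not_less)
    then have "?I (W h) \<le> ?I W0" using same[OF h Wh] same[OF h W0] W0 by fastforce
    then have eq: "?I (W h) = ?I W0" using W0_min[OF Wh] by simp
    obtain b c where u: "W h \<in> H2_0 ?\<Omega>" "AE x in lebesgue_on ?A. W h x = b \<bullet> x + c"
      using Wh by (auto simp: admissible_def)
    obtain b0 c0 where v: "W0 \<in> H2_0 ?\<Omega>" "AE x in lebesgue_on ?A. W0 x = b0 \<bullet> x + c0"
      using W0 by (auto simp: admissible_def)
    let ?p = "\<lambda>x. 1/2 * W h x + 1/2 * W0 x"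
    let ?b = "(1/2) *\<^sub>R (b + b0)" and ?c = "(c + c0) / 2"
    have p: "?p \<in> H2_0 ?\<Omega>" by (rule H2_0_lincomb[OF open_ball u(1) v(1)])
    have p_affine: "AE x in lebesgue_on ?A. ?p x = ?b \<bullet> x + ?c"
      using u(2) v(2) by eventually_elim (simp add: inner_add_left field_simps)
    then have "?p \<in> admissible \<epsilon> R" using p unfolding admissible_def by blast
    then have "?I W0 \<le> ?G ?p + l ?b" using W0_min D0[OF p p_affine] by fastforce
    moreover have "l ?b = (l b + l b0) / 2" by (simp add: l_def field_simps)
    ultimately have mid: "?I W0 \<le> ?G ?p + (l b + l b0) / 2" by simp
    have "H2_norm ?\<Omega> (\<lambda>x. W h x - W0 x) = 0"
    proof (rule minimizers_coincide[OF assms(1-3) u(1) v(1) _ _ mid])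
      show "?G (W h) + l b = ?I W0" using D0[OF u] eq by (rule trans[OF sym])
      show "?G W0 + l b0 = ?I W0" by (rule D0[OF v, symmetric])
    qed
    then show ?thesis using same[OF h Wh] eq by simp
  qed
  have ev: "\<forall>\<^sub>F h in at_right 0. 0 < h \<and> h < \<epsilon>"
    using assms(5) by (auto simp: eventually_at_right_field)
  show ?thesis
  proof (intro conjI tendsto_eventually)
    show "\<forall>\<^sub>F h in at_right 0. H2_norm ?\<Omega> (\<lambda>x. W h x - W0 x) = 0"
      using ev by eventually_elim (use main in blast)
    show "\<forall>\<^sub>F h in at_right 0. ?D h (W h) = ?I W0"
      using ev by eventually_elim (use main in blast)
  qed
qed

end
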